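(* Let $N\in\mathbb{N}$, let $\{p_{i,1}\}_{i=1}^N$ and $\{p_{i,2}\}_{i=1}^N$ be subsets of $[1,\infty)$, and let $\{(D_{i,1},\mathcal{D}_{i,1},\mu_{i,1})\}_{i=1}^N$ and $\{(D_{i,2},\mathcal{D}_{i,2},\mu_{i,2})\}_{i=1}^N$ be $\sigma$-finite separable measure spaces. Set $$Y:=\prod_{i=1}^NE^{p_{i,1},p_{i,2}}(D_{i,1}\times D_{i,2}).$$ If $X$ is a normed linear space that is isomorphic with a subspace of $Y$, then $X$ is $n$-good for every $n\in\mathbb{N}$. If $X$ is a retraction of $Y$, then there exists $\lambda\geq0$ such that $X$ has the $\lambda$-bounded approximation property.
   Context: For $p_1,p_2\in[1,\infty)$ and $\sigma$-finite separable measure spaces $(D_1,\mathcal{D}_1,\mu_1)$, $(D_2,\mathcal{D}_2,\mu_2)$ (separable: the $\sigma$-algebra is countably generated up to null sets), $E^{p_1,p_2}(D_1\times D_2)$ is the space of (classes of) jointly measurable functions $f:D_1\times D_2\to\mathbb{R}$ with $$\|f\|_{E^{p_1,p_2}(D_1\times D_2)}=\left(\int_{D_1}\left(\int_{D_2}|f(x,y)|^{p_2}\mu_2(dy)\right)^{\frac{p_1}{p_2}}\mu_1(dx)\right)^{\frac1{p_1}}<\infty,$$ i.e. $L^{p_1}(D_1;L^{p_2}(D_2))$. The finite product $Y$ carries the usual product norm (e.g. the sum of the norms). Wiener chaos: $V$ is a real separable Hilbert space, $(\Omega,\mathcal{F},\mathbb{P})$ carries a $V$-isonormal Gaussian process $(W(v))_{v\in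 V}$ generating $\mathcal{F}$ (augmented by the $\mathbb{P}$-zero sets); $H_k(x)=\frac{(-1)^k}{k!}e^{x^2/2}\frac{d^k}{dx^k}(e^{-x^2/2})$; $\mathcal{H}_k$ is the closed linear subspace of $L^2(\Omega)$ generated by $\{H_k(W(v)):\|v\|_V=1\}$; $\mathcal{H}^{\oplus n}=\bigoplus_{i=0}^n\mathcal{H}_i$. A normed space $X$ is $n$-good if there are finite positive constants $c_1,c_2$ such that $$c_1\left\|\sum_{k=1}^m\varepsilon^{(2)}_kx_k\right\|_{L^2(\Omega;X)}\le\left\|\sum_{k=1}^m\varepsilon^{(1)}_kx_k\right\|_{L^2(\Omega;X)}\le c_2\left\|\sum_{k=1}^m\varepsilon^{(2)}_kx_k\right\|_{L^2(\Omega;X)}$$ for every $m$, every two orthonormal sets $\{\varepsilon^{(1)}_k\}_{k=1}^m,\{\varepsilon^{(2)}_k\}_{k=1}^m\subseteq\mathcal{H}^{\oplus n}$ (orthonormal in $L^2(\Omega)$), and every $\{x_k\}_{k=1}^m\subseteq X$. $X$ is a retraction of $Y$ if there are bounded linear operators $R:Y\to X$ and $S:X\to Y$ with $RS=I_X$. $X$ has the $\lambda$-bounded approximation property if for every $\varepsilon>0$ and every compact $C\subseteq X$ there is a finite rank operator $T\in\mathcal{L}(X)$ with $\|T\|_{\mathcal{L}(X)}\le\lambda$ and $\sup_{x\in C}\|x-Tx\|_X\le\varepsilon$. *)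

theory Defs
  imports "HOL-Probability.Probability"
begin

section \<open>Normed spaces with explicit carriers\<close>

text \<open>
  The mixed-norm spaces below depend on measures and exponents, hence cannot be types.
  They are records with an explicit carrier; a normed space given as a type enters
  through \<open>type_nspace\<close>.
\<close>

record 'e nspace =
  vcarrier :: "'e set"
  vadd :: "'e \<Rightarrow> 'e \<Rightarrow> 'e"
  vscale :: "real \<Rightarrow> 'e \<Rightarrow> 'e"
  vnorm :: "'e \<Rightarrow> real"

definition type_nspace :: "'x::real_normed_vector nspace" where
  "type_nspace = \<lparr>vcarrier = UNIV, vadd = (+), vscale = scaleR, vnorm = norm\<rparr>"

definition bounded_linear_op :: "'e nspace \<Rightarrow> 'f nspace \<Rightarrow> ('e \<Rightarrow> 'f) \<Rightarrow> bool" where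
  "bounded_linear_op U V T \<longleftrightarrow>
     (\<forall>x\<in>vcarrier U. T x \<in> vcarrier V) \<and>
     (\<forall>x\<in>vcarrier U. \<forall>y\<in>vcarrier U. T (vadd U x y) = vadd V (T x) (T y)) \<and>
     (\<forall>c. \<forall>x\<in>vcarrier U. T (vscale U c x) = vscale V c (T x)) \<and>
     (\<exists>K. \<forall>x\<in>vcarrier U. vnorm V (T x) \<le> K * vnorm U x)"

definition linear_subspace_of :: "'e set \<Rightarrow> 'e nspace \<Rightarrow> bool" where
  "linear_subspace_of Z Y \<longleftrightarrow>
     Z \<subseteq> vcarrier Y \<and> Z \<noteq> {} \<and>
     (\<forall>x\<in>Z. \<forall>y\<in>Z. vadd Y x y \<in> Z) \<and>
     (\<forall>c. \<forall>x\<in>Z. vscale Y c x \<in> Z)"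

definition nspace_isomorphic :: "'e nspace \<Rightarrow> 'f nspace \<Rightarrow> bool" where
  "nspace_isomorphic U V \<longleftrightarrow>
     (\<exists>T T'. bounded_linear_op U V T \<and> bounded_linear_op V U T' \<and>
        (\<forall>x\<in>vcarrier U. T' (T x) = x) \<and> (\<forall>y\<in>vcarrier V. T (T' y) = y))"

definition isomorphic_with_subspace :: "'e nspace \<Rightarrow> 'f nspace \<Rightarrow> bool" where
  "isomorphic_with_subspace X Y \<longleftrightarrow>
     (\<exists>Z. linear_subspace_of Z Y \<and> nspace_isomorphic X (Y\<lparr>vcarrier := Z\<rparr>))"

definition retraction_of :: "'e nspace \<Rightarrow> 'f nspace \<Rightarrow> bool" where
  "retraction_of X Y \<longleftrightarrow>
     (\<exists>R S. bounded_linear_op Y X R \<and> bounded_linear_op X Y S \<and>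
        (\<forall>x\<in>vcarrier X. R (S x) = x))"

text \<open>Finite product, normed by the sum of the norms; tuples are extensional functions.\<close>

definition prod_nspace :: "'i set \<Rightarrow> ('i \<Rightarrow> 'e nspace) \<Rightarrow> ('i \<Rightarrow> 'e) nspace" where
  "prod_nspace I E =
     \<lparr>vcarrier = (\<Pi>\<^sub>E i\<in>I. vcarrier (E i)),
      vadd = (\<lambda>x y. \<lambda>i\<in>I. vadd (E i) (x i) (y i)),
      vscale = (\<lambda>c x. \<lambda>i\<in>I. vscale (E i) c (x i)),
      vnorm = (\<lambda>x. \<Sum>i\<in>I. vnorm (E i) (x i))\<rparr>"


section \<open>Mixed-norm spaces\<close>

text \<open>Countably generated up to null sets.\<close>

definition separable_measure :: "'a measure \<Rightarrow> bool" where
  "separable_measure M \<longleftrightarrow>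
     (\<exists>G. countable G \<and> G \<subseteq> sets M \<and>
        (\<forall>A\<in>sets M. \<exists>B\<in>sigma_sets (space M) G. (A - B) \<union> (B - A) \<in> null_sets M))"

text \<open>Power of an extended nonnegative number, meant for exponents \<open>a > 0\<close>.\<close>

definition ennpowr :: "ennreal \<Rightarrow> real \<Rightarrow> ennreal" where
  "ennpowr t a = (if t = \<infinity> then \<infinity> else ennreal (enn2real t powr a))"

definition mixed_integral ::
  "real \<Rightarrow> real \<Rightarrow> 'a measure \<Rightarrow> 'b measure \<Rightarrow> ('a \<times> 'b \<Rightarrow> real) \<Rightarrow> ennreal" where
  "mixed_integral p1 p2 M1 M2 f =
     (\<integral>\<^sup>+x. ennpowr (\<integral>\<^sup>+y. ennreal (\<bar>f (x, y)\<bar> powr p2) \<partial>M2) (p1 / p2) \<partial>M1)"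

definition mixed_norm ::
  "real \<Rightarrow> real \<Rightarrow> 'a measure \<Rightarrow> 'b measure \<Rightarrow> ('a \<times> 'b \<Rightarrow> real) \<Rightarrow> real" where
  "mixed_norm p1 p2 M1 M2 f = enn2real (mixed_integral p1 p2 M1 M2 f) powr (1 / p1)"

definition mixed_fun ::
  "real \<Rightarrow> real \<Rightarrow> 'a measure \<Rightarrow> 'b measure \<Rightarrow> ('a \<times> 'b \<Rightarrow> real) set" where
  "mixed_fun p1 p2 M1 M2 =
     {f \<in> borel_measurable (M1 \<Otimes>\<^sub>M M2). mixed_integral p1 p2 M1 M2 f < \<infinity>}"

definition mixed_class ::
  "real \<Rightarrow> real \<Rightarrow> 'a measure \<Rightarrow> 'b measure \<Rightarrow> ('a \<times> 'b \<Rightarrow> real) \<Rightarrow> ('a \<times> 'b \<Rightarrow> real) set" where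
  "mixed_class p1 p2 M1 M2 f =
     {g \<in> mixed_fun p1 p2 M1 M2. AE z in M1 \<Otimes>\<^sub>M M2. f z = g z}"

text \<open>
  The space of a.e.-equality classes.  As usual for quotients, the operations are unions
  over representatives of a family that does not depend on the representatives.
\<close>

definition mixed_space ::
  "real \<Rightarrow> real \<Rightarrow> 'a measure \<Rightarrow> 'b measure \<Rightarrow> ('a \<times> 'b \<Rightarrow> real) set nspace" where
  "mixed_space p1 p2 M1 M2 =
     \<lparr>vcarrier = mixed_class p1 p2 M1 M2 ` mixed_fun p1 p2 M1 M2,
      vadd = (\<lambda>A B. \<Union>f\<in>A. \<Union>g\<in>B. mixed_class p1 p2 M1 M2 (\<lambda>z. f z + g z)),
      vscale = (\<lambda>c A. \<Union>f\<in>A. mixed_class p1 p2 M1 M2 (\<lambda>z. c * f z)),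
      vnorm = (\<lambda>A. the_elem (mixed_norm p1 p2 M1 M2 ` A))\<rparr>"


section \<open>Isonormal Gaussian processes and Wiener chaos\<close>

text \<open>The zero variable counts as a (degenerate) centred Gaussian.\<close>

definition centered_gaussian :: "'w measure \<Rightarrow> ('w \<Rightarrow> real) \<Rightarrow> bool" where
  "centered_gaussian M X \<longleftrightarrow>
     X \<in> borel_measurable M \<and>
     ((AE \<omega> in M. X \<omega> = 0) \<or> (\<exists>\<sigma>>0. distributed M lborel X (\<lambda>x. ennreal (normal_density 0 \<sigma> x))))"

definition isonormal_process :: "'w measure \<Rightarrow> ('v::real_inner \<Rightarrow> 'w \<Rightarrow> real) \<Rightarrow> bool" where
  "isonormal_process M W \<longleftrightarrow>
     (\<forall>S c. finite S \<longrightarrow> centered_gaussian M (\<lambda>\<omega>. \<Sum>v\<in>S. c v * W v \<omega>)) \<and>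
     (\<forall>u v. (\<integral>\<omega>. W u \<omega> * W v \<omega> \<partial>M) = u \<bullet> v)"

definition generated_by_process :: "'w measure \<Rightarrow> ('v \<Rightarrow> 'w \<Rightarrow> real) \<Rightarrow> bool" where
  "generated_by_process M W \<longleftrightarrow>
     sets M = sigma_sets (space M)
       ({W v -` B \<inter> space M |v B. B \<in> sets borel} \<union> null_sets M)"

definition hermite :: "nat \<Rightarrow> real \<Rightarrow> real" where
  "hermite k x =
     (-1) ^ k / fact k * exp (x\<^sup>2 / 2) * (deriv ^^ k) (\<lambda>t. exp (- (t\<^sup>2) / 2)) x"

text \<open>
  Elements of \<open>L\<^sup>2(\<Omega>)\<close> are represented by functions here; the chaoses are closed under
  a.e. equality, so nothing depends on the choice of representatives.
\<close>

definition sq_integrable :: "'w measure \<Rightarrow> ('w \<Rightarrow> real) set" where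
  "sq_integrable M = {f \<in> borel_measurable M. integrable M (\<lambda>\<omega>. (f \<omega>)\<^sup>2)}"

definition L2_dist :: "'w measure \<Rightarrow> ('w \<Rightarrow> real) \<Rightarrow> ('w \<Rightarrow> real) \<Rightarrow> real" where
  "L2_dist M f g = sqrt (\<integral>\<omega>. (f \<omega> - g \<omega>)\<^sup>2 \<partial>M)"

definition fun_span :: "('w \<Rightarrow> real) set \<Rightarrow> ('w \<Rightarrow> real) set" where
  "fun_span G = {\<lambda>\<omega>. \<Sum>g\<in>F. c g * g \<omega> |F c. finite F \<and> F \<subseteq> G}"

definition L2_closed_span :: "'w measure \<Rightarrow> ('w \<Rightarrow> real) set \<Rightarrow> ('w \<Rightarrow> real) set" where
  "L2_closed_span M G = {f \<in> sq_integrable M. \<forall>\<epsilon>>0. \<exists>g\<in>fun_span G. L2_dist M f g < \<epsilon>}"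

definition wiener_chaos ::
  "'w measure \<Rightarrow> ('v::real_inner \<Rightarrow> 'w \<Rightarrow> real) \<Rightarrow> nat \<Rightarrow> ('w \<Rightarrow> real) set" where
  "wiener_chaos M W k = L2_closed_span M {\<lambda>\<omega>. hermite k (W v \<omega>) |v. norm v = 1}"

definition wiener_chaos_sum ::
  "'w measure \<Rightarrow> ('v::real_inner \<Rightarrow> 'w \<Rightarrow> real) \<Rightarrow> nat \<Rightarrow> ('w \<Rightarrow> real) set" where
  "wiener_chaos_sum M W n =
     {\<lambda>\<omega>. \<Sum>i\<le>n. h i \<omega> |h. \<forall>i\<le>n. h i \<in> wiener_chaos M W i}"


section \<open>Properties of a normed space\<close>

definition L2_orthonormal :: "'w measure \<Rightarrow> nat \<Rightarrow> (nat \<Rightarrow> 'w \<Rightarrow> real) \<Rightarrow> bool" where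
  "L2_orthonormal M m e \<longleftrightarrow>
     (\<forall>j\<in>{1..m}. \<forall>k\<in>{1..m}. (\<integral>\<omega>. e j \<omega> * e k \<omega> \<partial>M) = (if j = k then 1 else 0))"

text \<open>Norm of \<open>L\<^sup>2(\<Omega>;X)\<close>, applied only to functions for which the integral exists.\<close>

definition L2_norm :: "'w measure \<Rightarrow> ('w \<Rightarrow> 'x::real_normed_vector) \<Rightarrow> real" where
  "L2_norm M f = sqrt (\<integral>\<omega>. (norm (f \<omega>))\<^sup>2 \<partial>M)"

definition n_good ::
  "'w measure \<Rightarrow> ('v::real_inner \<Rightarrow> 'w \<Rightarrow> real) \<Rightarrow> nat \<Rightarrow> 'x::real_normed_vector itself \<Rightarrow> bool" where
  "n_good M W n (_ :: 'x itself) \<longleftrightarrow>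
     (\<exists>c1>0. \<exists>c2>0. \<forall>m e1 e2. \<forall>x :: nat \<Rightarrow> 'x.
        L2_orthonormal M m e1 \<and> L2_orthonormal M m e2 \<and>
        (\<forall>k\<in>{1..m}. e1 k \<in> wiener_chaos_sum M W n \<and> e2 k \<in> wiener_chaos_sum M W n) \<longrightarrow>
        c1 * L2_norm M (\<lambda>\<omega>. \<Sum>k=1..m. e2 k \<omega> *\<^sub>R x k)
          \<le> L2_norm M (\<lambda>\<omega>. \<Sum>k=1..m. e1 k \<omega> *\<^sub>R x k) \<and>
        L2_norm M (\<lambda>\<omega>. \<Sum>k=1..m. e1 k \<omega> *\<^sub>R x k)
          \<le> c2 * L2_norm M (\<lambda>\<omega>. \<Sum>k=1..m. e2 k \<omega> *\<^sub>R x k))"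

definition bounded_approximation_property ::
  "real \<Rightarrow> 'x::real_normed_vector itself \<Rightarrow> bool" where
  "bounded_approximation_property l (_ :: 'x itself) \<longleftrightarrow>
     (\<forall>\<epsilon>>0. \<forall>C :: 'x set. compact C \<longrightarrow>
        (\<exists>T :: 'x \<Rightarrow> 'x. bounded_linear T \<and> (\<exists>B. finite B \<and> range T \<subseteq> span B) \<and>
           onorm T \<le> l \<and> (\<forall>x\<in>C. norm (x - T x) \<le> \<epsilon>)))"

end

theory Submission
  imports Defs "HOL-Computational_Algebra.Polynomial"
begin

text \<open>
  Both halves rest on one analytic tool, Minkowski's integral inequality, which lets an average be
  pulled through a mixed norm.

  For the first claim, let \<open>e\<^sub>k\<close> be orthonormal in the first \<open>n\<close> chaoses and let \<open>x\<^sub>k\<close> be elements of a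
  mixed-norm space.  At every point \<open>z\<close> the random variable \<open>\<Sum> e\<^sub>k x\<^sub>k(z)\<close> belongs to the first \<open>n\<close>
  chaoses, and its second moment is \<open>G(z)\<^sup>2 = \<Sum> x\<^sub>k(z)\<^sup>2\<close>, whatever the orthonormal system.  On the
  first \<open>n\<close> chaoses all moments are comparable, with constants that depend only on \<open>n\<close> and on the order
  of the moments.  Moving the expectation across the mixed norm, from the inside out for the first
  moment (lemma \<open>norm_expectation_lower\<close>) and from the outside in for a moment of order at least both
  exponents (lemma \<open>norm_expectation_upper\<close>), shows that the norm of \<open>\<Sum> e\<^sub>k x\<^sub>k\<close> in \<open>L\<^sup>2\<close> is comparable to
  the norm of the square function \<open>G\<close>.  The latter does not mention the \<open>e\<^sub>k\<close>, so any two orthonormal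
  systems give comparable norms.  Finite products and isomorphic copies only change the constants.

  The comparison of moments is proved for polynomials in the variables \<open>W v\<close>.  After a change of basis
  the vectors \<open>v\<close> are orthonormal, and expanding in Hermite polynomials of one of these variables gives
  an induction on their number, as in Bonami's proof of hypercontractivity.  It bounds the fourth moment by
  the square of the second; squaring the polynomial doubles its degree, and iterating reaches all
  moments of order \<open>2\<^sup>k\<close>.  Fatou's lemma passes to the closure, and interpolating between the first and
  the fourth moment bounds the first moment from below.  The induction needs the moments of products
  of functions of orthogonal Gaussian variables to factorise.  This is read off from the fact that all the
  variables \<open>W (t b + u)\<close> are Gaussian, by comparing the coefficients of the powers of \<open>t\<close>.

  For the second claim, averaging over the cells of a finite partition into product sets is an
  operator of finite rank.  It is a contraction in every mixed norm, because it is given by symmetric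
  kernels of mass at most one.  It fixes the functions that are constant on the cells and vanish outside them, and linear
  combinations of rectangles are dense, so suitable averages are close to the identity on any finite
  set, hence on any compact set.  For a retract, given by \<open>R\<close> and \<open>S\<close>, compose these averages with \<open>S\<close> on the
  right and \<open>R\<close> on the left; the constant is a product of bounds for \<open>R\<close> and \<open>S\<close>.
\<close>

section \<open>Powers and Minkowski's integral inequality\<close>

lemma ennpowr_zero [simp]: "ennpowr 0 a = 0"
  by (simp add: ennpowr_def)

lemma ennpowr_top [simp]: "ennpowr \<infinity> a = \<infinity>" "ennpowr top a = top"
  by (simp_all add: ennpowr_def)

lemma ennpowr_ennreal: "0 \<le> x \<Longrightarrow> ennpowr (ennreal x) a = ennreal (x powr a)"
  by (simp add: ennpowr_def)

lemma ennpowr_one [simp]: "ennpowr t 1 = t"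
  by (cases t) (simp_all add: ennpowr_ennreal)

lemma ennpowr_one_base [simp]: "ennpowr 1 a = 1"
  using ennpowr_ennreal[of 1 a] by simp

lemma ennpowr_mono: "0 \<le> a \<Longrightarrow> s \<le> t \<Longrightarrow> ennpowr s a \<le> ennpowr t a"
  by (cases s; cases t) (auto simp: ennpowr_ennreal powr_mono2 top_unique)

lemma ennpowr_mult: "ennpowr (s * t) a = ennpowr s a * ennpowr t a"
proof (cases s; cases t)
  fix x y :: real assume "s = ennreal x" "0 \<le> x" "t = ennreal y" "0 \<le> y"
  then show ?thesis
    by (simp add: ennreal_mult[symmetric] ennpowr_ennreal powr_mult)
qed (auto simp: ennpowr_ennreal ennreal_mult_top ennreal_top_mult)

lemma ennpowr_ennpowr: "ennpowr (ennpowr t a) b = ennpowr t (a * b)"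
  by (cases t) (simp_all add: ennpowr_ennreal powr_powr)

lemma ennpowr_eq_0_iff [simp]: "ennpowr t a = 0 \<longleftrightarrow> t = 0"
  by (cases t) (auto simp: ennpowr_ennreal)

lemma ennpowr_eq_top_iff [simp]: "ennpowr t a = \<infinity> \<longleftrightarrow> t = \<infinity>" "ennpowr t a = top \<longleftrightarrow> t = top"
  by (cases t; auto simp: ennpowr_ennreal)+

lemma ennpowr_less_top_iff [simp]: "ennpowr t a < \<infinity> \<longleftrightarrow> t < \<infinity>" "ennpowr t a < top \<longleftrightarrow> t < top"
  by (simp_all only: less_top[symmetric] infinity_ennreal_def ennpowr_eq_top_iff simp_thms top.not_eq_extremum[symmetric])

lemma measurable_ennpowr [measurable]: "(\<lambda>t. ennpowr t a) \<in> borel_measurable borel"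
  unfolding ennpowr_def by measurable

text \<open>Continuity of powers is only used at \<open>0\<close>, where it follows from monotonicity.\<close>
lemma tendsto_ennpowr_0:
  assumes "(u \<longlongrightarrow> 0) F" "0 < a"
  shows "((\<lambda>i. ennpowr (u i) a) \<longlongrightarrow> 0) F"
proof (rule order_tendstoI)
  fix e :: ennreal assume "0 < e"
  then obtain d where d: "0 < d" "d < e" using dense by blast
  then have "0 < ennpowr d (1 / a)" by (simp add: zero_less_iff_neq_zero)
  with assms(1) have "eventually (\<lambda>i. u i < ennpowr d (1 / a)) F" by (rule order_tendstoD)
  then show "eventually (\<lambda>i. ennpowr (u i) a < e) F"
  proof eventually_elim
    case (elim i)
    then have "ennpowr (u i) a \<le> ennpowr (ennpowr d (1 / a)) a"
      using assms(2) by (intro ennpowr_mono) auto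
    then show ?case using assms(2) d by (simp add: ennpowr_ennpowr)
  qed
qed simp

text \<open>The convex function \<open>u\<^sup>p\<close> lies above its tangent at \<open>c\<close>.  The subtracted terms are moved to the other
  side, so that the inequality makes sense for extended nonnegative \<open>u\<close>.\<close>
lemma tangent_powr:
  fixes c p :: real and u :: ennreal
  assumes "1 \<le> p" "0 < c"
  shows "ennreal (p * c powr (p - 1)) * u \<le> ennreal ((p - 1) * c powr p) + ennpowr u p"
proof (cases u)
  case (real x)
  have "p * (x / c) \<le> (p - 1) + (x / c) powr p"
  proof (cases "x = 0")
    case False
    have "((x / c) powr p) powr (1 / p) * 1 powr (1 - 1 / p)
        \<le> 1 / p * (x / c) powr p + (1 - 1 / p) * 1"
      using real assms False by (intro Youngs_inequality_0) auto
    then have "x / c \<le> 1 / p * (x / c) powr p + (1 - 1 / p)"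
      using real assms by (simp add: powr_powr)
    then have "p * (x / c) \<le> p * (1 / p * (x / c) powr p + (1 - 1 / p))"
      using assms by (intro mult_left_mono) auto
    also have "\<dots> = (p - 1) + (x / c) powr p"
      using assms by (simp add: distrib_left right_diff_distrib)
    finally show ?thesis .
  qed (use assms in auto)
  then have "c powr p * (p * (x / c)) \<le> c powr p * ((p - 1) + (x / c) powr p)"
    by (intro mult_left_mono) auto
  moreover have "c powr p = c powr (p - 1) * c"
    using assms by (simp add: powr_diff)
  ultimately have "p * c powr (p - 1) * x \<le> (p - 1) * c powr p + x powr p"
    using assms real by (simp add: powr_divide algebra_simps)
  then show ?thesis
    using real assms
    by (simp add: ennpowr_ennreal ennreal_mult[symmetric] ennreal_plus[symmetric] del: ennreal_plus)
qed auto

text \<open>Jensen's inequality for \<open>u\<^sup>p\<close>, allowing total weight below one: integrate the tangent inequality.\<close>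
lemma power_mean:
  assumes [measurable]: "U \<in> borel_measurable M" "g \<in> borel_measurable M"
    and g: "(\<integral>\<^sup>+x. g x \<partial>M) \<le> 1" and p: "1 \<le> p"
  shows "ennpowr (\<integral>\<^sup>+x. U x * g x \<partial>M) p \<le> (\<integral>\<^sup>+x. ennpowr (U x) p * g x \<partial>M)"
proof -
  let ?m = "\<integral>\<^sup>+x. U x * g x \<partial>M" and ?I = "\<integral>\<^sup>+x. ennpowr (U x) p * g x \<partial>M"
  have *: "ennreal (p * c powr (p - 1)) * ?m \<le> ennreal ((p - 1) * c powr p) + ?I" if c: "0 < c" for c
  proof -
    have "ennreal (p * c powr (p - 1)) * ?m = (\<integral>\<^sup>+x. ennreal (p * c powr (p - 1)) * U x * g x \<partial>M)"
      by (subst nn_integral_cmult[symmetric]) (auto simp: mult.assoc)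
    also have "\<dots> \<le> (\<integral>\<^sup>+x. ennreal ((p - 1) * c powr p) * g x + ennpowr (U x) p * g x \<partial>M)"
      using tangent_powr[OF p c]
      by (intro nn_integral_mono) (auto simp: distrib_right[symmetric] intro!: mult_right_mono)
    also have "\<dots> = ennreal ((p - 1) * c powr p) * (\<integral>\<^sup>+x. g x \<partial>M) + ?I"
      by (subst nn_integral_add) (auto simp: nn_integral_cmult)
    also have "\<dots> \<le> ennreal ((p - 1) * c powr p) + ?I"
      using mult_left_mono[OF g] by (intro add_right_mono) auto
    finally show ?thesis .
  qed
  \<comment> \<open>A finite mean serves as its own point of tangency; if the mean is infinite, the tangent at \<open>1\<close>
      already forces the right-hand side to be infinite.\<close>
  show ?thesis
  proof (cases ?m)
    case (real m)
    show ?thesis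
    proof (cases "m = 0")
      case False
      then have m: "0 < m" using real by simp
      then have mm: "m powr p = m powr (p - 1) * m" by (simp add: powr_diff)
      show ?thesis
      proof (cases ?I)
        case I: (real i)
        have "p * m powr (p - 1) * m \<le> (p - 1) * m powr p + i"
          using *[OF m] I m p real
          by (simp add: ennreal_mult[symmetric] ennreal_plus[symmetric] del: ennreal_plus)
        then have "m powr p \<le> i" unfolding mm by (simp add: algebra_simps)
        then show ?thesis using I real by (simp add: ennpowr_ennreal)
      qed auto
    qed (use real in auto)
  next
    case top
    then have "?I = top" using *[of 1] p by (auto simp: ennreal_mult_top top_unique)
    then show ?thesis by simp
  qed
qed

text \<open>
  The usual proof by duality needs the left-hand side to be finite beforehand.  Here Jensen's inequality is
  applied instead: with \<open>n x\<close> the norm of \<open>h x\<close> and \<open>R\<close> the integral of \<open>n\<close>, the integral of \<open>h x y\<close>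
  over \<open>x\<close> is \<open>R\<close> times the mean of the normalised function \<open>h x y / n x\<close> for the weight \<open>n / R\<close>,
  and after taking powers each normalised function integrates to one over \<open>y\<close>.
\<close>
theorem Minkowski_integral:
  assumes "sigma_finite_measure M" "sigma_finite_measure N"
    and [measurable]: "(\<lambda>(x, y). h x y) \<in> borel_measurable (M \<Otimes>\<^sub>M N)"
    and p: "1 \<le> p"
  shows "ennpowr (\<integral>\<^sup>+y. ennpowr (\<integral>\<^sup>+x. h x y \<partial>M) p \<partial>N) (1 / p)
       \<le> (\<integral>\<^sup>+x. ennpowr (\<integral>\<^sup>+y. ennpowr (h x y) p \<partial>N) (1 / p) \<partial>M)"
proof -
  interpret M: sigma_finite_measure M by fact
  interpret N: sigma_finite_measure N by fact
  interpret pair_sigma_finite M N ..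
  define n where "n x = ennpowr (\<integral>\<^sup>+y. ennpowr (h x y) p \<partial>N) (1 / p)" for x
  have [measurable]: "n \<in> borel_measurable M" unfolding n_def by measurable
  define R where "R = (\<integral>\<^sup>+x. n x \<partial>M)"
  have np: "(\<integral>\<^sup>+y. ennpowr (h x y) p \<partial>N) = ennpowr (n x) p" for x
    using p by (simp add: n_def ennpowr_ennpowr)
  \<comment> \<open>Outside \<open>?X\<close> no normalisation is possible.  These \<open>x\<close> do not contribute: either \<open>h x\<close> vanishes
      almost everywhere, or \<open>x\<close> lies in a null set once the right-hand side is finite.\<close>
  let ?X = "{x \<in> space M. 0 < n x \<and> n x < \<infinity>}"
  define S where "S y = (\<integral>\<^sup>+x. h x y * indicator ?X x \<partial>M)" for y
  have [measurable]: "S \<in> borel_measurable N" unfolding S_def by measurable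
  have "ennpowr (\<integral>\<^sup>+y. ennpowr (\<integral>\<^sup>+x. h x y \<partial>M) p \<partial>N) (1 / p) \<le> R"
  proof (cases "R = \<infinity>")
    case False
    then have fin: "AE x in M. n x \<noteq> \<infinity>"
      unfolding R_def by (intro nn_integral_noteq_infinite) auto
    have "(\<integral>\<^sup>+y. (\<integral>\<^sup>+x. h x y * indicator (space M - ?X) x \<partial>M) \<partial>N)
        = (\<integral>\<^sup>+x. (\<integral>\<^sup>+y. h x y * indicator (space M - ?X) x \<partial>N) \<partial>M)"
      by (rule Fubini') measurable
    also have "\<dots> = (\<integral>\<^sup>+x. 0 \<partial>M)"
    proof (rule nn_integral_cong_AE, use fin in eventually_elim)
      fix x assume n: "n x \<noteq> \<infinity>"
      show "(\<integral>\<^sup>+y. h x y * indicator (space M - ?X) x \<partial>N) = 0"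
      proof (cases "x \<in> space M \<and> n x = 0")
        case True
        then have "(\<integral>\<^sup>+y. ennpowr (h x y) p \<partial>N) = 0" by (simp add: np)
        then have "AE y in N. h x y = 0"
          using True by (subst (asm) nn_integral_0_iff_AE) (auto cong: measurable_cong)
        then have "(\<integral>\<^sup>+y. h x y * indicator (space M - ?X) x \<partial>N) = (\<integral>\<^sup>+y. 0 \<partial>N)"
          by (intro nn_integral_cong_AE) (auto elim: eventually_mono)
        then show ?thesis by simp
      next
        case False
        then have "indicator (space M - ?X) x = (0::ennreal)"
          using n by (auto simp: indicator_def less_top zero_less_iff_neq_zero)
        then show ?thesis by simp
      qed
    qed
    finally have Z: "(\<integral>\<^sup>+y. (\<integral>\<^sup>+x. h x y * indicator (space M - ?X) x \<partial>M) \<partial>N) = 0"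
      by simp
    have AE0: "AE y in N. (\<integral>\<^sup>+x. h x y * indicator (space M - ?X) x \<partial>M) = 0"
      by (rule nn_integral_0_iff_AE[THEN iffD1, OF _ Z]) measurable
    have split: "(\<integral>\<^sup>+x. h x y \<partial>M) = S y + (\<integral>\<^sup>+x. h x y * indicator (space M - ?X) x \<partial>M)"
      if "y \<in> space N" for y
      unfolding S_def using that
      by (subst nn_integral_add[symmetric]) (auto intro!: nn_integral_cong simp: indicator_def)
    have SS: "AE y in N. (\<integral>\<^sup>+x. h x y \<partial>M) = S y"
      using AE0 AE_space by eventually_elim (simp add: split)
    have "(\<integral>\<^sup>+y. ennpowr (S y) p \<partial>N) \<le> ennpowr R p"
    proof (cases "R = 0")
      case True
      then have "AE x in M. n x = 0" unfolding R_def by (subst (asm) nn_integral_0_iff_AE) auto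
      then have "S y = 0" for y
      proof -
        have "S y = (\<integral>\<^sup>+x. 0 \<partial>M)" unfolding S_def
          using \<open>AE x in M. n x = 0\<close> by (intro nn_integral_cong_AE) (auto elim!: eventually_mono)
        then show ?thesis by simp
      qed
      then show ?thesis by simp
    next
      case R0: False
      define g where "g x = n x * inverse R * indicator ?X x" for x
      define U where "U y x = h x y * inverse (n x)" for x y
      have [measurable]: "g \<in> borel_measurable M" "(\<lambda>(x, y). U y x) \<in> borel_measurable (M \<Otimes>\<^sub>M N)"
        unfolding g_def U_def by measurable
      have RR: "R * inverse R = 1" using R0 False
        by (metis divide_ennreal_def ennreal_divide_self infinity_ennreal_def less_top)
      have nn: "n x * inverse (n x) = 1" if "x \<in> ?X" for x
        using that by (metis (no_types, lifting) divide_ennreal_def ennreal_divide_self infinity_ennreal_def less_irrefl mem_Collect_eq)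
      have g1: "(\<integral>\<^sup>+x. g x \<partial>M) \<le> 1"
      proof -
        have "(\<integral>\<^sup>+x. g x \<partial>M) \<le> (\<integral>\<^sup>+x. n x * inverse R \<partial>M)"
          unfolding g_def by (intro nn_integral_mono) (auto simp: indicator_def)
        also have "\<dots> = R * inverse R" by (simp add: nn_integral_multc R_def)
        finally show ?thesis by (simp add: RR)
      qed
      have SU: "S y = R * (\<integral>\<^sup>+x. U y x * g x \<partial>M)" if "y \<in> space N" for y
      proof -
        have "R * (\<integral>\<^sup>+x. U y x * g x \<partial>M) = (\<integral>\<^sup>+x. R * (U y x * g x) \<partial>M)"
          using that by (subst nn_integral_cmult) auto
        also have "\<dots> = S y" unfolding S_def
        proof (intro nn_integral_cong)
          fix x
          have "R * (U y x * g x) = h x y * ((n x * inverse (n x)) * (R * inverse R)) * indicator ?X x"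
            by (simp add: U_def g_def ac_simps)
          then show "R * (U y x * g x) = h x y * indicator ?X x"
            using nn RR by (auto simp: indicator_def)
        qed
        finally show ?thesis by simp
      qed
      have "(\<integral>\<^sup>+y. ennpowr (S y) p \<partial>N) \<le> (\<integral>\<^sup>+y. ennpowr R p * (\<integral>\<^sup>+x. ennpowr (U y x) p * g x \<partial>M) \<partial>N)"
        using g1 p by (intro nn_integral_mono) (auto simp: SU ennpowr_mult intro!: mult_left_mono power_mean)
      also have "\<dots> = ennpowr R p * (\<integral>\<^sup>+y. (\<integral>\<^sup>+x. ennpowr (U y x) p * g x \<partial>M) \<partial>N)"
        by (subst nn_integral_cmult) auto
      also have "(\<integral>\<^sup>+y. (\<integral>\<^sup>+x. ennpowr (U y x) p * g x \<partial>M) \<partial>N)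
               = (\<integral>\<^sup>+x. (\<integral>\<^sup>+y. ennpowr (U y x) p * g x \<partial>N) \<partial>M)"
        by (rule Fubini') measurable
      also have "\<dots> = (\<integral>\<^sup>+x. g x \<partial>M)"
      proof (intro nn_integral_cong)
        fix x assume x: "x \<in> space M"
        have "(\<integral>\<^sup>+y. ennpowr (U y x) p * g x \<partial>N)
            = (\<integral>\<^sup>+y. ennpowr (h x y) p * (ennpowr (inverse (n x)) p * g x) \<partial>N)"
          by (simp add: U_def ennpowr_mult ac_simps)
        also have "\<dots> = ennpowr (n x) p * (ennpowr (inverse (n x)) p * g x)"
          using x by (subst nn_integral_multc) (auto simp: np)
        also have "\<dots> = ennpowr (n x * inverse (n x)) p * g x" by (simp add: ennpowr_mult ac_simps)
        also have "\<dots> = g x" using nn[of x] by (cases "x \<in> ?X") (auto simp: g_def)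
        finally show "(\<integral>\<^sup>+y. ennpowr (U y x) p * g x \<partial>N) = g x" .
      qed
      also have "ennpowr R p * (\<integral>\<^sup>+x. g x \<partial>M) \<le> ennpowr R p"
        using mult_left_mono[OF g1, of "ennpowr R p"] by simp
      finally show ?thesis .
    qed
    moreover have "(\<integral>\<^sup>+y. ennpowr (\<integral>\<^sup>+x. h x y \<partial>M) p \<partial>N) = (\<integral>\<^sup>+y. ennpowr (S y) p \<partial>N)"
      using SS by (intro nn_integral_cong_AE) (auto elim: eventually_mono)
    ultimately have "ennpowr (\<integral>\<^sup>+y. ennpowr (\<integral>\<^sup>+x. h x y \<partial>M) p \<partial>N) (1 / p) \<le> ennpowr (ennpowr R p) (1 / p)"
      using p by (intro ennpowr_mono) auto
    then show ?thesis using p by (simp add: ennpowr_ennpowr)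
  qed simp
  then show ?thesis by (simp add: R_def n_def)
qed

text \<open>Mixed norms of extended nonnegative functions, so that they can be estimated before any integrability is established.\<close>
definition emixed :: "real \<Rightarrow> real \<Rightarrow> 'a measure \<Rightarrow> 'b measure \<Rightarrow> ('a \<times> 'b \<Rightarrow> ennreal) \<Rightarrow> ennreal" where
  "emixed p1 p2 M1 M2 u = (\<integral>\<^sup>+x. ennpowr (\<integral>\<^sup>+y. ennpowr (u (x, y)) p2 \<partial>M2) (p1 / p2) \<partial>M1)"

definition enorm_mixed :: "real \<Rightarrow> real \<Rightarrow> 'a measure \<Rightarrow> 'b measure \<Rightarrow> ('a \<times> 'b \<Rightarrow> ennreal) \<Rightarrow> ennreal" where
  "enorm_mixed p1 p2 M1 M2 u = ennpowr (emixed p1 p2 M1 M2 u) (1 / p1)"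

lemma mixed_integral_eq_emixed:
  "mixed_integral p1 p2 M1 M2 f = emixed p1 p2 M1 M2 (\<lambda>z. ennreal \<bar>f z\<bar>)"
  by (simp add: mixed_integral_def emixed_def ennpowr_ennreal)

lemma mixed_norm_eq_enorm:
  assumes "mixed_integral p1 p2 M1 M2 f < \<infinity>"
  shows "ennreal (mixed_norm p1 p2 M1 M2 f) = enorm_mixed p1 p2 M1 M2 (\<lambda>z. ennreal \<bar>f z\<bar>)"
  using assms
  by (cases "mixed_integral p1 p2 M1 M2 f")
     (simp_all add: mixed_norm_def enorm_mixed_def mixed_integral_eq_emixed[symmetric] ennpowr_ennreal)

lemma mixed_norm_nonneg [simp]: "0 \<le> mixed_norm p1 p2 M1 M2 f"
  by (simp add: mixed_norm_def)

locale mixed =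
  M1: sigma_finite_measure M1 + M2: sigma_finite_measure M2
  for p1 p2 :: real and M1 :: "'a measure" and M2 :: "'b measure" +
  assumes p1: "1 \<le> p1" and p2: "1 \<le> p2"
begin

sublocale pair_sigma_finite M1 M2 ..

text \<open>\<open>EN\<close> and \<open>EM\<close> are the mixed norm and its \<open>p1\<close>-th power for extended nonnegative functions.\<close>
abbreviation "\<MM> \<equiv> M1 \<Otimes>\<^sub>M M2"
abbreviation "EM \<equiv> emixed p1 p2 M1 M2"
abbreviation "EN \<equiv> enorm_mixed p1 p2 M1 M2"

lemma EN_inner:
  "EN u = ennpowr (\<integral>\<^sup>+x. ennpowr (ennpowr (\<integral>\<^sup>+y. ennpowr (u (x, y)) p2 \<partial>M2) (1 / p2)) p1 \<partial>M1) (1 / p1)"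
  by (simp add: enorm_mixed_def emixed_def ennpowr_ennpowr)

lemma EN_less_top_iff: "EN u < \<infinity> \<longleftrightarrow> EM u < \<infinity>"
  by (simp add: enorm_mixed_def)

lemma EM_mono:
  assumes "AE z in \<MM>. u z \<le> v z"
  shows "EM u \<le> EM v"
proof -
  have "AE x in M1. AE y in M2. u (x, y) \<le> v (x, y)"
    using AE_pair[OF assms] .
  then have "AE x in M1. ennpowr (\<integral>\<^sup>+y. ennpowr (u (x, y)) p2 \<partial>M2) (p1 / p2)
      \<le> ennpowr (\<integral>\<^sup>+y. ennpowr (v (x, y)) p2 \<partial>M2) (p1 / p2)"
    using p1 p2 by (elim eventually_mono) (auto intro!: ennpowr_mono nn_integral_mono_AE elim!: eventually_mono)
  then show ?thesis unfolding emixed_def by (rule nn_integral_mono_AE)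
qed

lemma EN_mono: "AE z in \<MM>. u z \<le> v z \<Longrightarrow> EN u \<le> EN v"
  unfolding enorm_mixed_def using p1 by (intro ennpowr_mono EM_mono) auto

lemma EN_cmult:
  assumes [measurable]: "u \<in> borel_measurable \<MM>"
  shows "EN (\<lambda>z. c * u z) = c * EN u"
proof -
  have "(\<integral>\<^sup>+x. ennpowr (\<integral>\<^sup>+y. ennpowr (c * u (x, y)) p2 \<partial>M2) (p1 / p2) \<partial>M1)
      = (\<integral>\<^sup>+x. ennpowr c p1 * ennpowr (\<integral>\<^sup>+y. ennpowr (u (x, y)) p2 \<partial>M2) (p1 / p2) \<partial>M1)"
  proof (intro nn_integral_cong)
    fix x assume "x \<in> space M1"
    then have "(\<integral>\<^sup>+y. ennpowr (c * u (x, y)) p2 \<partial>M2) = ennpowr c p2 * (\<integral>\<^sup>+y. ennpowr (u (x, y)) p2 \<partial>M2)"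
      by (simp add: ennpowr_mult nn_integral_cmult)
    then show "ennpowr (\<integral>\<^sup>+y. ennpowr (c * u (x, y)) p2 \<partial>M2) (p1 / p2)
        = ennpowr c p1 * ennpowr (\<integral>\<^sup>+y. ennpowr (u (x, y)) p2 \<partial>M2) (p1 / p2)"
      using p2 by (simp add: ennpowr_mult ennpowr_ennpowr)
  qed
  also have "\<dots> = ennpowr c p1 * EM u"
    unfolding emixed_def by (rule nn_integral_cmult) measurable
  finally show ?thesis
    using p1 by (simp add: enorm_mixed_def emixed_def ennpowr_mult ennpowr_ennpowr)
qed

lemma EN_zero: "EN (\<lambda>z. 0) = 0"
  by (simp add: enorm_mixed_def emixed_def)

lemma measurable_EN [measurable]:
  assumes [measurable]: "(\<lambda>(w, z). h w z) \<in> borel_measurable (P \<Otimes>\<^sub>M \<MM>)"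
  shows "(\<lambda>w. EN (h w)) \<in> borel_measurable P"
  unfolding enorm_mixed_def emixed_def by measurable

text \<open>Apply Minkowski's inequality first in the inner variable, then in the outer one.\<close>
lemma Minkowski_mixed:
  assumes "sigma_finite_measure P"
    and [measurable]: "(\<lambda>(w, z). h w z) \<in> borel_measurable (P \<Otimes>\<^sub>M \<MM>)"
  shows "EN (\<lambda>z. \<integral>\<^sup>+w. h w z \<partial>P) \<le> (\<integral>\<^sup>+w. EN (h w) \<partial>P)"
proof -
  interpret P: sigma_finite_measure P by fact
  have "EN (\<lambda>z. \<integral>\<^sup>+w. h w z \<partial>P)
     \<le> ennpowr (\<integral>\<^sup>+x. ennpowr (\<integral>\<^sup>+w. ennpowr (\<integral>\<^sup>+y. ennpowr (h w (x, y)) p2 \<partial>M2) (1 / p2) \<partial>P) p1 \<partial>M1) (1 / p1)"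
    unfolding EN_inner using p1 p2
    by (intro ennpowr_mono nn_integral_mono Minkowski_integral assms(1) M2.sigma_finite_measure_axioms) auto
  also have "\<dots> \<le> (\<integral>\<^sup>+w. ennpowr (\<integral>\<^sup>+x. ennpowr (ennpowr (\<integral>\<^sup>+y. ennpowr (h w (x, y)) p2 \<partial>M2) (1 / p2)) p1 \<partial>M1) (1 / p1) \<partial>P)"
    using p1 by (intro Minkowski_integral assms(1) M1.sigma_finite_measure_axioms) auto
  finally show ?thesis unfolding EN_inner .
qed

text \<open>
  The same inequality read with the roles of the two measures exchanged: \<open>r / p1\<close> and \<open>r / p2\<close> are at least
  one, so a moment of order \<open>r\<close> taken outside is dominated by one taken inside.
\<close>
lemma Minkowski_mixed_power:
  assumes "sigma_finite_measure P"
    and [measurable]: "(\<lambda>(w, z). h w z) \<in> borel_measurable (P \<Otimes>\<^sub>M \<MM>)"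
    and r: "p1 \<le> r" "p2 \<le> r"
  shows "ennpowr (\<integral>\<^sup>+w. ennpowr (EN (h w)) r \<partial>P) (1 / r)
       \<le> EN (\<lambda>z. ennpowr (\<integral>\<^sup>+w. ennpowr (h w z) r \<partial>P) (1 / r))"
proof -
  interpret P: sigma_finite_measure P by fact
  define k where "k x w = (\<integral>\<^sup>+y. ennpowr (h w (x, y)) p2 \<partial>M2)" for x w
  have [measurable]: "(\<lambda>(x, w). k x w) \<in> borel_measurable (M1 \<Otimes>\<^sub>M P)"
    unfolding k_def by measurable
  have r0: "0 < r" using p1 r by simp
  have "ennpowr (\<integral>\<^sup>+w. ennpowr (EN (h w)) r \<partial>P) (1 / r)
      = ennpowr (ennpowr (\<integral>\<^sup>+w. ennpowr (\<integral>\<^sup>+x. ennpowr (k x w) (p1 / p2) \<partial>M1) (r / p1) \<partial>P) (1 / (r / p1))) (1 / p1)"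
    using p1 by (simp add: enorm_mixed_def emixed_def k_def ennpowr_ennpowr)
  also have "\<dots> \<le> ennpowr (\<integral>\<^sup>+x. ennpowr (\<integral>\<^sup>+w. ennpowr (ennpowr (k x w) (p1 / p2)) (r / p1) \<partial>P) (1 / (r / p1)) \<partial>M1) (1 / p1)"
    using p1 r by (intro ennpowr_mono Minkowski_integral assms(1) M1.sigma_finite_measure_axioms) auto
  also have "\<dots> = ennpowr (\<integral>\<^sup>+x. ennpowr (ennpowr (\<integral>\<^sup>+w. ennpowr (k x w) (r / p2) \<partial>P) (1 / (r / p2))) (p1 / p2) \<partial>M1) (1 / p1)"
    using p1 p2 r0 by (simp add: ennpowr_ennpowr)
  also have "\<dots> \<le> ennpowr (\<integral>\<^sup>+x. ennpowr (\<integral>\<^sup>+y. ennpowr (\<integral>\<^sup>+w. ennpowr (ennpowr (h w (x, y)) p2) (r / p2) \<partial>P) (1 / (r / p2)) \<partial>M2) (p1 / p2) \<partial>M1) (1 / p1)"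
    unfolding k_def using p1 p2 r
    by (intro ennpowr_mono nn_integral_mono Minkowski_integral assms(1) M2.sigma_finite_measure_axioms) auto
  also have "\<dots> = EN (\<lambda>z. ennpowr (\<integral>\<^sup>+w. ennpowr (h w z) r \<partial>P) (1 / r))"
    using p1 p2 r0 by (simp add: enorm_mixed_def emixed_def ennpowr_ennpowr)
  finally show ?thesis .
qed

text \<open>A sum of two functions is an integral over a two-point space, so Minkowski's inequality applies.\<close>
lemma EN_triangle:
  assumes [measurable]: "u \<in> borel_measurable \<MM>" "v \<in> borel_measurable \<MM>"
  shows "EN (\<lambda>z. u z + v z) \<le> EN u + EN v"
proof -
  let ?P = "count_space (UNIV :: bool set)" and ?h = "\<lambda>b. if b then u else v"
  have "EN (\<lambda>z. \<integral>\<^sup>+b. ?h b z \<partial>?P) \<le> (\<integral>\<^sup>+b. EN (?h b) \<partial>?P)"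
  proof (rule Minkowski_mixed)
    show "(\<lambda>(b, z). ?h b z) \<in> borel_measurable (?P \<Otimes>\<^sub>M \<MM>)"
      by (rule measurable_pair_measure_countable1) auto
  qed (simp add: sigma_finite_measure_count_space_countable)
  then show ?thesis
    by (simp add: nn_integral_count_space_finite UNIV_bool add.commute)
qed

text \<open>Dominated convergence, used once in each variable.\<close>
lemma EN_tendsto_0:
  assumes [measurable]: "\<And>i. u i \<in> borel_measurable \<MM>" "v \<in> borel_measurable \<MM>"
    and le: "\<And>i z. z \<in> space \<MM> \<Longrightarrow> u i z \<le> v z" and v: "EN v < \<infinity>"
    and lim: "\<And>z. z \<in> space \<MM> \<Longrightarrow> v z < \<infinity> \<Longrightarrow> (\<lambda>i. u i z) \<longlonglongrightarrow> 0"
  shows "(\<lambda>i. EN (u i)) \<longlonglongrightarrow> 0"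
proof -
  define I where "I w x = (\<integral>\<^sup>+y. ennpowr (w (x, y)) p2 \<partial>M2)" for w :: "'a \<times> 'b \<Rightarrow> ennreal" and x
  have [measurable]: "I w \<in> borel_measurable M1" if "w \<in> borel_measurable \<MM>" for w
    using that unfolding I_def by measurable
  have EMI: "EM w = (\<integral>\<^sup>+x. ennpowr (I w x) (p1 / p2) \<partial>M1)" for w
    by (simp add: emixed_def I_def)
  have fin: "(\<integral>\<^sup>+x. ennpowr (I v x) (p1 / p2) \<partial>M1) < \<infinity>"
    using v EN_less_top_iff[of v] by (simp add: EMI)
  then have "AE x in M1. ennpowr (I v x) (p1 / p2) \<noteq> \<infinity>"
    by (intro nn_integral_noteq_infinite) auto
  then have "AE x in M1. (\<lambda>i. ennpowr (I (u i) x) (p1 / p2)) \<longlonglongrightarrow> 0"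
    using AE_space
  proof eventually_elim
    case (elim x)
    then have vx: "(\<integral>\<^sup>+y. ennpowr (v (x, y)) p2 \<partial>M2) < \<infinity>"
      by (simp add: I_def less_top)
    then have "AE y in M2. ennpowr (v (x, y)) p2 \<noteq> \<infinity>"
      using elim by (intro nn_integral_noteq_infinite) auto
    then have "AE y in M2. (\<lambda>i. ennpowr (u i (x, y)) p2) \<longlonglongrightarrow> 0"
      using AE_space
    proof eventually_elim
      case (elim y)
      then show ?case
        using lim[of "(x, y)"] \<open>x \<in> space M1\<close> p2
        by (intro tendsto_ennpowr_0) (auto simp: space_pair_measure less_top)
    qed
    then have "(\<lambda>i. \<integral>\<^sup>+y. ennpowr (u i (x, y)) p2 \<partial>M2) \<longlonglongrightarrow> (\<integral>\<^sup>+y. 0 \<partial>M2)"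
      using elim vx p2 le
      by (intro nn_integral_dominated_convergence[where w="\<lambda>y. ennpowr (v (x, y)) p2"])
         (auto intro!: AE_I2 ennpowr_mono simp: space_pair_measure)
    then show ?case
      unfolding I_def using p1 p2 by (intro tendsto_ennpowr_0) auto
  qed
  then have "(\<lambda>i. \<integral>\<^sup>+x. ennpowr (I (u i) x) (p1 / p2) \<partial>M1) \<longlonglongrightarrow> (\<integral>\<^sup>+x. 0 \<partial>M1)"
    using fin p1 p2 le
    by (intro nn_integral_dominated_convergence[where w="\<lambda>x. ennpowr (I v x) (p1 / p2)"])
       (auto simp: I_def space_pair_measure intro!: AE_I2 ennpowr_mono nn_integral_mono)
  then show ?thesis
    unfolding enorm_mixed_def EMI using p1 by (intro tendsto_ennpowr_0) auto
qed

end

section \<open>Polynomials in Gaussian variables\<close>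

text \<open>An algebra of random variables within which every expectation below exists.\<close>
definition (in prob_space) all_moments :: "('a \<Rightarrow> real) set" where
  "all_moments = {f \<in> borel_measurable M. \<forall>k::nat. integrable M (\<lambda>x. \<bar>f x\<bar> ^ k)}"

context prob_space
begin

lemma all_moments_measurable [measurable_dest]: "f \<in> all_moments \<Longrightarrow> f \<in> borel_measurable M"
  by (simp add: all_moments_def)

lemma all_moments_const [simp]: "(\<lambda>_. c) \<in> all_moments"
  by (simp add: all_moments_def)

lemma abs_add_power_le: "\<bar>a + b :: real\<bar> ^ k \<le> 2 ^ k * (\<bar>a\<bar> ^ k + \<bar>b\<bar> ^ k)"
proof -
  have "\<bar>a + b\<bar> ^ k \<le> (2 * max \<bar>a\<bar> \<bar>b\<bar>) ^ k" by (intro power_mono) auto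
  also have "\<dots> = 2 ^ k * (max \<bar>a\<bar> \<bar>b\<bar>) ^ k" by (simp add: power_mult_distrib)
  also have "(max \<bar>a\<bar> \<bar>b\<bar>) ^ k \<le> \<bar>a\<bar> ^ k + \<bar>b\<bar> ^ k" by (simp add: max_def)
  finally show ?thesis by simp
qed

lemma all_moments_add [intro]:
  assumes "f \<in> all_moments" "g \<in> all_moments"
  shows "(\<lambda>x. f x + g x) \<in> all_moments"
proof -
  have [measurable]: "f \<in> borel_measurable M" "g \<in> borel_measurable M"
    using assms by (auto simp: all_moments_def)
  have "integrable M (\<lambda>x. \<bar>f x + g x\<bar> ^ k)" for k :: nat
  proof (rule Bochner_Integration.integrable_bound)
    show "integrable M (\<lambda>x. 2 ^ k * (\<bar>f x\<bar> ^ k + \<bar>g x\<bar> ^ k))"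
      using assms by (auto simp: all_moments_def)
    show "AE x in M. norm (\<bar>f x + g x\<bar> ^ k) \<le> norm (2 ^ k * (\<bar>f x\<bar> ^ k + \<bar>g x\<bar> ^ k))"
      by (intro AE_I2) (simp add: abs_add_power_le)
  qed measurable
  then show ?thesis by (simp add: all_moments_def)
qed

lemma all_moments_mult [intro]:
  assumes "f \<in> all_moments" "g \<in> all_moments"
  shows "(\<lambda>x. f x * g x) \<in> all_moments"
proof -
  have [measurable]: "f \<in> borel_measurable M" "g \<in> borel_measurable M"
    using assms by (auto simp: all_moments_def)
  have "integrable M (\<lambda>x. \<bar>f x * g x\<bar> ^ k)" for k :: nat
  proof (rule Bochner_Integration.integrable_bound)
    show "integrable M (\<lambda>x. \<bar>f x\<bar> ^ (2 * k) + \<bar>g x\<bar> ^ (2 * k))"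
      using assms by (intro Bochner_Integration.integrable_add) (auto simp: all_moments_def)
    show "AE x in M. norm (\<bar>f x * g x\<bar> ^ k) \<le> norm (\<bar>f x\<bar> ^ (2 * k) + \<bar>g x\<bar> ^ (2 * k))"
    proof (intro AE_I2)
      fix x
      have "2 * (\<bar>f x\<bar> ^ k * \<bar>g x\<bar> ^ k) \<le> (\<bar>f x\<bar> ^ k)\<^sup>2 + (\<bar>g x\<bar> ^ k)\<^sup>2"
        using sum_squares_bound[of "\<bar>f x\<bar> ^ k" "\<bar>g x\<bar> ^ k"] by simp
      moreover have "0 \<le> \<bar>f x\<bar> ^ k * \<bar>g x\<bar> ^ k" by simp
      moreover have "(\<bar>f x\<bar> ^ k)\<^sup>2 = \<bar>f x\<bar> ^ (2 * k)" "(\<bar>g x\<bar> ^ k)\<^sup>2 = \<bar>g x\<bar> ^ (2 * k)"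
        by (simp_all add: power_mult[symmetric] mult.commute)
      ultimately have "\<bar>f x\<bar> ^ k * \<bar>g x\<bar> ^ k \<le> \<bar>f x\<bar> ^ (2 * k) + \<bar>g x\<bar> ^ (2 * k)"
        by linarith
      then show "norm (\<bar>f x * g x\<bar> ^ k) \<le> norm (\<bar>f x\<bar> ^ (2 * k) + \<bar>g x\<bar> ^ (2 * k))"
        by (simp add: abs_mult power_mult_distrib)
    qed
  qed measurable
  then show ?thesis by (simp add: all_moments_def)
qed

lemma all_moments_cmult [intro]: "f \<in> all_moments \<Longrightarrow> (\<lambda>x. c * f x) \<in> all_moments"
  by (rule all_moments_mult) auto

lemma all_moments_sum [intro]:
  "(\<And>i. i \<in> I \<Longrightarrow> f i \<in> all_moments) \<Longrightarrow> (\<lambda>x. \<Sum>i\<in>I. f i x) \<in> all_moments"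
  by (induction I rule: infinite_finite_induct) auto

lemma all_moments_power [intro]: "f \<in> all_moments \<Longrightarrow> (\<lambda>x. f x ^ k) \<in> all_moments"
  by (induction k) auto

lemma all_moments_integrable: "f \<in> all_moments \<Longrightarrow> integrable M f"
  using integrable_abs_cancel[of M f] unfolding all_moments_def by (auto dest: spec[of _ 1])

end

text \<open>The moments of a standard normal variable.\<close>
definition gauss_moment :: "nat \<Rightarrow> real" where
  "gauss_moment k = (if even k then fact k / (2 ^ (k div 2) * fact (k div 2)) else 0)"

lemma gauss_moment_Suc: "gauss_moment (Suc (Suc k)) = (k + 1) * gauss_moment k"
proof (cases "even k")
  case True
  then obtain m where k: "k = 2 * m" by blast
  have "fact (Suc (Suc (2 * m))) = (2 * real m + 2) * (2 * real m + 1) * fact (2 * m)"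
    by (simp add: algebra_simps)
  then show ?thesis unfolding k gauss_moment_def by (simp add: divide_simps del: fact_Suc) (simp add: algebra_simps)
qed (simp add: gauss_moment_def)

lemma gauss_moment_0 [simp]: "gauss_moment 0 = 1" and gauss_moment_1 [simp]: "gauss_moment (Suc 0) = 0"
  by (simp_all add: gauss_moment_def)

text \<open>
  A linear combination of independent normal variables is normal.  This is the statement for the moments,
  in which only the numbers matter: by it the moments of \<open>W (t b + u)\<close> for orthogonal \<open>b\<close> and \<open>u\<close> are polynomials in \<open>t\<close>.
\<close>
lemma gauss_moment_binomial:
  fixes a b t :: real
  shows "gauss_moment n * sqrt (t\<^sup>2 * a\<^sup>2 + b\<^sup>2) ^ n
       = (\<Sum>j\<le>n. of_nat (n choose j) * (gauss_moment j * a ^ j) * (gauss_moment (n - j) * b ^ (n - j)) * t ^ j)"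
proof (cases "even n")
  case False
  then have zero: "gauss_moment j * gauss_moment (n - j) = 0" if "j \<le> n" for j
    using that by (auto simp: gauss_moment_def)
  have "(\<Sum>j\<le>n. of_nat (n choose j) * (gauss_moment j * a ^ j) * (gauss_moment (n - j) * b ^ (n - j)) * t ^ j) = 0"
  proof (intro sum.neutral ballI)
    fix j assume "j \<in> {..n}"
    then have "gauss_moment j = 0 \<or> gauss_moment (n - j) = 0" using zero[of j] by simp
    then show "of_nat (n choose j) * (gauss_moment j * a ^ j) * (gauss_moment (n - j) * b ^ (n - j)) * t ^ j = 0"
      by (elim disjE) simp_all
  qed
  moreover have "gauss_moment n = 0" using False by (simp add: gauss_moment_def)
  ultimately show ?thesis by simp
next
  case True
  then obtain m where n: "n = 2 * m" by blast
  have *: "of_nat (2 * m choose (2 * i)) * gauss_moment (2 * i) * gauss_moment (2 * m - 2 * i)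
      = gauss_moment (2 * m) * of_nat (m choose i)" if "i \<le> m" for i
  proof -
    have "real (2 * m choose (2 * i)) = fact (2 * m) / (fact (2 * i) * fact (2 * m - 2 * i))"
      using that by (intro binomial_fact) auto
    moreover have "real (m choose i) = fact m / (fact i * fact (m - i))"
      using that by (intro binomial_fact) auto
    moreover have "2 * m - 2 * i = 2 * (m - i)" "(2::real) ^ m = 2 ^ i * 2 ^ (m - i)"
      using that by (auto simp: power_add[symmetric] diff_mult_distrib2)
    ultimately show ?thesis by (simp add: gauss_moment_def)
  qed
  have "(\<Sum>j\<le>n. of_nat (n choose j) * (gauss_moment j * a ^ j) * (gauss_moment (n - j) * b ^ (n - j)) * t ^ j)
      = (\<Sum>j\<in>(\<lambda>i. 2 * i) ` {..m}. of_nat (n choose j) * (gauss_moment j * a ^ j) * (gauss_moment (n - j) * b ^ (n - j)) * t ^ j)"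
  proof (rule sum.mono_neutral_right)
    show "\<forall>j\<in>{..n} - (\<lambda>i. 2 * i) ` {..m}.
       of_nat (n choose j) * (gauss_moment j * a ^ j) * (gauss_moment (n - j) * b ^ (n - j)) * t ^ j = 0"
    proof
      fix j assume j: "j \<in> {..n} - (\<lambda>i. 2 * i) ` {..m}"
      then have "odd j" unfolding n by (auto elim!: evenE)
      then show "of_nat (n choose j) * (gauss_moment j * a ^ j) * (gauss_moment (n - j) * b ^ (n - j)) * t ^ j = 0"
        by (simp add: gauss_moment_def)
    qed
  qed (auto simp: n)
  also have "\<dots> = (\<Sum>i\<le>m. of_nat (2 * m choose (2 * i)) * gauss_moment (2 * i) * gauss_moment (2 * m - 2 * i)
                      * (a ^ (2 * i) * b ^ (2 * m - 2 * i) * t ^ (2 * i)))"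
    by (subst sum.reindex) (auto simp: inj_on_def n mult_ac)
  also have "\<dots> = (\<Sum>i\<le>m. gauss_moment (2 * m) * (of_nat (m choose i) * (t\<^sup>2 * a\<^sup>2) ^ i * (b\<^sup>2) ^ (m - i)))"
  proof (intro sum.cong refl)
    fix i assume "i \<in> {..m}"
    then have i: "i \<le> m" by simp
    have "b ^ (2 * m - 2 * i) = (b\<^sup>2) ^ (m - i)"
      by (simp add: power_mult[symmetric] diff_mult_distrib2)
    then show "of_nat (2 * m choose (2 * i)) * gauss_moment (2 * i) * gauss_moment (2 * m - 2 * i)
                      * (a ^ (2 * i) * b ^ (2 * m - 2 * i) * t ^ (2 * i))
         = gauss_moment (2 * m) * (of_nat (m choose i) * (t\<^sup>2 * a\<^sup>2) ^ i * (b\<^sup>2) ^ (m - i))"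
      unfolding *[OF i] by (simp add: power_mult power_mult_distrib)
  qed
  also have "\<dots> = gauss_moment (2 * m) * (t\<^sup>2 * a\<^sup>2 + b\<^sup>2) ^ m"
    by (simp add: binomial_ring sum_distrib_left)
  also have "(t\<^sup>2 * a\<^sup>2 + b\<^sup>2) ^ m = sqrt (t\<^sup>2 * a\<^sup>2 + b\<^sup>2) ^ n"
    by (simp add: n power_mult)
  finally show ?thesis by (simp add: n)
qed

text \<open>Polynomials of degree at most \<open>n\<close> in the variables \<open>W v\<close> with \<open>v\<close> in \<open>B\<close>, as functions.\<close>
inductive gauss_poly :: "('v \<Rightarrow> 'w \<Rightarrow> real) \<Rightarrow> 'v set \<Rightarrow> nat \<Rightarrow> ('w \<Rightarrow> real) \<Rightarrow> bool"
  for W :: "'v \<Rightarrow> 'w \<Rightarrow> real" and B :: "'v set" where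
  const: "gauss_poly W B n (\<lambda>_. c)"
| mult: "v \<in> B \<Longrightarrow> gauss_poly W B n f \<Longrightarrow> gauss_poly W B (Suc n) (\<lambda>w. W v w * f w)"
| add: "gauss_poly W B n f \<Longrightarrow> gauss_poly W B n g \<Longrightarrow> gauss_poly W B n (\<lambda>w. f w + g w)"

lemma gauss_poly_Suc: "gauss_poly W B n f \<Longrightarrow> gauss_poly W B (Suc n) f"
  by (induction rule: gauss_poly.induct) (auto intro: gauss_poly.intros)

lemma gauss_poly_mono_degree: "n \<le> m \<Longrightarrow> gauss_poly W B n f \<Longrightarrow> gauss_poly W B m f"
  by (induction rule: dec_induct) (auto intro: gauss_poly_Suc)

lemma gauss_poly_mono_set: "gauss_poly W B n f \<Longrightarrow> B \<subseteq> B' \<Longrightarrow> gauss_poly W B' n f"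
  by (induction rule: gauss_poly.induct) (auto intro: gauss_poly.intros)

lemma gauss_poly_cmult: "gauss_poly W B n f \<Longrightarrow> gauss_poly W B n (\<lambda>w. c * f w)"
proof (induction rule: gauss_poly.induct)
  case (mult v n f)
  then show ?case using gauss_poly.mult[of v B W n "\<lambda>w. c * f w"] by (simp add: mult.left_commute)
next
  case (add n f g)
  then show ?case using gauss_poly.add[of W B n "\<lambda>w. c * f w" "\<lambda>w. c * g w"] by (simp add: distrib_left)
qed (rule gauss_poly.const)

lemma gauss_poly_prod: "gauss_poly W B n f \<Longrightarrow> gauss_poly W B m g \<Longrightarrow> gauss_poly W B (n + m) (\<lambda>w. f w * g w)"
proof (induction rule: gauss_poly.induct)
  case (const n c)
  then show ?case by (intro gauss_poly_cmult) (auto intro: gauss_poly_mono_degree[of m])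
next
  case (mult v n f)
  then show ?case using gauss_poly.mult[of v B W "n + m" "\<lambda>w. f w * g w"] by (simp add: mult.assoc)
next
  case (add n f h)
  then show ?case using gauss_poly.add[of W B "n + m" "\<lambda>w. f w * g w" "\<lambda>w. h w * g w"] by (simp add: distrib_right)
qed

lemma gauss_poly_sum: "(\<And>i. i \<in> I \<Longrightarrow> gauss_poly W B n (f i)) \<Longrightarrow> gauss_poly W B n (\<lambda>w. \<Sum>i\<in>I. f i w)"
  by (induction I rule: infinite_finite_induct) (auto intro: gauss_poly.intros)

lemma gauss_poly_square: "gauss_poly W B n f \<Longrightarrow> gauss_poly W B (2 * n) (\<lambda>w. (f w)\<^sup>2)"
  using gauss_poly_prod[of W B n f n f] by (simp add: power2_eq_square mult_2)

lemma gauss_poly_poly: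
  assumes "v \<in> B" "degree p \<le> n"
  shows "gauss_poly W B n (\<lambda>w. poly p (W v w))"
proof -
  have pow: "gauss_poly W B i (\<lambda>w. W v w ^ i)" for i
    by (induction i) (auto intro: gauss_poly.intros assms)
  show ?thesis
    unfolding poly_altdef using assms(2)
    by (intro gauss_poly_sum gauss_poly_cmult gauss_poly_mono_degree[OF _ pow]) auto
qed

lemma gauss_poly_empty: "gauss_poly W {} n f \<Longrightarrow> \<exists>c. f = (\<lambda>_. c)"
  by (induction rule: gauss_poly.induct) auto

lemma gauss_poly_finite_support: "gauss_poly W B n f \<Longrightarrow> \<exists>S\<subseteq>B. finite S \<and> gauss_poly W S n f"
proof (induction rule: gauss_poly.induct)
  case (const n c)
  show ?case by (rule exI[of _ "{}"]) (auto intro: gauss_poly.const)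
next
  case (mult v n f)
  then obtain S where "S \<subseteq> B" "finite S" "gauss_poly W S n f" by auto
  then show ?case using mult.hyps
    by (intro exI[of _ "insert v S"]) (auto intro: gauss_poly.mult gauss_poly_mono_set)
next
  case (add n f g)
  then obtain S T where "S \<subseteq> B" "finite S" "gauss_poly W S n f" "T \<subseteq> B" "finite T" "gauss_poly W T n g" by auto
  then show ?case
    by (intro exI[of _ "S \<union> T"]) (auto intro!: gauss_poly.add intro: gauss_poly_mono_set)
qed

text \<open>
  Monic, hence without the factor \<open>1 / k!\<close> of \<^const>\<open>hermite\<close>.  This form of the recursion makes
  integration by parts immediate.
\<close>
fun hermite_poly :: "nat \<Rightarrow> real poly" where
  "hermite_poly 0 = 1"
| "hermite_poly (Suc n) = [:0, 1:] * hermite_poly n - pderiv (hermite_poly n)"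

lemma degree_hermite_poly: "degree (hermite_poly n) \<le> n"
proof (induction n)
  case (Suc n)
  have "degree ([:0, 1:] * hermite_poly n) \<le> Suc n"
    using degree_mult_le[of "[:0, 1::real:]" "hermite_poly n"] Suc by simp
  moreover have "degree (pderiv (hermite_poly n)) \<le> Suc n"
    using Suc by (simp add: degree_pderiv)
  ultimately show ?case by (simp del: pCons_0_0 mult_pCons_left add: degree_diff_le)
qed simp

lemma pderiv_hermite_poly: "pderiv (hermite_poly (Suc n)) = of_nat (Suc n) * hermite_poly n"
proof (induction n)
  case 0 then show ?case by (simp add: pderiv_pCons one_pCons)
next
  case (Suc n)
  have X: "pderiv [:0, 1::real:] = 1" by (simp add: pderiv_pCons)
  have "pderiv (hermite_poly (Suc (Suc n))) = hermite_poly (Suc n) + [:0, 1:] * (of_nat (Suc n) * hermite_poly n)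
          - pderiv (of_nat (Suc n) * hermite_poly n)"
    by (subst hermite_poly.simps) (simp only: pderiv_diff pderiv_mult Suc.IH X mult_1 mult_1_right add.commute)
  also have "pderiv (of_nat (Suc n) * hermite_poly n) = of_nat (Suc n) * pderiv (hermite_poly n)"
    by (simp add: pderiv_mult pderiv_of_nat del: of_nat_Suc)
  also have "hermite_poly (Suc n) + [:0, 1:] * (of_nat (Suc n) * hermite_poly n) - of_nat (Suc n) * pderiv (hermite_poly n)
      = hermite_poly (Suc n) + of_nat (Suc n) * hermite_poly (Suc n)"
    by (simp only: hermite_poly.simps right_diff_distrib mult.left_commute add_diff_eq)
  also have "\<dots> = of_nat (Suc (Suc n)) * hermite_poly (Suc n)"
    by (simp only: of_nat_Suc distrib_right mult_1)
  finally show ?case .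
qed

lemma hermite_poly_recurrence:
  "x * poly (hermite_poly n) x = poly (hermite_poly (Suc n)) x + real n * poly (hermite_poly (n - 1)) x"
proof (cases n)
  case (Suc m)
  have "poly (hermite_poly (Suc n)) x = x * poly (hermite_poly n) x - poly (pderiv (hermite_poly n)) x"
    by simp
  also have "poly (pderiv (hermite_poly n)) x = real n * poly (hermite_poly (n - 1)) x"
    unfolding Suc pderiv_hermite_poly by simp
  finally show ?thesis by simp
qed simp

lemma hermite_eq_hermite_poly: "hermite k x = poly (hermite_poly k) x / fact k"
proof -
  have "(deriv ^^ k) (\<lambda>t. exp (- (t\<^sup>2) / 2)) = (\<lambda>x. (- 1) ^ k * poly (hermite_poly k) x * exp (- (x\<^sup>2) / 2))"
  proof (induction k)
    case (Suc k)
    have "((\<lambda>x. (- 1) ^ k * poly (hermite_poly k) x * exp (- (x\<^sup>2) / 2)) has_field_derivative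
        (- 1) ^ Suc k * poly (hermite_poly (Suc k)) x * exp (- (x\<^sup>2) / 2)) (at x)" for x :: real
      by (rule derivative_eq_intros poly_DERIV refl | simp)+ (simp add: algebra_simps)
    then show ?case using Suc by (auto intro!: DERIV_imp_deriv)
  qed simp
  then show ?thesis
    by (simp add: hermite_def exp_minus power_mult_distrib[symmetric] field_simps)
qed

text \<open>
  Multiplication by \<open>W b\<close> acts on the expansion through the three-term recurrence: the coefficient of the
  \<open>j\<close>-th polynomial receives those of index \<open>j - 1\<close> and \<open>j + 1\<close>.  The degrees of the coefficients fall with \<open>j\<close>, which
  is the gain exploited in the bound for the fourth moment.
\<close>
lemma gauss_poly_hermite_expansion:
  "gauss_poly W (insert b B) n f \<Longrightarrow>
    \<exists>G. (\<forall>j\<le>n. gauss_poly W B (n - j) (G j)) \<and>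
        f = (\<lambda>w. \<Sum>j\<le>n. poly (hermite_poly j) (W b w) * G j w)"
proof (induction rule: gauss_poly.induct)
  case (const n c)
  show ?case
    by (rule exI[of _ "\<lambda>j _. if j = 0 then c else 0"])
       (auto intro: gauss_poly.const simp: if_distrib[of "(*) _"] sum.delta cong: if_cong)
next
  case (add n f g)
  then obtain F G where
    F: "\<And>j. j \<le> n \<Longrightarrow> gauss_poly W B (n - j) (F j)" "f = (\<lambda>w. \<Sum>j\<le>n. poly (hermite_poly j) (W b w) * F j w)" and
    G: "\<And>j. j \<le> n \<Longrightarrow> gauss_poly W B (n - j) (G j)" "g = (\<lambda>w. \<Sum>j\<le>n. poly (hermite_poly j) (W b w) * G j w)"
    by auto
  then show ?case
    by (intro exI[of _ "\<lambda>j w. F j w + G j w"]) (auto intro: gauss_poly.add simp: sum.distrib distrib_left)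
next
  case (mult v n f)
  then obtain G where
    G: "\<And>j. j \<le> n \<Longrightarrow> gauss_poly W B (n - j) (G j)"
    and f: "f = (\<lambda>w. \<Sum>j\<le>n. poly (hermite_poly j) (W b w) * G j w)"
    by auto
  show ?case
  proof (cases "v = b")
    case False
    then have v: "v \<in> B" using mult.hyps by simp
    show ?thesis
    proof (intro exI[of _ "\<lambda>j w. if j \<le> n then W v w * G j w else 0"] conjI allI impI)
      fix j assume "j \<le> Suc n"
      show "gauss_poly W B (Suc n - j) (\<lambda>w. if j \<le> n then W v w * G j w else 0)"
        using gauss_poly.mult[OF v G, of j] by (cases "j \<le> n") (auto simp: Suc_diff_le intro: gauss_poly.const)
    qed (auto simp: f sum_distrib_left mult.left_commute)
  next
    case True
    \<comment> \<open>Coefficients extended by \<open>0\<close>, so that both sums can be shifted.\<close>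
    define G0 where "G0 j w = (if j \<le> n then G j w else 0)" for j w
    have G0: "gauss_poly W B (n - j) (G0 j)" for j
      using G[of j] by (cases "j \<le> n") (auto simp: G0_def[abs_def] intro: gauss_poly.const)
    define H where "H j w = (if j = 0 then 0 else G0 (j - 1) w) + real (Suc j) * G0 (Suc j) w" for j w
    have "W b w * f w = (\<Sum>j\<le>Suc n. poly (hermite_poly j) (W b w) * H j w)" for w
    proof -
      let ?h = "\<lambda>j. poly (hermite_poly j) (W b w)"
      have "W b w * f w = (\<Sum>j\<le>n. (W b w * ?h j) * G0 j w)"
        by (simp add: f sum_distrib_left mult.assoc G0_def)
      also have "\<dots> = (\<Sum>j\<le>n. ?h (Suc j) * G0 j w) + (\<Sum>j\<le>n. real j * ?h (j - 1) * G0 j w)"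
        by (simp only: hermite_poly_recurrence distrib_right sum.distrib)
      also have "(\<Sum>j\<le>n. ?h (Suc j) * G0 j w) = (\<Sum>j\<le>Suc n. ?h j * (if j = 0 then 0 else G0 (j - 1) w))"
        by (subst sum.atMost_Suc_shift) simp
      also have "(\<Sum>j\<le>n. real j * ?h (j - 1) * G0 j w) = (\<Sum>j\<le>Suc (Suc n). real j * ?h (j - 1) * G0 j w)"
        by (simp add: G0_def)
      also have "\<dots> = (\<Sum>j\<le>Suc n. ?h j * (real (Suc j) * G0 (Suc j) w))"
        by (subst sum.atMost_Suc_shift) (simp add: mult_ac)
      finally show ?thesis by (simp only: H_def sum.distrib distrib_left)
    qed
    moreover have "gauss_poly W B (Suc n - j) (H j)" if "j \<le> Suc n" for j
    proof -
      have "gauss_poly W B (Suc n - j) (\<lambda>w. if j = 0 then 0 else G0 (j - 1) w)"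
      proof (cases j)
        case (Suc i) then show ?thesis using G0[of i] by simp
      qed (simp add: gauss_poly.const)
      moreover have "gauss_poly W B (Suc n - j) (\<lambda>w. real (Suc j) * G0 (Suc j) w)"
        by (rule gauss_poly_cmult, rule gauss_poly_mono_degree[OF _ G0]) simp
      ultimately show ?thesis unfolding H_def[abs_def] by (rule gauss_poly.add)
    qed
    ultimately show ?thesis unfolding True by (intro exI[of _ H]) auto
  qed
qed

text \<open>The expectation of \<open>p\<close> at a standard normal variable, as a linear functional of the polynomial.\<close>
definition gauss_expectation :: "real poly \<Rightarrow> real" where
  "gauss_expectation p = (\<Sum>i\<le>degree p. coeff p i * gauss_moment i)"

lemma gauss_expectation_upto: "degree p \<le> n \<Longrightarrow> gauss_expectation p = (\<Sum>i\<le>n. coeff p i * gauss_moment i)"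
  unfolding gauss_expectation_def by (rule sum.mono_neutral_left) (auto simp: coeff_eq_0)

lemma gauss_expectation_add: "gauss_expectation (p + q) = gauss_expectation p + gauss_expectation q"
proof -
  let ?n = "max (degree p) (degree q)"
  have "degree (p + q) \<le> ?n" by (rule degree_add_le_max)
  then show ?thesis
    using gauss_expectation_upto[of p ?n] gauss_expectation_upto[of q ?n] gauss_expectation_upto[of "p + q" ?n]
    by (simp add: distrib_right sum.distrib)
qed

lemma gauss_expectation_smult: "gauss_expectation (smult c p) = c * gauss_expectation p"
  using gauss_expectation_upto[of "smult c p" "degree p"]
  by (simp add: gauss_expectation_def sum_distrib_left mult.assoc degree_smult_le)

lemma gauss_expectation_diff: "gauss_expectation (p - q) = gauss_expectation p - gauss_expectation q"
  using gauss_expectation_add[of "p - q" q] by simp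

lemma gauss_expectation_0 [simp]: "gauss_expectation 0 = 0" and gauss_expectation_1 [simp]: "gauss_expectation 1 = 1"
  by (simp_all add: gauss_expectation_def)

text \<open>Gaussian integration by parts; it restates the recursion of the moments.\<close>
lemma gauss_expectation_Stein: "gauss_expectation ([:0, 1:] * p) = gauss_expectation (pderiv p)"
proof -
  let ?n = "Suc (degree p)"
  have "gauss_expectation ([:0, 1:] * p) = (\<Sum>i\<le>Suc ?n. coeff (pCons 0 p) i * gauss_moment i)"
    using gauss_expectation_upto[of "pCons 0 p" "Suc ?n"] degree_pCons_le[of 0 p] by simp
  also have "\<dots> = (\<Sum>i\<le>?n. coeff p i * gauss_moment (Suc i))"
    by (subst sum.atMost_Suc_shift) simp
  also have "\<dots> = (\<Sum>i\<le>degree p. coeff p (Suc i) * gauss_moment (Suc (Suc i)))"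
    by (subst sum.atMost_Suc_shift) simp
  also have "\<dots> = (\<Sum>i\<le>degree p. coeff (pderiv p) i * gauss_moment i)"
    by (simp add: gauss_moment_Suc coeff_pderiv mult_ac add_ac)
  also have "\<dots> = gauss_expectation (pderiv p)"
    by (rule gauss_expectation_upto[symmetric]) (simp add: degree_pderiv)
  finally show ?thesis .
qed

lemma gauss_expectation_hermite_Suc:
  "gauss_expectation (hermite_poly (Suc n) * p) = gauss_expectation (hermite_poly n * pderiv p)"
proof -
  have "hermite_poly (Suc n) * p = [:0, 1:] * (hermite_poly n * p) - pderiv (hermite_poly n) * p"
    by (simp only: hermite_poly.simps left_diff_distrib mult.assoc)
  then have "gauss_expectation (hermite_poly (Suc n) * p)
      = gauss_expectation (pderiv (hermite_poly n * p)) - gauss_expectation (pderiv (hermite_poly n) * p)"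
    by (simp only: gauss_expectation_diff gauss_expectation_Stein)
  also have "\<dots> = gauss_expectation (hermite_poly n * pderiv p)"
    by (simp only: pderiv_mult gauss_expectation_add) (simp add: mult.commute)
  finally show ?thesis .
qed

text \<open>Each integration by parts removes one Hermite index and differentiates the other factor.\<close>
lemma gauss_expectation_hermite_orthogonal:
  "gauss_expectation (hermite_poly i * hermite_poly j) = (if i = j then fact i else 0)"
proof (induction i arbitrary: j)
  case 0
  show ?case
  proof (cases j)
    case (Suc k)
    then show ?thesis using gauss_expectation_hermite_Suc[of k 1] by simp
  qed simp
next
  case (Suc i)
  show ?case
  proof (cases j)
    case 0
    then show ?thesis using gauss_expectation_hermite_Suc[of i 1] by simp
  next
    case (Suc k)
    have "of_nat (Suc k) * hermite_poly k = smult (real (Suc k)) (hermite_poly k)"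
      by (simp only: of_nat_poly) simp
    then have "gauss_expectation (hermite_poly (Suc i) * hermite_poly j)
       = real (Suc k) * gauss_expectation (hermite_poly i * hermite_poly k)"
      unfolding gauss_expectation_hermite_Suc Suc pderiv_hermite_poly
      by (simp only: mult_smult_right gauss_expectation_smult)
    then show ?thesis by (simp add: Suc.IH Suc)
  qed
qed

lemma sum_power4_le:
  fixes a :: "'i \<Rightarrow> real"
  shows "(\<Sum>i\<in>I. a i) ^ 4 \<le> real (card I) ^ 3 * (\<Sum>i\<in>I. a i ^ 4)"
proof -
  have "(\<Sum>i\<in>I. a i) ^ 4 = ((\<Sum>i\<in>I. a i)\<^sup>2)\<^sup>2" by (simp add: power_mult[symmetric])
  also have "\<dots> \<le> ((\<Sum>i\<in>I. (a i)\<^sup>2) * card I)\<^sup>2"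
    by (intro power_mono sum_squared_le_sum_of_squares) auto
  also have "\<dots> = (\<Sum>i\<in>I. (a i)\<^sup>2)\<^sup>2 * (real (card I))\<^sup>2" by (simp add: power_mult_distrib)
  also have "\<dots> \<le> ((\<Sum>i\<in>I. ((a i)\<^sup>2)\<^sup>2) * card I) * (real (card I))\<^sup>2"
    by (intro mult_right_mono sum_squared_le_sum_of_squares) auto
  also have "\<dots> = real (card I) ^ 3 * (\<Sum>i\<in>I. a i ^ 4)"
    by (simp add: power4_eq_xxxx power2_eq_square power3_eq_cube mult.assoc)
  finally show ?thesis .
qed

text \<open>
  The base of the exponential growth in the degree.  The summand \<open>4\<close> absorbs the mixed terms of the
  expansion of a fourth power, the other summand the pure fourth power of the remainder.
\<close>
definition hyper_const :: "nat \<Rightarrow> real" where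
  "hyper_const N = 4 + 3 * real N ^ 3 * (\<Sum>j\<le>N. \<bar>gauss_expectation (hermite_poly j ^ 4)\<bar>)"

text \<open>Gram--Schmidt orthonormalisation.\<close>
lemma orthonormal_basis_of_finite:
  fixes S :: "'v::real_inner set"
  assumes "finite S"
  shows "\<exists>B. finite B \<and> pairwise orthogonal B \<and> (\<forall>b\<in>B. norm b = 1) \<and> S \<subseteq> span B"
  using assms
proof (induction S rule: finite_induct)
  case empty
  show ?case by (rule exI[of _ "{}"]) auto
next
  case (insert v S)
  then obtain B where B: "finite B" "pairwise orthogonal B" "\<And>b. b \<in> B \<Longrightarrow> norm b = 1" "S \<subseteq> span B"
    by auto
  define p where "p = (\<Sum>b\<in>B. (v \<bullet> b) *\<^sub>R b)"
  define u where "u = v - p"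
  have p: "p \<in> span B" unfolding p_def by (intro span_sum span_scale span_base)
  have ortho: "u \<bullet> b = 0" if b: "b \<in> B" for b
  proof -
    have "p \<bullet> b = (\<Sum>c\<in>B. if c = b then v \<bullet> b else 0)"
      unfolding p_def inner_sum_left
    proof (intro sum.cong refl)
      fix c assume "c \<in> B"
      then show "((v \<bullet> c) *\<^sub>R c) \<bullet> b = (if c = b then v \<bullet> b else 0)"
        using B(2,3) b by (auto simp: pairwise_def orthogonal_def dot_square_norm)
    qed
    then show ?thesis using b B(1) by (simp add: u_def inner_diff_left)
  qed
  show ?case
  proof (cases "u = 0")
    case True
    then show ?thesis using B p by (intro exI[of _ B]) (auto simp: u_def)
  next
    case False
    let ?w = "(1 / norm u) *\<^sub>R u"
    have "u \<in> span (insert ?w B)"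
    proof -
      have "norm u *\<^sub>R ?w \<in> span (insert ?w B)" by (intro span_scale span_base) simp
      then show ?thesis using False by simp
    qed
    moreover have "p \<in> span (insert ?w B)" using p span_mono[of B "insert ?w B"] by auto
    ultimately have "u + p \<in> span (insert ?w B)" by (rule span_add)
    moreover have "pairwise orthogonal (insert ?w B)"
      using B(2) ortho by (auto simp: pairwise_insert orthogonal_def inner_commute)
    ultimately show ?thesis
      using B False span_mono[of B "insert ?w B"]
      by (intro exI[of _ "insert ?w B"]) (auto simp: u_def)
  qed
qed

locale isonormal = prob_space M for M :: "'w measure" +
  fixes W :: "'v::real_inner \<Rightarrow> 'w \<Rightarrow> real"
  assumes isonormal: "isonormal_process M W"
begin

lemma W_inner: "expectation (\<lambda>w. W u w * W v w) = u \<bullet> v"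
  using isonormal unfolding isonormal_process_def by (simp only:)

text \<open>The standard deviation of \<open>W v\<close> is \<open>norm v\<close>, by the covariance formula; the degenerate case is \<open>v = 0\<close>.\<close>
lemma W_moment_aux:
  "W v \<in> borel_measurable M \<and> (\<forall>k. integrable M (\<lambda>w. W v w ^ k) \<and> expectation (\<lambda>w. W v w ^ k) = gauss_moment k * norm v ^ k)"
proof -
  have "\<forall>S c. finite S \<longrightarrow> centered_gaussian M (\<lambda>w. \<Sum>v\<in>S. c v * W v w)"
    using isonormal unfolding isonormal_process_def by (rule conjunct1)
  from this[rule_format, of "{v}" "\<lambda>_. 1"] have cg: "centered_gaussian M (W v)" by simp
  then have [measurable]: "W v \<in> borel_measurable M" by (simp add: centered_gaussian_def)
  have var: "expectation (\<lambda>w. W v w ^ 2) = norm v ^ 2"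
  proof -
    have "expectation (\<lambda>w. W v w * W v w) = v \<bullet> v"
      using W_inner .
    then show ?thesis by (simp only: power2_eq_square power2_norm_eq_inner[symmetric])
  qed
  from cg consider (zero) "AE w in M. W v w = 0"
    | (pos) \<sigma> where "0 < \<sigma>" "distributed M lborel (W v) (\<lambda>x. ennreal (normal_density 0 \<sigma> x))"
    unfolding centered_gaussian_def by blast
  then show ?thesis
  proof cases
    case zero
    have pw: "AE w in M. W v w ^ k = 0 ^ k" for k using zero by eventually_elim simp
    have E: "expectation (\<lambda>w. W v w ^ k) = 0 ^ k" for k
      using integral_cong_AE[OF _ _ pw, of k] by (simp add: prob_space)
    have I: "integrable M (\<lambda>w. W v w ^ k)" for k
      using integrable_cong_AE[OF _ _ pw, of k] by simp
    have "norm v = 0" using var E[of 2] by simp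
    then show ?thesis using E I \<open>W v \<in> borel_measurable M\<close> by (auto simp: power_0_left)
  next
    case pos
    have nd: "integrable lborel (\<lambda>x. normal_density 0 \<sigma> x * x ^ k) \<and>
          integral\<^sup>L lborel (\<lambda>x. normal_density 0 \<sigma> x * x ^ k) = gauss_moment k * \<sigma> ^ k" for k
    proof (cases "even k")
      case True
      then obtain m where k: "k = 2 * m" by blast
      have "fact (2 * m) / ((2 / \<sigma>\<^sup>2) ^ m * fact m) = gauss_moment k * \<sigma> ^ k"
        using pos(1) by (simp add: gauss_moment_def k power_divide power_mult)
      then show ?thesis
        using normal_moment_even[OF pos(1), of 0 m] by (auto simp: has_bochner_integral_iff k)
    next
      case False
      then obtain m where k: "k = 2 * m + 1" using oddE by blast
      then show ?thesis
        using normal_moment_odd[OF pos(1), of 0 m] False by (auto simp: has_bochner_integral_iff gauss_moment_def)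
    qed
    have EI: "integrable M (\<lambda>w. W v w ^ k) \<and> expectation (\<lambda>w. W v w ^ k) = gauss_moment k * \<sigma> ^ k" for k
    proof -
      have "integrable lborel (\<lambda>x. normal_density 0 \<sigma> x * x ^ k) \<longleftrightarrow> integrable M (\<lambda>w. W v w ^ k)"
        by (rule distributed_integrable[OF pos(2)]) auto
      moreover have "(\<integral>x. normal_density 0 \<sigma> x * x ^ k \<partial>lborel) = expectation (\<lambda>w. W v w ^ k)"
        by (rule distributed_integral[OF pos(2)]) auto
      ultimately show ?thesis using nd[of k] by metis
    qed
    have "gauss_moment 2 = 1" by (simp add: gauss_moment_def)
    then have "\<sigma>\<^sup>2 = (norm v)\<^sup>2" using EI[of 2] var by simp
    then have "\<sigma> = norm v" using pos(1) by (simp add: power2_eq_iff_nonneg)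
    then show ?thesis using EI by simp
  qed
qed

lemma W_measurable [measurable]: "W v \<in> borel_measurable M"
  and W_moment: "expectation (\<lambda>w. W v w ^ k) = gauss_moment k * norm v ^ k"
  and W_all_moments [simp, intro]: "W v \<in> all_moments"
proof -
  show "W v \<in> borel_measurable M" "expectation (\<lambda>w. W v w ^ k) = gauss_moment k * norm v ^ k"
    using W_moment_aux[of v] by auto
  then show "W v \<in> all_moments"
    using W_moment_aux[of v] integrable_abs[of M "\<lambda>w. W v w ^ _"] by (auto simp: all_moments_def power_abs)
qed

text \<open>The second moment of the difference vanishes, by the covariance formula.\<close>
lemma W_linear: "AE w in M. W (a *\<^sub>R u + b *\<^sub>R v) w = a * W u w + b * W v w"
proof -
  let ?w = "a *\<^sub>R u + b *\<^sub>R v"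
  let ?D = "\<lambda>w. W ?w w - (a * W u w + b * W v w)"
  have I: "integrable M (\<lambda>w. W x w * W y w)" for x y
    by (intro all_moments_integrable all_moments_mult) auto
  have eq: "(?D w)\<^sup>2 = W ?w w * W ?w w - 2 * a * (W ?w w * W u w) - 2 * b * (W ?w w * W v w)
      + a\<^sup>2 * (W u w * W u w) + 2 * a * b * (W u w * W v w) + b\<^sup>2 * (W v w * W v w)" for w
    by (simp add: power2_eq_square algebra_simps)
  have "expectation (\<lambda>w. (?D w)\<^sup>2) = ?w \<bullet> ?w - 2 * a * (?w \<bullet> u) - 2 * b * (?w \<bullet> v)
      + a\<^sup>2 * (u \<bullet> u) + 2 * a * b * (u \<bullet> v) + b\<^sup>2 * (v \<bullet> v)"
    unfolding eq by (simp add: I W_inner)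
  also have "\<dots> = 0"
    by (simp add: inner_add_left inner_add_right power2_eq_square algebra_simps inner_commute)
  finally have "expectation (\<lambda>w. (?D w)\<^sup>2) = 0" .
  moreover have "integrable M (\<lambda>w. (?D w)\<^sup>2)" unfolding eq by (simp add: I)
  ultimately have "AE w in M. (?D w)\<^sup>2 = 0"
    by (subst (asm) integral_nonneg_eq_0_iff_AE) auto
  then show ?thesis by eventually_elim simp
qed

lemma gauss_poly_all_moments: "gauss_poly W B n f \<Longrightarrow> f \<in> all_moments"
  by (induction rule: gauss_poly.induct) auto

lemma expectation_Cauchy_Schwarz:
  assumes X: "X \<in> all_moments" and Y: "Y \<in> all_moments"
  shows "(expectation (\<lambda>w. X w * Y w))\<^sup>2 \<le> expectation (\<lambda>w. (X w)\<^sup>2) * expectation (\<lambda>w. (Y w)\<^sup>2)"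
proof -
  let ?P = "expectation (\<lambda>w. (X w)\<^sup>2)" and ?Q = "expectation (\<lambda>w. X w * Y w)" and ?S = "expectation (\<lambda>w. (Y w)\<^sup>2)"
  have I: "integrable M (\<lambda>w. (X w)\<^sup>2)" "integrable M (\<lambda>w. X w * Y w)" "integrable M (\<lambda>w. (Y w)\<^sup>2)"
    using X Y by (auto intro!: all_moments_integrable)
  have *: "0 \<le> ?P - 2 * t * ?Q + t\<^sup>2 * ?S" for t
  proof -
    have "0 \<le> expectation (\<lambda>w. (X w - t * Y w)\<^sup>2)" by simp
    also have "(\<lambda>w. (X w - t * Y w)\<^sup>2) = (\<lambda>w. (X w)\<^sup>2 - 2 * t * (X w * Y w) + t\<^sup>2 * (Y w)\<^sup>2)"
      by (auto simp: power2_eq_square algebra_simps)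
    finally show ?thesis using I by simp
  qed
  show ?thesis
  proof (cases "?S = 0")
    case True
    then have "AE w in M. (Y w)\<^sup>2 = 0"
      using I(3) by (subst (asm) integral_nonneg_eq_0_iff_AE) auto
    then have "?Q = expectation (\<lambda>_. 0)"
      using X Y by (intro integral_cong_AE) (auto elim: eventually_mono)
    then show ?thesis by (simp add: True)
  next
    case False
    then have S: "0 < ?S" by (simp add: less_le)
    have "0 \<le> (?P - 2 * (?Q / ?S) * ?Q + (?Q / ?S)\<^sup>2 * ?S) * ?S"
      using *[of "?Q / ?S"] S by (intro mult_nonneg_nonneg) auto
    also have "\<dots> = ?P * ?S - ?Q\<^sup>2"
      using S by (simp add: field_simps power2_eq_square)
    finally show ?thesis by simp
  qed
qed

lemma W_sum:
  assumes "finite B"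
  shows "AE w in M. W (\<Sum>b\<in>B. c b *\<^sub>R b) w = (\<Sum>b\<in>B. c b * W b w)"
  using assms
proof (induction B)
  case empty
  show ?case using W_linear[of 0 0 0 0] by simp
next
  case (insert b B)
  have "AE w in M. W (c b *\<^sub>R b + 1 *\<^sub>R (\<Sum>b\<in>B. c b *\<^sub>R b)) w = c b * W b w + 1 * W (\<Sum>b\<in>B. c b *\<^sub>R b) w"
    by (rule W_linear)
  with insert.IH show ?case by eventually_elim (simp add: insert.hyps)
qed

text \<open>
  The substitute for independence.  By induction on \<open>B\<close> the claim is known for the coefficients \<open>G\<close> of the
  expansion along \<open>b\<close> and for every vector orthogonal to the smaller set, in particular for
  \<open>t b + u\<close>.  Both sides are polynomials in \<open>t\<close>; comparing coefficients separates the powers of \<open>W b\<close>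
  from those of \<open>W u\<close>.
\<close>
lemma gauss_poly_orthogonal_moment:
  assumes "gauss_poly W B n Q" "finite B" "pairwise orthogonal B" "\<And>b. b \<in> B \<Longrightarrow> orthogonal b u"
  shows "expectation (\<lambda>w. Q w * W u w ^ k) = expectation Q * (gauss_moment k * norm u ^ k)"
  using assms(2,1,3,4)
proof (induction B arbitrary: n Q u k rule: finite_induct)
  case empty
  then obtain c where "Q = (\<lambda>_. c)" using gauss_poly_empty by blast
  then show ?case by (simp add: W_moment prob_space)
next
  case (insert b B)
  have ortho: "pairwise orthogonal B" "orthogonal b u" "\<And>v. v \<in> B \<Longrightarrow> orthogonal v b" "\<And>v. v \<in> B \<Longrightarrow> orthogonal v u"
    using insert.prems insert.hyps by (auto simp: pairwise_insert)
  have *: "expectation (\<lambda>w. G w * W b w ^ j * W u w ^ k)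
      = expectation G * (gauss_moment j * norm b ^ j) * (gauss_moment k * norm u ^ k)"
    if G: "gauss_poly W B m G" for G m j k
  proof -
    have Gm: "G \<in> all_moments" using G by (rule gauss_poly_all_moments)
    let ?l = "j + k"
    let ?c = "\<lambda>i. of_nat (?l choose i) * expectation (\<lambda>w. G w * W b w ^ i * W u w ^ (?l - i))"
    let ?d = "\<lambda>i. of_nat (?l choose i) * (expectation G * (gauss_moment i * norm b ^ i) * (gauss_moment (?l - i) * norm u ^ (?l - i)))"
    have "(\<Sum>i\<le>?l. ?c i * t ^ i) = (\<Sum>i\<le>?l. ?d i * t ^ i)" for t
    proof -
      have int: "integrable M (\<lambda>w. G w * W b w ^ i * W u w ^ i')" for i i'
        by (intro all_moments_integrable all_moments_mult all_moments_power Gm) auto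
      have "(\<Sum>i\<le>?l. ?c i * t ^ i) = (\<Sum>i\<le>?l. expectation (\<lambda>w. of_nat (?l choose i) * t ^ i * (G w * W b w ^ i * W u w ^ (?l - i))))"
        by (intro sum.cong refl, subst Bochner_Integration.integral_mult_right_zero) (simp only: mult_ac)
      also have "\<dots> = expectation (\<lambda>w. \<Sum>i\<le>?l. of_nat (?l choose i) * t ^ i * (G w * W b w ^ i * W u w ^ (?l - i)))"
        by (rule Bochner_Integration.integral_sum[symmetric]) (intro integrable_mult_right int)
      also have "\<dots> = expectation (\<lambda>w. G w * (t * W b w + W u w) ^ ?l)"
        by (simp add: binomial_ring sum_distrib_left power_mult_distrib mult_ac)
      also have "\<dots> = expectation (\<lambda>w. G w * W (t *\<^sub>R b + 1 *\<^sub>R u) w ^ ?l)"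
      proof (rule integral_cong_AE)
        show "AE w in M. G w * (t * W b w + W u w) ^ ?l = G w * W (t *\<^sub>R b + 1 *\<^sub>R u) w ^ ?l"
          using W_linear[of t b 1 u] by eventually_elim simp
      qed (use Gm in measurable)
      also have "\<dots> = expectation G * (gauss_moment ?l * norm (t *\<^sub>R b + 1 *\<^sub>R u) ^ ?l)"
        by (rule insert.IH[OF G ortho(1)]) (use ortho in \<open>auto intro: orthogonal_clauses\<close>)
      also have "norm (t *\<^sub>R b + 1 *\<^sub>R u) = sqrt (t\<^sup>2 * (norm b)\<^sup>2 + (norm u)\<^sup>2)"
        using ortho(2) by (simp add: norm_eq_sqrt_inner inner_add_left inner_add_right orthogonal_def inner_commute power2_eq_square)
      also have "gauss_moment ?l * sqrt (t\<^sup>2 * (norm b)\<^sup>2 + (norm u)\<^sup>2) ^ ?l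
         = (\<Sum>i\<le>?l. of_nat (?l choose i) * (gauss_moment i * norm b ^ i) * (gauss_moment (?l - i) * norm u ^ (?l - i)) * t ^ i)"
        by (rule gauss_moment_binomial)
      also have "expectation G * \<dots> = (\<Sum>i\<le>?l. ?d i * t ^ i)"
        by (simp add: sum_distrib_left mult_ac)
      finally show ?thesis .
    qed
    then have "\<forall>i\<le>?l. ?c i = ?d i"
      using polyfun_eq_coeffs[where c="?c" and d="?d" and n="?l"] by blast
    note this[rule_format, of j, OF le_add1]
    then show ?thesis by (simp add: binomial_eq_0_iff)
  qed
  obtain G where G: "\<And>j. j \<le> n \<Longrightarrow> gauss_poly W B (n - j) (G j)"
    and Q: "Q = (\<lambda>w. \<Sum>j\<le>n. poly (hermite_poly j) (W b w) * G j w)"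
    using gauss_poly_hermite_expansion[OF insert.prems(1)] by blast
  define g where "g j i = (\<lambda>w. coeff (hermite_poly j) i * (G j w * W b w ^ i))" for j i
  have Qg: "Q = (\<lambda>w. \<Sum>j\<le>n. \<Sum>i\<le>degree (hermite_poly j). g j i w)"
    by (simp add: Q poly_altdef sum_distrib_right sum_distrib_left g_def mult_ac)
  have gI: "integrable M (g j i)" "integrable M (\<lambda>w. g j i w * W u w ^ k)" if "j \<le> n" for i j
    unfolding g_def using gauss_poly_all_moments[OF G[OF that]]
    by (auto intro!: all_moments_integrable all_moments_mult all_moments_power)
  have "expectation (\<lambda>w. Q w * W u w ^ k) = (\<Sum>j\<le>n. \<Sum>i\<le>degree (hermite_poly j). expectation (\<lambda>w. g j i w * W u w ^ k))"
    by (simp add: Qg sum_distrib_right gI)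
  also have "\<dots> = (\<Sum>j\<le>n. \<Sum>i\<le>degree (hermite_poly j). expectation (g j i) * (gauss_moment k * norm u ^ k))"
  proof (intro sum.cong refl)
    fix j i assume "j \<in> {..n}"
    then have Gj: "gauss_poly W B (n - j) (G j)" using G by simp
    show "expectation (\<lambda>w. g j i w * W u w ^ k) = expectation (g j i) * (gauss_moment k * norm u ^ k)"
      using *[OF Gj, of i k] *[OF Gj, of i 0] by (simp add: g_def mult.assoc)
  qed
  also have "\<dots> = expectation Q * (gauss_moment k * norm u ^ k)"
    by (simp add: Qg gI sum_distrib_right)
  finally show ?case .
qed

lemma expectation_poly_W_times:
  assumes "gauss_poly W B n Q" "finite B" "pairwise orthogonal B" "\<And>b. b \<in> B \<Longrightarrow> orthogonal b u" "norm u = 1"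
  shows "expectation (\<lambda>w. poly p (W u w) * Q w) = gauss_expectation p * expectation Q"
proof -
  have Q: "Q \<in> all_moments" using assms(1) by (rule gauss_poly_all_moments)
  have "expectation (\<lambda>w. poly p (W u w) * Q w) = expectation (\<lambda>w. \<Sum>i\<le>degree p. coeff p i * (Q w * W u w ^ i))"
    by (simp add: poly_altdef sum_distrib_left mult_ac)
  also have "\<dots> = (\<Sum>i\<le>degree p. coeff p i * expectation (\<lambda>w. Q w * W u w ^ i))"
    using Q by (subst Bochner_Integration.integral_sum)
       (auto intro!: integrable_mult_right all_moments_integrable all_moments_mult all_moments_power)
  also have "\<dots> = gauss_expectation p * expectation Q"
    using gauss_poly_orthogonal_moment[OF assms(1-4)] assms(5)
    by (simp add: gauss_expectation_def sum_distrib_left mult_ac)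
  finally show ?thesis .
qed

text \<open>
  Bonami's induction.  Split \<open>F = H + R\<close>, where \<open>H\<close> is free of the new variable and \<open>R\<close> collects the terms
  with a Hermite polynomial of positive index.  In the fourth power the term linear in \<open>R\<close> has mean zero.
  Every other term containing \<open>R\<close> has coefficients of degree below \<open>n\<close>, hence carries at least one factor
  \<open>1 / hyper_const N\<close> from the induction hypothesis, and this pays for the numerical constants.
\<close>
lemma fourth_moment_orthonormal:
  assumes "finite B" "pairwise orthogonal B" "\<And>b. b \<in> B \<Longrightarrow> norm b = 1" "n \<le> N" "gauss_poly W B n F"
  shows "expectation (\<lambda>w. F w ^ 4) \<le> hyper_const N ^ (2 * n) * (expectation (\<lambda>w. (F w)\<^sup>2))\<^sup>2"
  using assms
proof (induction B arbitrary: n F rule: finite_induct)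
  case empty
  have A: "1 \<le> hyper_const N"
    by (auto simp: hyper_const_def intro!: add_increasing2 mult_nonneg_nonneg sum_nonneg)
  obtain c where "F = (\<lambda>_. c)" using empty gauss_poly_empty by blast
  then show ?case
    using mult_right_mono[OF one_le_power[OF A, of "2 * n"], of "c ^ 4"] by (simp add: prob_space power_mult[symmetric])
next
  case (insert b B)
  define A where "A = hyper_const N"
  have A4: "4 \<le> A"
    by (auto simp: A_def hyper_const_def intro!: mult_nonneg_nonneg sum_nonneg)
  have ortho: "pairwise orthogonal B" "\<And>v. v \<in> B \<Longrightarrow> orthogonal v b" "norm b = 1" "\<And>v. v \<in> B \<Longrightarrow> norm v = 1"
    using insert.prems insert.hyps by (auto simp: pairwise_insert)
  obtain G where G: "\<And>j. j \<le> n \<Longrightarrow> gauss_poly W B (n - j) (G j)"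
    and F: "F = (\<lambda>w. \<Sum>j\<le>n. poly (hermite_poly j) (W b w) * G j w)"
    using gauss_poly_hermite_expansion[OF insert.prems(4)] by blast
  define h where "h j w = poly (hermite_poly j) (W b w)" for j w
  have Eh: "expectation (\<lambda>w. poly p (W b w) * Q w) = gauss_expectation p * expectation Q"
    if "gauss_poly W B m Q" for p m Q
    using expectation_poly_W_times[OF that insert.hyps(1) ortho(1,2,3)] .
  have hm: "h j \<in> all_moments" for j
    unfolding h_def using gauss_poly_poly[of b UNIV "hermite_poly j" "degree (hermite_poly j)" W]
    by (auto intro: gauss_poly_all_moments)
  have Gm: "G j \<in> all_moments" if "j \<le> n" for j using G[OF that] by (rule gauss_poly_all_moments)
  note am = all_moments_mult all_moments_power all_moments_sum hm Gm
  have sq: "expectation (\<lambda>w. (\<Sum>i\<in>I. h i w * G i w)\<^sup>2 * Q w) = (\<Sum>i\<in>I. fact i * expectation (\<lambda>w. (G i w)\<^sup>2 * Q w))"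
    if I: "I \<subseteq> {..n}" and Q: "gauss_poly W B m Q" for I m Q
  proof -
    have fin: "finite I" using I finite_subset by blast
    have Qm: "Q \<in> all_moments" using Q by (rule gauss_poly_all_moments)
    have one: "expectation (\<lambda>w. h i w * G i w * (h j w * G j w) * Q w)
        = (if i = j then fact i * expectation (\<lambda>w. (G i w)\<^sup>2 * Q w) else 0)" if ij: "i \<in> I" "j \<in> I" for i j
    proof -
      have "gauss_poly W B ((n - i) + (n - j) + m) (\<lambda>w. G i w * G j w * Q w)"
        using ij I by (intro gauss_poly_prod G Q) auto
      from Eh[OF this, of "hermite_poly i * hermite_poly j"]
      show ?thesis by (simp add: gauss_expectation_hermite_orthogonal h_def mult_ac power2_eq_square)
    qed
    have "expectation (\<lambda>w. (\<Sum>i\<in>I. h i w * G i w)\<^sup>2 * Q w)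
        = expectation (\<lambda>w. \<Sum>i\<in>I. \<Sum>j\<in>I. h i w * G i w * (h j w * G j w) * Q w)"
      by (simp only: power2_eq_square sum_product) (simp only: sum_distrib_right)
    also have "\<dots> = (\<Sum>i\<in>I. \<Sum>j\<in>I. expectation (\<lambda>w. h i w * G i w * (h j w * G j w) * Q w))"
      using I Qm
      by (simp add: Bochner_Integration.integral_sum all_moments_integrable am subset_eq)
    also have "\<dots> = (\<Sum>i\<in>I. \<Sum>j\<in>I. if i = j then fact i * expectation (\<lambda>w. (G i w)\<^sup>2 * Q w) else 0)"
      by (intro sum.cong refl one)
    also have "\<dots> = (\<Sum>i\<in>I. fact i * expectation (\<lambda>w. (G i w)\<^sup>2 * Q w))"
      using fin by simp
    finally show ?thesis .
  qed
  define H where "H = G 0"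
  define R where "R w = (\<Sum>j\<in>{1..n}. h j w * G j w)" for w
  have split0: "(\<Sum>j\<le>n. f j) = f 0 + (\<Sum>j\<in>{1..n}. f j)" for f :: "nat \<Rightarrow> real"
  proof -
    have "{..n} = insert 0 {1..n}" by auto
    then show ?thesis by simp
  qed
  have FHR: "F = (\<lambda>w. H w + R w)"
    unfolding F H_def R_def split0 by (simp add: h_def)
  have H: "gauss_poly W B n H" using G[of 0] by (simp add: H_def)
  have Hm: "H \<in> all_moments" using H by (rule gauss_poly_all_moments)
  have Rm: "R \<in> all_moments" unfolding R_def[abs_def] by (intro am) auto
  define a where "a = expectation (\<lambda>w. (H w)\<^sup>2)"
  define m where "m j = expectation (\<lambda>w. (G j w)\<^sup>2)" for j
  define s where "s = (\<Sum>j\<in>{1..n}. fact j * m j)"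
  have a0: "0 \<le> a" unfolding a_def by simp
  have m0: "0 \<le> m j" for j unfolding m_def by simp
  have s0: "0 \<le> s" unfolding s_def by (intro sum_nonneg mult_nonneg_nonneg m0) auto
  have EF2: "expectation (\<lambda>w. (F w)\<^sup>2) = a + s"
  proof -
    have "expectation (\<lambda>w. (F w)\<^sup>2) = (\<Sum>i\<le>n. fact i * m i)"
      using sq[of "{..n}" 0 "\<lambda>_. 1"] by (simp add: gauss_poly.const F h_def m_def)
    then show ?thesis
      unfolding split0 by (simp add: s_def a_def H_def m_def)
  qed
  have IH: "expectation (\<lambda>w. G j w ^ 4) \<le> A ^ (2 * (n - j)) * (m j)\<^sup>2" if "j \<le> n" for j
    unfolding A_def m_def using insert.prems that
    by (intro insert.IH ortho G) (auto simp: pairwise_insert)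
  have EH4: "expectation (\<lambda>w. H w ^ 4) \<le> A ^ (2 * n) * a\<^sup>2"
    using IH[of 0] by (simp add: H_def a_def m_def)
  have EH3R: "expectation (\<lambda>w. H w ^ 3 * R w) = 0"
  proof -
    have "expectation (\<lambda>w. H w ^ 3 * R w) = (\<Sum>j\<in>{1..n}. expectation (\<lambda>w. h j w * (H w * H w * H w * G j w)))"
      unfolding R_def using Hm
      by (subst Bochner_Integration.integral_sum[symmetric])
         (auto simp: sum_distrib_left mult_ac power3_eq_cube intro!: all_moments_integrable am)
    also have "\<dots> = (\<Sum>j\<in>{1..n}. 0)"
    proof (intro sum.cong refl)
      fix j assume j: "j \<in> {1..n}"
      then have "gauss_poly W B (n + n + n + (n - j)) (\<lambda>w. H w * H w * H w * G j w)"
        by (intro gauss_poly_prod H G) auto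
      from Eh[OF this, of "hermite_poly j"]
      show "expectation (\<lambda>w. h j w * (H w * H w * H w * G j w)) = 0"
        using j gauss_expectation_hermite_orthogonal[of j 0] by (auto simp: h_def)
    qed
    finally show ?thesis by simp
  qed
  \<comment> \<open>Orthogonality leaves only diagonal terms, and Cauchy--Schwarz separates \<open>G j\<close> from \<open>H\<close>.\<close>
  have EH2R2: "A * expectation (\<lambda>w. (H w)\<^sup>2 * (R w)\<^sup>2) \<le> A ^ (2 * n) * (a * s)"
  proof -
    have "A * expectation (\<lambda>w. (G j w)\<^sup>2 * (H w)\<^sup>2) \<le> A ^ (2 * n) * (a * m j)" if j: "j \<in> {1..n}" for j
    proof -
      have "(expectation (\<lambda>w. (G j w)\<^sup>2 * (H w)\<^sup>2))\<^sup>2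
          \<le> expectation (\<lambda>w. ((G j w)\<^sup>2)\<^sup>2) * expectation (\<lambda>w. ((H w)\<^sup>2)\<^sup>2)"
        using j by (intro expectation_Cauchy_Schwarz all_moments_power Gm Hm) auto
      also have "\<dots> \<le> (A ^ (2 * (n - j)) * (m j)\<^sup>2) * (A ^ (2 * n) * a\<^sup>2)"
        using IH[of j] EH4 j A4 by (intro mult_mono) auto
      also have "\<dots> = (A ^ (n - j) * A ^ n * (a * m j))\<^sup>2"
        by (simp add: power_mult_distrib power_mult[symmetric] mult_ac)
      finally have "expectation (\<lambda>w. (G j w)\<^sup>2 * (H w)\<^sup>2) \<le> A ^ (n - j) * A ^ n * (a * m j)"
        by (rule power2_le_imp_le) (use A4 a0 m0 in auto)
      then have "A * expectation (\<lambda>w. (G j w)\<^sup>2 * (H w)\<^sup>2) \<le> A * (A ^ (n - j) * A ^ n * (a * m j))"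
        using A4 by (intro mult_left_mono) auto
      also have "\<dots> = A ^ (Suc (n - j) + n) * (a * m j)" by (simp add: power_add)
      also have "\<dots> \<le> A ^ (2 * n) * (a * m j)"
        using A4 j a0 m0 by (intro mult_right_mono power_increasing) auto
      finally show ?thesis .
    qed
    then have "(\<Sum>j\<in>{1..n}. fact j * (A * expectation (\<lambda>w. (G j w)\<^sup>2 * (H w)\<^sup>2)))
        \<le> (\<Sum>j\<in>{1..n}. fact j * (A ^ (2 * n) * (a * m j)))"
      by (intro sum_mono mult_left_mono) auto
    moreover have "A * expectation (\<lambda>w. (H w)\<^sup>2 * (R w)\<^sup>2)
        = (\<Sum>j\<in>{1..n}. fact j * (A * expectation (\<lambda>w. (G j w)\<^sup>2 * (H w)\<^sup>2)))"
      using sq[OF _ gauss_poly_square[OF H], of "{1..n}"]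
      by (simp add: R_def mult.commute[of "(H _)\<^sup>2"] sum_distrib_left mult.left_commute subset_eq)
    moreover have "(\<Sum>j\<in>{1..n}. fact j * (A ^ (2 * n) * (a * m j))) = A ^ (2 * n) * (a * s)"
      by (simp add: s_def sum_distrib_left mult_ac)
    ultimately show ?thesis by simp
  qed
  have ER4: "3 * expectation (\<lambda>w. R w ^ 4) \<le> A ^ (2 * n) * s\<^sup>2"
  proof -
    define c where "c = (\<Sum>j\<le>N. \<bar>gauss_expectation (hermite_poly j ^ 4)\<bar>)"
    have c0: "0 \<le> c" unfolding c_def by (intro sum_nonneg) auto
    have one: "A * expectation (\<lambda>w. (h j w * G j w) ^ 4) \<le> c * A ^ (2 * n) * (fact j * m j)\<^sup>2" if j: "j \<in> {1..n}" for j
    proof -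
      have "gauss_poly W B ((n - j) + (n - j) + (n - j) + (n - j)) (\<lambda>w. G j w * G j w * G j w * G j w)"
        using j by (intro gauss_poly_prod G) auto
      from Eh[OF this, of "hermite_poly j ^ 4"]
      have "expectation (\<lambda>w. (h j w * G j w) ^ 4) = gauss_expectation (hermite_poly j ^ 4) * expectation (\<lambda>w. G j w ^ 4)"
        by (simp add: h_def power_mult_distrib power4_eq_xxxx mult_ac)
      also have "\<dots> \<le> c * expectation (\<lambda>w. G j w ^ 4)"
      proof (rule mult_right_mono)
        have "gauss_expectation (hermite_poly j ^ 4) \<le> \<bar>gauss_expectation (hermite_poly j ^ 4)\<bar>" by simp
        also have "\<dots> \<le> c" unfolding c_def using j insert.prems(3) by (intro member_le_sum) auto
        finally show "gauss_expectation (hermite_poly j ^ 4) \<le> c" .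
      qed simp
      also have "\<dots> \<le> c * (A ^ (2 * (n - j)) * (m j)\<^sup>2)"
        using IH[of j] j c0 by (intro mult_left_mono) auto
      finally have "A * expectation (\<lambda>w. (h j w * G j w) ^ 4) \<le> A * (c * (A ^ (2 * (n - j)) * (m j)\<^sup>2))"
        using A4 by (intro mult_left_mono) auto
      also have "\<dots> = c * (A ^ Suc (2 * (n - j)) * (1 * m j)\<^sup>2)" by simp
      also have "\<dots> \<le> c * (A ^ (2 * n) * (fact j * m j)\<^sup>2)"
        using c0 A4 j m0
        by (intro mult_left_mono mult_mono power_increasing power_mono mult_right_mono) (auto simp: fact_ge_1)
      finally show ?thesis by (simp add: mult_ac)
    qed
    have "(\<Sum>j\<in>{1..n}. (fact j * m j)\<^sup>2) \<le> s\<^sup>2"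
    proof -
      have "(\<Sum>j\<in>{1..n}. (fact j * m j)\<^sup>2) \<le> (\<Sum>j\<in>{1..n}. fact j * m j * s)"
        unfolding power2_eq_square s_def using m0
        by (intro sum_mono mult_left_mono member_le_sum) auto
      then show ?thesis by (simp add: s_def sum_distrib_right power2_eq_square)
    qed
    have "A * expectation (\<lambda>w. R w ^ 4) \<le> A * expectation (\<lambda>w. real n ^ 3 * (\<Sum>j\<in>{1..n}. (h j w * G j w) ^ 4))"
      using A4 sum_power4_le[of "\<lambda>j. h j _ * G j _" "{1..n}"]
      by (intro mult_left_mono integral_mono all_moments_integrable all_moments_cmult am Rm) (auto simp: R_def)
    also have "\<dots> = real n ^ 3 * (\<Sum>j\<in>{1..n}. A * expectation (\<lambda>w. (h j w * G j w) ^ 4))"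
      by (simp add: Bochner_Integration.integral_sum all_moments_integrable am sum_distrib_left mult_ac)
    also have "\<dots> \<le> real n ^ 3 * (\<Sum>j\<in>{1..n}. c * A ^ (2 * n) * (fact j * m j)\<^sup>2)"
      by (intro mult_left_mono sum_mono one) auto
    also have "\<dots> = real n ^ 3 * c * A ^ (2 * n) * (\<Sum>j\<in>{1..n}. (fact j * m j)\<^sup>2)"
      by (simp add: sum_distrib_left mult_ac)
    also have "\<dots> \<le> real N ^ 3 * c * A ^ (2 * n) * s\<^sup>2"
      using insert.prems(3) c0 A4 \<open>(\<Sum>j\<in>{1..n}. (fact j * m j)\<^sup>2) \<le> s\<^sup>2\<close>
      by (intro mult_mono power_mono) (auto intro!: mult_nonneg_nonneg sum_nonneg)
    finally have "3 * (A * expectation (\<lambda>w. R w ^ 4)) \<le> (3 * real N ^ 3 * c) * (A ^ (2 * n) * s\<^sup>2)" by simp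
    also have "\<dots> \<le> A * (A ^ (2 * n) * s\<^sup>2)"
      using A4 by (intro mult_right_mono) (auto simp: A_def hyper_const_def c_def)
    finally have "A * (3 * expectation (\<lambda>w. R w ^ 4)) \<le> A * (A ^ (2 * n) * s\<^sup>2)" by simp
    then show ?thesis using A4 by simp
  qed
  \<comment> \<open>The cubic term is split by \<open>4 H R\<^sup>3 \<le> 2 H\<^sup>2 R\<^sup>2 + 2 R\<^sup>4\<close>.\<close>
  have pt: "(H w + R w) ^ 4 \<le> H w ^ 4 + 4 * (H w ^ 3 * R w) + 8 * ((H w)\<^sup>2 * (R w)\<^sup>2) + 3 * R w ^ 4" for w
  proof -
    have "0 \<le> 2 * (R w)\<^sup>2 * (H w - R w)\<^sup>2" by simp
    then show ?thesis by (simp add: power4_eq_xxxx power3_eq_cube power2_eq_square algebra_simps)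
  qed
  have "expectation (\<lambda>w. F w ^ 4)
      \<le> expectation (\<lambda>w. H w ^ 4 + 4 * (H w ^ 3 * R w) + 8 * ((H w)\<^sup>2 * (R w)\<^sup>2) + 3 * R w ^ 4)"
    unfolding FHR using pt
    by (intro integral_mono all_moments_integrable all_moments_add all_moments_cmult am Rm Hm) auto
  also have "\<dots> = expectation (\<lambda>w. H w ^ 4) + 4 * expectation (\<lambda>w. H w ^ 3 * R w)
      + 8 * expectation (\<lambda>w. (H w)\<^sup>2 * (R w)\<^sup>2) + 3 * expectation (\<lambda>w. R w ^ 4)"
    by (simp add: all_moments_integrable am Rm Hm)
  also have "\<dots> \<le> A ^ (2 * n) * a\<^sup>2 + 2 * (A ^ (2 * n) * (a * s)) + A ^ (2 * n) * s\<^sup>2"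
  proof -
    have "4 * expectation (\<lambda>w. (H w)\<^sup>2 * (R w)\<^sup>2) \<le> A * expectation (\<lambda>w. (H w)\<^sup>2 * (R w)\<^sup>2)"
      using A4 by (intro mult_right_mono) auto
    then show ?thesis using EH4 EH3R EH2R2 ER4 by linarith
  qed
  also have "\<dots> = A ^ (2 * n) * (a + s)\<^sup>2" by (simp add: power2_eq_square algebra_simps)
  finally show ?case unfolding EF2 A_def .
qed

text \<open>Every \<open>W v\<close> is almost surely a linear combination of the variables of the basis.\<close>
lemma gauss_poly_orthonormal_version:
  assumes "gauss_poly W S n f" "finite B" "S \<subseteq> span B"
  shows "\<exists>g. gauss_poly W B n g \<and> (AE w in M. f w = g w)"
  using assms(1)
proof (induction rule: gauss_poly.induct)
  case (const n c)
  show ?case by (rule exI[of _ "\<lambda>_. c"]) (auto intro: gauss_poly.const)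
next
  case (add n f g)
  then obtain f' g' where "gauss_poly W B n f'" "AE w in M. f w = f' w" "gauss_poly W B n g'" "AE w in M. g w = g' w"
    by auto
  moreover from this(2,4) have "AE w in M. f w + g w = f' w + g' w" by eventually_elim simp
  ultimately show ?case by (intro exI[of _ "\<lambda>w. f' w + g' w"]) (auto intro: gauss_poly.add)
next
  case (mult v n f)
  then obtain f' where f': "gauss_poly W B n f'" "AE w in M. f w = f' w" by auto
  obtain c where v: "v = (\<Sum>b\<in>B. c b *\<^sub>R b)"
    using mult.hyps assms(3) by (auto simp: span_finite[OF assms(2)])
  have "gauss_poly W B (Suc n) (\<lambda>w. \<Sum>b\<in>B. c b * (W b w * f' w))"
    by (intro gauss_poly_sum gauss_poly_cmult gauss_poly.mult f')
  moreover have "AE w in M. W v w * f w = (\<Sum>b\<in>B. c b * (W b w * f' w))"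
    using W_sum[OF assms(2), of c] f'(2) unfolding v[symmetric]
    by eventually_elim (simp add: sum_distrib_right mult.assoc)
  ultimately show ?case by blast
qed

theorem fourth_moment:
  assumes "gauss_poly W B n F"
  shows "expectation (\<lambda>w. F w ^ 4) \<le> hyper_const n ^ (2 * n) * (expectation (\<lambda>w. (F w)\<^sup>2))\<^sup>2"
proof -
  obtain S where S: "finite S" "gauss_poly W S n F" using gauss_poly_finite_support[OF assms] by auto
  obtain C where C: "finite C" "pairwise orthogonal C" "\<forall>b\<in>C. norm b = 1" "S \<subseteq> span C"
    using orthonormal_basis_of_finite[OF S(1)] by blast
  obtain G where G: "gauss_poly W C n G" and eq: "AE w in M. F w = G w"
    using gauss_poly_orthonormal_version[OF S(2) C(1,4)] by blast
  note [measurable] = all_moments_measurable[OF gauss_poly_all_moments[OF assms]]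
    all_moments_measurable[OF gauss_poly_all_moments[OF G]]
  have "expectation (\<lambda>w. F w ^ k) = expectation (\<lambda>w. G w ^ k)" for k
    using eq by (intro integral_cong_AE) (auto elim: eventually_mono)
  then show ?thesis using fourth_moment_orthonormal[OF C(1,2) _ order_refl G] C(3) by simp
qed

text \<open>The square of a polynomial of degree \<open>n\<close> has degree \<open>2 n\<close>, so the bound for the fourth moment can be iterated.\<close>
theorem dyadic_moments:
  "\<exists>C>0. \<forall>F. gauss_poly W UNIV n F \<longrightarrow>
     expectation (\<lambda>w. F w ^ (2 ^ Suc k)) \<le> C * (expectation (\<lambda>w. (F w)\<^sup>2)) ^ (2 ^ k)"
proof (induction k arbitrary: n)
  case 0
  show ?case by (rule exI[of _ 1]) simp
next
  case (Suc k)
  obtain C where C: "C > 0"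
    "\<And>F. gauss_poly W UNIV (2 * n) F \<Longrightarrow>
     expectation (\<lambda>w. F w ^ (2 ^ Suc k)) \<le> C * (expectation (\<lambda>w. (F w)\<^sup>2)) ^ (2 ^ k)"
    using Suc.IH by blast
  let ?K = "hyper_const n ^ (2 * n)"
  have K: "0 < ?K"
    by (auto simp: hyper_const_def intro!: zero_less_power add_pos_nonneg mult_nonneg_nonneg sum_nonneg)
  show ?case
  proof (intro exI[of _ "C * ?K ^ (2 ^ k)"] conjI allI impI)
    show "0 < C * ?K ^ (2 ^ k)" using C K by simp
    fix F assume F: "gauss_poly W UNIV n F"
    have "expectation (\<lambda>w. F w ^ (2 ^ Suc (Suc k))) = expectation (\<lambda>w. ((F w)\<^sup>2) ^ (2 ^ Suc k))"
      by (simp add: power_mult[symmetric])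
    also have "\<dots> \<le> C * (expectation (\<lambda>w. ((F w)\<^sup>2)\<^sup>2)) ^ (2 ^ k)"
      by (rule C(2)[OF gauss_poly_square[OF F]])
    also have "\<dots> \<le> C * (?K * (expectation (\<lambda>w. (F w)\<^sup>2))\<^sup>2) ^ (2 ^ k)"
      using C(1) fourth_moment[OF F] by (intro mult_left_mono power_mono) (auto simp: power_mult[symmetric])
    also have "\<dots> = C * ?K ^ (2 ^ k) * (expectation (\<lambda>w. (F w)\<^sup>2)) ^ (2 ^ Suc k)"
      by (simp add: power_mult_distrib power_mult[symmetric] mult.assoc)
    finally show "expectation (\<lambda>w. F w ^ (2 ^ Suc (Suc k))) \<le> C * ?K ^ (2 ^ k) * (expectation (\<lambda>w. (F w)\<^sup>2)) ^ (2 ^ Suc k)" .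
  qed
qed

text \<open>
  The \<open>L\<^sup>2\<close> closure of the polynomials of degree at most \<open>n\<close>: it contains the sums of the first chaoses, and the
  bounds for the moments of polynomials persist in it.
\<close>
definition chaos_closure :: "nat \<Rightarrow> ('w \<Rightarrow> real) set" where
  "chaos_closure n = {F \<in> sq_integrable M.
     \<forall>e>0. \<exists>P. gauss_poly W UNIV n P \<and> expectation (\<lambda>w. (F w - P w)\<^sup>2) < e}"

lemma sq_integrable_add:
  assumes "f \<in> sq_integrable M" "g \<in> sq_integrable M"
  shows "(\<lambda>w. f w + g w) \<in> sq_integrable M"
proof -
  have [measurable]: "f \<in> borel_measurable M" "g \<in> borel_measurable M" using assms by (auto simp: sq_integrable_def)
  have "integrable M (\<lambda>w. (f w + g w)\<^sup>2)"
  proof (rule Bochner_Integration.integrable_bound)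
    show "integrable M (\<lambda>w. 2 * (f w)\<^sup>2 + 2 * (g w)\<^sup>2)" using assms by (auto simp: sq_integrable_def)
    show "AE w in M. norm ((f w + g w)\<^sup>2) \<le> norm (2 * (f w)\<^sup>2 + 2 * (g w)\<^sup>2)"
    proof (intro AE_I2)
      fix w show "norm ((f w + g w)\<^sup>2) \<le> norm (2 * (f w)\<^sup>2 + 2 * (g w)\<^sup>2)"
      proof -
        have "(f w + g w)\<^sup>2 \<le> 2 * (f w)\<^sup>2 + 2 * (g w)\<^sup>2"
          using sum_squares_bound[of "f w" "g w"] by (simp add: power2_sum)
        then show ?thesis by simp
      qed
    qed
  qed measurable
  then show ?thesis by (simp add: sq_integrable_def)
qed

lemma sq_integrable_cmult: "f \<in> sq_integrable M \<Longrightarrow> (\<lambda>w. c * f w) \<in> sq_integrable M"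
  by (auto simp: sq_integrable_def power_mult_distrib intro: borel_measurable_times)

lemma sq_integrable_diff:
  "f \<in> sq_integrable M \<Longrightarrow> g \<in> sq_integrable M \<Longrightarrow> (\<lambda>w. f w - g w) \<in> sq_integrable M"
  using sq_integrable_add[of f "\<lambda>w. - 1 * g w"] sq_integrable_cmult[of g "- 1"] by simp

lemma gauss_poly_sq_integrable: "gauss_poly W B n P \<Longrightarrow> P \<in> sq_integrable M"
  using gauss_poly_all_moments[of B n P]
  by (auto simp: sq_integrable_def intro!: all_moments_integrable all_moments_measurable)

lemma chaos_closure_add:
  assumes f: "f \<in> chaos_closure n" and g: "g \<in> chaos_closure n"
  shows "(\<lambda>w. f w + g w) \<in> chaos_closure n"
proof -
  have "\<exists>P. gauss_poly W UNIV n P \<and> expectation (\<lambda>w. (f w + g w - P w)\<^sup>2) < e" if e: "0 < e" for e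
  proof -
    obtain P where P: "gauss_poly W UNIV n P" "expectation (\<lambda>w. (f w - P w)\<^sup>2) < e / 4"
      using f e unfolding chaos_closure_def by (force dest: spec[of _ "e / 4"])
    obtain Q where Q: "gauss_poly W UNIV n Q" "expectation (\<lambda>w. (g w - Q w)\<^sup>2) < e / 4"
      using g e unfolding chaos_closure_def by (force dest: spec[of _ "e / 4"])
    have fP: "(\<lambda>w. f w - P w) \<in> sq_integrable M" and gQ: "(\<lambda>w. g w - Q w) \<in> sq_integrable M"
      using f g by (auto simp: chaos_closure_def intro!: sq_integrable_diff gauss_poly_sq_integrable[OF P(1)] gauss_poly_sq_integrable[OF Q(1)])
    have "expectation (\<lambda>w. (f w + g w - (P w + Q w))\<^sup>2)
        \<le> expectation (\<lambda>w. 2 * (f w - P w)\<^sup>2 + 2 * (g w - Q w)\<^sup>2)"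
    proof (rule integral_mono)
      have "(\<lambda>w. f w + g w - (P w + Q w)) \<in> sq_integrable M"
        using sq_integrable_add[OF fP gQ] by (simp add: algebra_simps)
      then show "integrable M (\<lambda>w. (f w + g w - (P w + Q w))\<^sup>2)" by (simp add: sq_integrable_def)
      show "integrable M (\<lambda>w. 2 * (f w - P w)\<^sup>2 + 2 * (g w - Q w)\<^sup>2)"
        using fP gQ by (auto simp: sq_integrable_def)
      fix w
      show "(f w + g w - (P w + Q w))\<^sup>2 \<le> 2 * (f w - P w)\<^sup>2 + 2 * (g w - Q w)\<^sup>2"
        using sum_squares_bound[of "f w - P w" "g w - Q w"] power2_sum[of "f w - P w" "g w - Q w"]
        by (simp add: algebra_simps)
    qed
    also have "\<dots> < e" using P Q fP gQ by (simp add: sq_integrable_def)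
    finally show ?thesis using gauss_poly.add[OF P(1) Q(1)] by blast
  qed
  then show ?thesis using f g by (auto simp: chaos_closure_def sq_integrable_add)
qed

lemma chaos_closure_cmult:
  assumes f: "f \<in> chaos_closure n"
  shows "(\<lambda>w. c * f w) \<in> chaos_closure n"
proof -
  have "\<exists>P. gauss_poly W UNIV n P \<and> expectation (\<lambda>w. (c * f w - P w)\<^sup>2) < e" if e: "0 < e" for e
  proof -
    have pos: "0 < c\<^sup>2 + 1" by (simp add: add_nonneg_pos)
    with e have "0 < e / (c\<^sup>2 + 1)" by simp
    then obtain P where P: "gauss_poly W UNIV n P" "expectation (\<lambda>w. (f w - P w)\<^sup>2) < e / (c\<^sup>2 + 1)"
      using f unfolding chaos_closure_def by blast
    have "expectation (\<lambda>w. (c * f w - c * P w)\<^sup>2) = c\<^sup>2 * expectation (\<lambda>w. (f w - P w)\<^sup>2)"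
      by (simp add: right_diff_distrib[symmetric] power_mult_distrib)
    also have "\<dots> \<le> (c\<^sup>2 + 1) * expectation (\<lambda>w. (f w - P w)\<^sup>2)"
      by (intro mult_right_mono) auto
    also have "\<dots> < e" using P(2) by (subst (asm) pos_less_divide_eq[OF pos]) (simp only: mult.commute)
    finally show ?thesis using gauss_poly_cmult[OF P(1)] by blast
  qed
  then show ?thesis using f by (auto simp: chaos_closure_def sq_integrable_cmult)
qed

lemma gauss_poly_chaos_closure: "gauss_poly W UNIV n P \<Longrightarrow> P \<in> chaos_closure n"
  unfolding chaos_closure_def
  by (auto intro!: gauss_poly_sq_integrable exI[of _ P])

lemma chaos_closure_sum: "(\<And>i. i \<in> I \<Longrightarrow> f i \<in> chaos_closure n) \<Longrightarrow> (\<lambda>w. \<Sum>i\<in>I. f i w) \<in> chaos_closure n"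
  by (induction I rule: infinite_finite_induct)
     (auto intro: chaos_closure_add gauss_poly_chaos_closure gauss_poly.const)

lemma wiener_chaos_subset:
  assumes "i \<le> n"
  shows "wiener_chaos M W i \<subseteq> chaos_closure n"
proof
  fix F assume F: "F \<in> wiener_chaos M W i"
  let ?G = "{\<lambda>w. hermite i (W v w) |v. norm v = 1}"
  have "\<exists>P. gauss_poly W UNIV n P \<and> expectation (\<lambda>w. (F w - P w)\<^sup>2) < e" if e: "0 < e" for e
  proof -
    obtain P where P: "P \<in> fun_span ?G" "L2_dist M F P < sqrt e"
      using F e by (force simp: wiener_chaos_def L2_closed_span_def dest: spec[of _ "sqrt e"])
    have gp: "gauss_poly W UNIV n g" if "g \<in> ?G" for g
    proof -
      obtain v where g: "g = (\<lambda>w. (1 / fact i) * poly (hermite_poly i) (W v w))"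
        using \<open>g \<in> ?G\<close> by (auto simp: hermite_eq_hermite_poly)
      show ?thesis
        unfolding g using degree_hermite_poly[of i] assms by (intro gauss_poly_cmult gauss_poly_poly) auto
    qed
    obtain A c where A: "A \<subseteq> ?G" and P_eq: "P = (\<lambda>w. \<Sum>g\<in>A. c g * g w)"
      using P(1) unfolding fun_span_def by blast
    have "gauss_poly W UNIV n P"
      unfolding P_eq using A by (intro gauss_poly_sum gauss_poly_cmult gp) blast
    then show ?thesis using P(2) by (auto simp: L2_dist_def)
  qed
  moreover have "F \<in> sq_integrable M" using F by (simp add: wiener_chaos_def L2_closed_span_def)
  ultimately show "F \<in> chaos_closure n" by (simp add: chaos_closure_def)
qed

lemma wiener_chaos_sum_subset: "wiener_chaos_sum M W n \<subseteq> chaos_closure n"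
  using wiener_chaos_subset by (auto simp: wiener_chaos_sum_def intro!: chaos_closure_sum)

text \<open>
  Approximants at distance \<open>1 / (j + 1)\<close> converge in \<open>L\<^sup>1\<close>, so a subsequence converges almost surely; the bound on the
  second moments, with a limit equal to that of \<open>F\<close>, is what Fatou's lemma needs.
\<close>
lemma chaos_closure_approximation:
  assumes F: "F \<in> chaos_closure n"
  obtains P where "\<And>j. gauss_poly W UNIV n (P j)" "AE w in M. (\<lambda>j. P j w) \<longlonglongrightarrow> F w"
    "\<And>j::nat. expectation (\<lambda>w. (P j w)\<^sup>2) \<le> (1 + 1 / Suc j) * expectation (\<lambda>w. (F w)\<^sup>2) + 2 / Suc j"
proof -
  let ?s = "\<lambda>j::nat. 1 / real (Suc j)"
  have "\<exists>Q. gauss_poly W UNIV n Q \<and> expectation (\<lambda>w. (F w - Q w)\<^sup>2) < (?s j)\<^sup>2" for j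
  proof -
    have "0 < (?s j)\<^sup>2" by simp
    then show ?thesis using F unfolding chaos_closure_def by blast
  qed
  then obtain Q where Q: "\<And>j. gauss_poly W UNIV n (Q j)" "\<And>j. expectation (\<lambda>w. (F w - Q j w)\<^sup>2) < (?s j)\<^sup>2"
    by metis
  have Fsq: "F \<in> sq_integrable M" using F by (simp add: chaos_closure_def)
  note Qsq = gauss_poly_sq_integrable[OF Q(1)]
  have D: "(\<lambda>w. F w - Q j w) \<in> sq_integrable M" for j using sq_integrable_diff[OF Fsq Qsq] .
  have DI: "integrable M (\<lambda>w. (F w - Q j w)\<^sup>2)" for j using D by (simp add: sq_integrable_def)
  have abs_le: "2 * \<bar>d\<bar> \<le> s + d\<^sup>2 / s" if "0 < s" for s d :: real
  proof -
    have "2 * \<bar>d\<bar> * s \<le> s\<^sup>2 + d\<^sup>2" using sum_squares_bound[of "\<bar>d\<bar>" s] by simp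
    also have "\<dots> = (s + d\<^sup>2 / s) * s" using that by (simp add: field_simps power2_eq_square)
    finally show ?thesis using that by simp
  qed
  have absI: "integrable M (\<lambda>w. Q j w - F w)" for j
  proof (rule Bochner_Integration.integrable_bound)
    show "integrable M (\<lambda>w. 1 + (F w - Q j w)\<^sup>2)" using DI by simp
    show "(\<lambda>w. Q j w - F w) \<in> borel_measurable M" using Fsq Qsq by (auto simp: sq_integrable_def intro: borel_measurable_diff)
    show "AE w in M. norm (Q j w - F w) \<le> norm (1 + (F w - Q j w)\<^sup>2)"
    proof (intro AE_I2)
      fix w
      show "norm (Q j w - F w) \<le> norm (1 + (F w - Q j w)\<^sup>2)"
      proof -
        have "2 * \<bar>F w - Q j w\<bar> \<le> 1 + (F w - Q j w)\<^sup>2"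
          using abs_le[OF zero_less_one, of "F w - Q j w"] by simp
        moreover have "\<bar>F w - Q j w\<bar> \<le> 2 * \<bar>F w - Q j w\<bar>" by simp
        ultimately have "\<bar>F w - Q j w\<bar> \<le> 1 + (F w - Q j w)\<^sup>2" by (rule order_trans[rotated])
        then show ?thesis by (simp add: abs_minus_commute)
      qed
    qed
  qed
  have "(\<lambda>j. expectation (\<lambda>w. norm (Q j w - F w))) \<longlonglongrightarrow> 0"
  proof (rule tendsto_sandwich[OF _ _ tendsto_const LIMSEQ_inverse_real_of_nat])
    show "\<forall>\<^sub>F j in sequentially. expectation (\<lambda>w. norm (Q j w - F w)) \<le> inverse (real (Suc j))"
    proof (intro always_eventually allI)
      fix j
      have "expectation (\<lambda>w. norm (Q j w - F w)) \<le> expectation (\<lambda>w. (?s j + (F w - Q j w)\<^sup>2 / ?s j) / 2)"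
      proof (rule integral_mono)
        fix w
        have "0 < ?s j" by simp
        from abs_le[OF this, of "F w - Q j w"]
        show "norm (Q j w - F w) \<le> (?s j + (F w - Q j w)\<^sup>2 / ?s j) / 2"
          unfolding real_norm_def abs_minus_commute[of "Q j w"] by simp
      qed (use absI DI in \<open>auto intro!: integrable_divide Bochner_Integration.integrable_add integrable_mult_left\<close>)
      also have "\<dots> = (?s j + expectation (\<lambda>w. (F w - Q j w)\<^sup>2) / ?s j) / 2"
        using DI by (simp add: prob_space)
      also have "\<dots> \<le> (?s j + (?s j)\<^sup>2 / ?s j) / 2"
        using Q(2)[of j] by (intro divide_right_mono add_left_mono) auto
      also have "\<dots> = inverse (real (Suc j))"
        by (simp add: power2_eq_square inverse_eq_divide del: of_nat_Suc)
      finally show "expectation (\<lambda>w. norm (Q j w - F w)) \<le> inverse (real (Suc j))" .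
    qed
  qed simp
  from tendsto_L1_AE_subseq[OF absI this]
  obtain r :: "nat \<Rightarrow> nat" where r: "strict_mono r" "AE w in M. (\<lambda>j. Q (r j) w - F w) \<longlonglongrightarrow> 0"
    by blast
  have bound: "expectation (\<lambda>w. (Q j w)\<^sup>2) \<le> (1 + ?s j) * expectation (\<lambda>w. (F w)\<^sup>2) + 2 * ?s j" for j
  proof -
    have s: "0 < ?s j" "?s j \<le> 1" by auto
    have FI: "integrable M (\<lambda>w. (F w)\<^sup>2)" "integrable M (\<lambda>w. (Q j w)\<^sup>2)"
      using Fsq Qsq by (auto simp: sq_integrable_def)
    have "expectation (\<lambda>w. (Q j w)\<^sup>2) \<le> expectation (\<lambda>w. (1 + ?s j) * (F w)\<^sup>2 + (1 + 1 / ?s j) * (F w - Q j w)\<^sup>2)"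
    proof (rule integral_mono)
      show "integrable M (\<lambda>w. (1 + ?s j) * (F w)\<^sup>2 + (1 + 1 / ?s j) * (F w - Q j w)\<^sup>2)"
        by (intro Bochner_Integration.integrable_add integrable_mult_right FI DI)
      fix w
      have "q\<^sup>2 \<le> (1 + t) * f\<^sup>2 + (1 + 1 / t) * (f - q)\<^sup>2" if "0 < t" for t f q :: real
      proof -
        have "0 \<le> (t * f + (f - q))\<^sup>2 / t" using that by simp
        also have "\<dots> = t * f\<^sup>2 + 2 * f * (f - q) + (f - q)\<^sup>2 / t"
          using that by (simp add: field_simps power2_eq_square)
        finally have "0 \<le> t * f\<^sup>2 + 2 * f * (f - q) + (f - q)\<^sup>2 / t" .
        moreover have "q\<^sup>2 = f\<^sup>2 - 2 * f * (f - q) + (f - q)\<^sup>2"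
          by (simp add: power2_eq_square algebra_simps)
        moreover have "(1 + 1 / t) * (f - q)\<^sup>2 = (f - q)\<^sup>2 + (f - q)\<^sup>2 / t" "(1 + t) * f\<^sup>2 = f\<^sup>2 + t * f\<^sup>2"
          by (simp_all add: distrib_right)
        ultimately show ?thesis by linarith
      qed
      then show "(Q j w)\<^sup>2 \<le> (1 + ?s j) * (F w)\<^sup>2 + (1 + 1 / ?s j) * (F w - Q j w)\<^sup>2" using s(1) .
    qed fact
    also have "\<dots> = (1 + ?s j) * expectation (\<lambda>w. (F w)\<^sup>2) + (1 + 1 / ?s j) * expectation (\<lambda>w. (F w - Q j w)\<^sup>2)"
      using FI DI by (simp del: of_nat_Suc)
    also have "(1 + 1 / ?s j) * expectation (\<lambda>w. (F w - Q j w)\<^sup>2) \<le> (1 + 1 / ?s j) * (?s j)\<^sup>2"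
      using Q(2)[of j] by (intro mult_left_mono) auto
    also have "\<dots> = (?s j)\<^sup>2 + ?s j"
    proof -
      have "(1 + 1 / t) * t\<^sup>2 = t\<^sup>2 + t" if "0 < t" for t :: real
        using that by (simp add: field_simps power2_eq_square)
      from this[OF s(1)] show ?thesis .
    qed
    also have "(?s j)\<^sup>2 \<le> ?s j" using s mult_left_mono[of "?s j" 1 "?s j"] by (simp add: power2_eq_square)
    finally show ?thesis by simp
  qed
  show ?thesis
  proof (rule that[of "\<lambda>j. Q (r j)"])
    show "gauss_poly W UNIV n (Q (r j))" for j by (rule Q(1))
    show "AE w in M. (\<lambda>j. Q (r j) w) \<longlonglongrightarrow> F w"
      using r(2) by eventually_elim (simp add: LIM_zero_iff)
    fix j
    have "?s (r j) \<le> ?s j" using seq_suble[OF r(1), of j] by (intro divide_left_mono) auto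
    then have "(1 + ?s (r j)) * expectation (\<lambda>w. (F w)\<^sup>2) + 2 * ?s (r j) \<le> (1 + ?s j) * expectation (\<lambda>w. (F w)\<^sup>2) + 2 * ?s j"
      by (intro add_mono mult_right_mono) auto
    with bound[of "r j"]
    show "expectation (\<lambda>w. (Q (r j) w)\<^sup>2) \<le> (1 + 1 / Suc j) * expectation (\<lambda>w. (F w)\<^sup>2) + 2 / Suc j"
      by simp
  qed
qed

theorem chaos_closure_moments:
  "\<exists>C>0. \<forall>F\<in>chaos_closure n.
     (\<integral>\<^sup>+w. ennreal (F w ^ (2 ^ Suc k)) \<partial>M) \<le> ennreal (C * (expectation (\<lambda>w. (F w)\<^sup>2)) ^ (2 ^ k))"
proof -
  obtain C where C: "C > 0" "\<And>F. gauss_poly W UNIV n F \<Longrightarrow>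
     expectation (\<lambda>w. F w ^ (2 ^ Suc k)) \<le> C * (expectation (\<lambda>w. (F w)\<^sup>2)) ^ (2 ^ k)"
    using dyadic_moments by blast
  show ?thesis
  proof (intro exI[of _ C] conjI ballI C(1))
    fix F assume F: "F \<in> chaos_closure n"
    then have [measurable]: "F \<in> borel_measurable M" by (simp add: chaos_closure_def sq_integrable_def)
    obtain P where P: "\<And>j. gauss_poly W UNIV n (P j)" "AE w in M. (\<lambda>j. P j w) \<longlonglongrightarrow> F w"
      "\<And>j::nat. expectation (\<lambda>w. (P j w)\<^sup>2) \<le> (1 + 1 / Suc j) * expectation (\<lambda>w. (F w)\<^sup>2) + 2 / Suc j"
      by (rule chaos_closure_approximation[OF F, rule_format]) (rule that)
    note Pm = gauss_poly_all_moments[OF P(1)]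
    have [measurable]: "P j \<in> borel_measurable M" for j using Pm by (rule all_moments_measurable)
    let ?m = "2 ^ Suc k"
    let ?b = "\<lambda>j::nat. C * ((1 + 1 / real (Suc j)) * expectation (\<lambda>w. (F w)\<^sup>2) + 2 / real (Suc j)) ^ (2 ^ k)"
    have "(\<integral>\<^sup>+w. ennreal (F w ^ ?m) \<partial>M) = (\<integral>\<^sup>+w. liminf (\<lambda>j. ennreal (P j w ^ ?m)) \<partial>M)"
    proof (intro nn_integral_cong_AE, use P(2) in eventually_elim)
      fix w assume "(\<lambda>j. P j w) \<longlonglongrightarrow> F w"
      then have "(\<lambda>j. ennreal (P j w ^ ?m)) \<longlonglongrightarrow> ennreal (F w ^ ?m)"
        by (intro tendsto_ennrealI tendsto_power)
      from lim_imp_Liminf[OF _ this] show "ennreal (F w ^ ?m) = liminf (\<lambda>j. ennreal (P j w ^ ?m))" by simp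
    qed
    also have "\<dots> \<le> liminf (\<lambda>j. \<integral>\<^sup>+w. ennreal (P j w ^ ?m) \<partial>M)"
      by (rule nn_integral_liminf) measurable
    also have "\<dots> \<le> liminf (\<lambda>j. ennreal (?b j))"
    proof (intro Liminf_mono always_eventually allI)
      fix j
      have "(\<integral>\<^sup>+w. ennreal (P j w ^ ?m) \<partial>M) = ennreal (expectation (\<lambda>w. P j w ^ ?m))"
        using Pm by (intro nn_integral_eq_integral all_moments_integrable all_moments_power) auto
      also have "\<dots> \<le> ennreal (?b j)"
        using C(2)[OF P(1)[of j]] C(1) P(3)[of j]
        by (intro ennreal_leI order_trans[OF C(2)[OF P(1)[of j]]] mult_left_mono power_mono) auto
      finally show "(\<integral>\<^sup>+w. ennreal (P j w ^ ?m) \<partial>M) \<le> ennreal (?b j)" .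
    qed
    also have "\<dots> = ennreal (C * (expectation (\<lambda>w. (F w)\<^sup>2)) ^ (2 ^ k))"
    proof -
      have inv: "(\<lambda>j. 1 / real (Suc j)) \<longlonglongrightarrow> 0"
        using LIMSEQ_inverse_real_of_nat by (simp add: inverse_eq_divide)
      have "?b \<longlonglongrightarrow> C * ((1 + 0) * expectation (\<lambda>w. (F w)\<^sup>2) + 0) ^ (2 ^ k)"
        using inv tendsto_mult[OF tendsto_const[of 2] inv] by (intro tendsto_intros) auto
      from lim_imp_Liminf[OF _ tendsto_ennrealI[OF this]] show ?thesis by simp
    qed
    finally show "(\<integral>\<^sup>+w. ennreal (F w ^ ?m) \<partial>M) \<le> ennreal (C * (expectation (\<lambda>w. (F w)\<^sup>2)) ^ (2 ^ k))" .
  qed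
qed

text \<open>
  A variable whose fourth moment is controlled by the square of its second cannot have its second moment
  concentrated on large values: with the threshold \<open>t\<close> below, large values account for at most half of it.
\<close>
theorem chaos_closure_L1_bound:
  "\<exists>c>0. \<forall>F\<in>chaos_closure n.
     ennreal (c * sqrt (expectation (\<lambda>w. (F w)\<^sup>2))) \<le> (\<integral>\<^sup>+w. ennreal \<bar>F w\<bar> \<partial>M)"
proof -
  obtain C where C: "C > 0" "\<And>F. F \<in> chaos_closure n \<Longrightarrow>
     (\<integral>\<^sup>+w. ennreal (F w ^ 4) \<partial>M) \<le> ennreal (C * (expectation (\<lambda>w. (F w)\<^sup>2))\<^sup>2)"
    using chaos_closure_moments[of n 1] by auto
  show ?thesis
  proof (intro exI[of _ "1 / (2 * sqrt (2 * C))"] conjI ballI)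
    show "0 < 1 / (2 * sqrt (2 * C))" using C(1) by simp
    fix F assume F: "F \<in> chaos_closure n"
    then have [measurable]: "F \<in> borel_measurable M" and I2: "integrable M (\<lambda>w. (F w)\<^sup>2)"
      by (auto simp: chaos_closure_def sq_integrable_def)
    define v where "v = expectation (\<lambda>w. (F w)\<^sup>2)"
    show "ennreal (1 / (2 * sqrt (2 * C)) * sqrt v) \<le> (\<integral>\<^sup>+w. ennreal \<bar>F w\<bar> \<partial>M)"
    proof (cases "v = 0")
      case False
      have v: "0 < v" using False by (simp add: v_def less_le)
      define t where "t = sqrt (2 * C * v)"
      have t: "0 < t" "t\<^sup>2 = 2 * C * v" using C(1) v by (auto simp: t_def)
      have "ennreal v = (\<integral>\<^sup>+w. ennreal ((F w)\<^sup>2) \<partial>M)"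
        unfolding v_def using I2 by (intro nn_integral_eq_integral[symmetric]) auto
      also have "\<dots> \<le> (\<integral>\<^sup>+w. ennreal t * ennreal \<bar>F w\<bar> + ennreal (1 / t\<^sup>2) * ennreal (F w ^ 4) \<partial>M)"
      proof (intro nn_integral_mono)
        fix w
        have "(F w)\<^sup>2 \<le> t * \<bar>F w\<bar> + (1 / t\<^sup>2) * F w ^ 4"
        proof (cases "\<bar>F w\<bar> \<le> t")
          case True
          have "(F w)\<^sup>2 = \<bar>F w\<bar> * \<bar>F w\<bar>" by (simp add: power2_eq_square)
          also have "\<dots> \<le> t * \<bar>F w\<bar>" using True by (intro mult_right_mono) auto
          finally have "(F w)\<^sup>2 \<le> t * \<bar>F w\<bar>" .
          moreover have "0 \<le> (1 / t\<^sup>2) * F w ^ 4" by simp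
          ultimately show ?thesis by linarith
        next
          case False
          then have "t\<^sup>2 \<le> (F w)\<^sup>2" using t(1) by (metis abs_le_square_iff abs_of_pos less_imp_le not_le)
          then have "(F w)\<^sup>2 * t\<^sup>2 \<le> (F w)\<^sup>2 * (F w)\<^sup>2" by (intro mult_left_mono) auto
          then have "(F w)\<^sup>2 \<le> (1 / t\<^sup>2) * F w ^ 4" using t(1) by (simp add: field_simps power4_eq_xxxx power2_eq_square)
          moreover have "0 \<le> t * \<bar>F w\<bar>" using t(1) by simp
          ultimately show ?thesis by linarith
        qed
        then show "ennreal ((F w)\<^sup>2) \<le> ennreal t * ennreal \<bar>F w\<bar> + ennreal (1 / t\<^sup>2) * ennreal (F w ^ 4)"
          using t(1) by (simp add: ennreal_mult'[symmetric] ennreal_plus[symmetric] del: ennreal_plus)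
      qed
      also have "\<dots> = ennreal t * (\<integral>\<^sup>+w. ennreal \<bar>F w\<bar> \<partial>M) + ennreal (1 / t\<^sup>2) * (\<integral>\<^sup>+w. ennreal (F w ^ 4) \<partial>M)"
        by (subst nn_integral_add) (auto simp: nn_integral_cmult)
      also have "\<dots> \<le> ennreal t * (\<integral>\<^sup>+w. ennreal \<bar>F w\<bar> \<partial>M) + ennreal (1 / t\<^sup>2) * ennreal (C * v\<^sup>2)"
        using C(2)[OF F] by (intro add_left_mono mult_left_mono) (auto simp: v_def)
      also have "ennreal (1 / t\<^sup>2) * ennreal (C * v\<^sup>2) = ennreal (v / 2)"
        unfolding t(2) using v C(1) by (subst ennreal_mult'[symmetric]) (auto simp: field_simps power2_eq_square)
      finally have *: "ennreal v \<le> ennreal t * (\<integral>\<^sup>+w. ennreal \<bar>F w\<bar> \<partial>M) + ennreal (v / 2)" .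
      show ?thesis
      proof (cases "\<integral>\<^sup>+w. ennreal \<bar>F w\<bar> \<partial>M")
        case (real i)
        then have "v \<le> t * i + v / 2"
          using * t(1) v by (simp add: ennreal_mult'[symmetric] ennreal_plus[symmetric] del: ennreal_plus)
        then have "v \<le> 2 * t * i" by simp
        moreover have "t = sqrt (2 * C) * sqrt v" "v = sqrt v * sqrt v" using v C(1) by (auto simp: t_def real_sqrt_mult)
        ultimately have "sqrt v * sqrt v \<le> (2 * sqrt (2 * C) * i) * sqrt v" by (metis mult.assoc mult.commute)
        then have "sqrt v \<le> 2 * sqrt (2 * C) * i" by (rule mult_right_le_imp_le) (use v in simp)
        then have "1 / (2 * sqrt (2 * C)) * sqrt v \<le> i" using C(1) by (simp add: field_simps)
        then show ?thesis using real by (simp add: ennreal_leI)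
      qed simp
    qed simp
  qed
qed

end

section \<open>Random series in a mixed-norm space\<close>

context mixed
begin

abbreviation "MF \<equiv> mixed_fun p1 p2 M1 M2"
abbreviation "MN \<equiv> mixed_norm p1 p2 M1 M2"
abbreviation "MC \<equiv> mixed_class p1 p2 M1 M2"

lemma mixed_fun_iff: "f \<in> MF \<longleftrightarrow> f \<in> borel_measurable \<MM> \<and> EN (\<lambda>z. ennreal \<bar>f z\<bar>) < \<infinity>"
  unfolding EN_less_top_iff by (simp add: mixed_fun_def mixed_integral_eq_emixed)

lemma mixed_fun_measurable [measurable_dest]: "f \<in> MF \<Longrightarrow> f \<in> borel_measurable \<MM>"
  by (simp add: mixed_fun_iff)

lemma MN_eq_EN: "f \<in> MF \<Longrightarrow> ennreal (MN f) = EN (\<lambda>z. ennreal \<bar>f z\<bar>)"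
  by (rule mixed_norm_eq_enorm) (simp add: mixed_fun_def)

lemma mixed_fun_bound:
  assumes "g \<in> MF" and [measurable]: "f \<in> borel_measurable \<MM>"
    and le: "AE z in \<MM>. \<bar>f z\<bar> \<le> \<bar>g z\<bar>"
  shows "f \<in> MF" "MN f \<le> MN g"
proof -
  have mono: "EN (\<lambda>z. ennreal \<bar>f z\<bar>) \<le> EN (\<lambda>z. ennreal \<bar>g z\<bar>)"
  proof (rule EN_mono)
    show "AE z in \<MM>. ennreal \<bar>f z\<bar> \<le> ennreal \<bar>g z\<bar>"
      using le by eventually_elim (rule ennreal_leI)
  qed
  also have "\<dots> < \<infinity>" using assms(1) by (simp only: mixed_fun_iff)
  finally show f: "f \<in> MF" using assms(2) by (simp only: mixed_fun_iff)
  from mono have "ennreal (MN f) \<le> ennreal (MN g)"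
    by (simp only: MN_eq_EN[OF f] MN_eq_EN[OF assms(1)])
  then show "MN f \<le> MN g" by simp
qed

lemma mixed_fun_cong_AE:
  assumes f: "f \<in> MF" and [measurable]: "g \<in> borel_measurable \<MM>" and eq: "AE z in \<MM>. f z = g z"
  shows "g \<in> MF" "MN g = MN f"
proof -
  have le: "AE z in \<MM>. \<bar>g z\<bar> \<le> \<bar>f z\<bar>" "AE z in \<MM>. \<bar>f z\<bar> \<le> \<bar>g z\<bar>"
    using eq by (eventually_elim, simp)+
  show g: "g \<in> MF" by (rule mixed_fun_bound(1)[OF f _ le(1)]) measurable
  show "MN g = MN f"
    using mixed_fun_bound(2)[OF f _ le(1)] mixed_fun_bound(2)[OF g _ le(2)] f by (auto intro: antisym)
qed

lemma mixed_fun_add: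
  assumes f: "f \<in> MF" and g: "g \<in> MF"
  shows "(\<lambda>z. f z + g z) \<in> MF" "MN (\<lambda>z. f z + g z) \<le> MN f + MN g"
proof -
  have [measurable]: "f \<in> borel_measurable \<MM>" "g \<in> borel_measurable \<MM>" using f g by auto
  have "EN (\<lambda>z. ennreal \<bar>f z + g z\<bar>) \<le> EN (\<lambda>z. ennreal \<bar>f z\<bar> + ennreal \<bar>g z\<bar>)"
    by (intro EN_mono AE_I2) (simp add: ennreal_plus[symmetric] del: ennreal_plus)
  also have "\<dots> \<le> EN (\<lambda>z. ennreal \<bar>f z\<bar>) + EN (\<lambda>z. ennreal \<bar>g z\<bar>)"
    by (rule EN_triangle) auto
  finally have le: "EN (\<lambda>z. ennreal \<bar>f z + g z\<bar>) \<le> ennreal (MN f + MN g)"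
    by (simp add: MN_eq_EN[OF f, symmetric] MN_eq_EN[OF g, symmetric] ennreal_plus)
  then have "EN (\<lambda>z. ennreal \<bar>f z + g z\<bar>) < \<infinity>" by (rule order_le_less_trans) simp
  then show fg: "(\<lambda>z. f z + g z) \<in> MF" by (simp add: mixed_fun_iff)
  show "MN (\<lambda>z. f z + g z) \<le> MN f + MN g"
    using le unfolding MN_eq_EN[OF fg, symmetric] by (subst (asm) ennreal_le_iff) auto
qed

lemma mixed_fun_cmult:
  assumes f: "f \<in> MF"
  shows "(\<lambda>z. c * f z) \<in> MF" "MN (\<lambda>z. c * f z) = \<bar>c\<bar> * MN f"
proof -
  have [measurable]: "f \<in> borel_measurable \<MM>" using f by auto
  have eq: "EN (\<lambda>z. ennreal \<bar>c * f z\<bar>) = ennreal (\<bar>c\<bar> * MN f)"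
    using EN_cmult[of "\<lambda>z. ennreal \<bar>f z\<bar>" "ennreal \<bar>c\<bar>"]
    by (simp add: abs_mult ennreal_mult MN_eq_EN[OF f])
  then show cf: "(\<lambda>z. c * f z) \<in> MF" by (simp add: mixed_fun_iff)
  show "MN (\<lambda>z. c * f z) = \<bar>c\<bar> * MN f"
    using eq unfolding MN_eq_EN[OF cf, symmetric] by simp
qed

lemma mixed_fun_zero [simp]: "(\<lambda>z. 0) \<in> MF" "MN (\<lambda>z. 0) = 0"
proof -
  show z: "(\<lambda>z. 0) \<in> MF" by (simp add: mixed_fun_iff EN_zero)
  show "MN (\<lambda>z. 0) = 0" using MN_eq_EN[OF z] by (simp add: EN_zero)
qed

lemma mixed_fun_diff:
  assumes "f \<in> MF" "g \<in> MF"
  shows "(\<lambda>z. f z - g z) \<in> MF"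
  using mixed_fun_add(1)[OF assms(1) mixed_fun_cmult(1)[OF assms(2), of "- 1"]] by simp

lemma mixed_fun_sum: "(\<And>k. k \<in> K \<Longrightarrow> f k \<in> MF) \<Longrightarrow> (\<lambda>z. \<Sum>k\<in>K. f k z) \<in> MF"
  by (induction K rule: infinite_finite_induct) (auto intro: mixed_fun_add)

lemma mixed_fun_abs: "f \<in> MF \<Longrightarrow> (\<lambda>z. \<bar>f z\<bar>) \<in> MF"
  by (rule mixed_fun_bound[of f]) auto

lemma mixed_class_eq_iff:
  assumes f: "f \<in> MF" and g: "g \<in> MF"
  shows "MC f = MC g \<longleftrightarrow> (AE z in \<MM>. f z = g z)"
proof
  assume "MC f = MC g"
  moreover have "g \<in> MC g" using g by (simp add: mixed_class_def)
  ultimately have "g \<in> MC f" by (simp only:)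
  then show "AE z in \<MM>. f z = g z" by (simp add: mixed_class_def)
next
  assume eq: "AE z in \<MM>. f z = g z"
  have "(AE z in \<MM>. f z = h z) \<longleftrightarrow> (AE z in \<MM>. g z = h z)" for h
  proof
    assume "AE z in \<MM>. f z = h z"
    with eq show "AE z in \<MM>. g z = h z" by eventually_elim simp
  next
    assume "AE z in \<MM>. g z = h z"
    with eq show "AE z in \<MM>. f z = h z" by eventually_elim simp
  qed
  then show "MC f = MC g" by (simp add: mixed_class_def)
qed

lemma mixed_class_memD: "f' \<in> MC f \<Longrightarrow> f' \<in> MF \<and> (AE z in \<MM>. f z = f' z)"
  by (simp add: mixed_class_def)

lemma mixed_class_self: "f \<in> MF \<Longrightarrow> f \<in> MC f"
  by (simp add: mixed_class_def)

abbreviation "MSP \<equiv> mixed_space p1 p2 M1 M2"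

lemma mixed_class_nonempty: "f \<in> MF \<Longrightarrow> MC f \<noteq> {}"
  using mixed_class_self by blast

lemma mixed_space_add:
  assumes f: "f \<in> MF" and g: "g \<in> MF"
  shows "vadd MSP (MC f) (MC g) = MC (\<lambda>z. f z + g z)"
proof -
  have eq: "MC (\<lambda>z. f' z + g' z) = MC (\<lambda>z. f z + g z)" if "f' \<in> MC f" "g' \<in> MC g" for f' g'
  proof -
    note f' = mixed_class_memD[OF that(1)] and g' = mixed_class_memD[OF that(2)]
    from f'[THEN conjunct2] g'[THEN conjunct2] have "AE z in \<MM>. f' z + g' z = f z + g z"
      by eventually_elim simp
    then show ?thesis
      using mixed_class_eq_iff[OF mixed_fun_add(1)[OF f'[THEN conjunct1] g'[THEN conjunct1]] mixed_fun_add(1)[OF f g]]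
      by (rule iffD2[rotated])
  qed
  have "vadd MSP (MC f) (MC g) = (\<Union>f'\<in>MC f. \<Union>g'\<in>MC g. MC (\<lambda>z. f' z + g' z))"
    by (simp add: mixed_space_def)
  also have "\<dots> = (\<Union>f'\<in>MC f. \<Union>g'\<in>MC g. MC (\<lambda>z. f z + g z))"
    by (intro SUP_cong refl eq)
  also have "\<dots> = MC (\<lambda>z. f z + g z)"
    by (simp only: UN_constant mixed_class_nonempty[OF f] mixed_class_nonempty[OF g] if_False)
  finally show ?thesis .
qed

lemma mixed_space_scale:
  assumes f: "f \<in> MF"
  shows "vscale MSP c (MC f) = MC (\<lambda>z. c * f z)"
proof -
  have eq: "MC (\<lambda>z. c * f' z) = MC (\<lambda>z. c * f z)" if "f' \<in> MC f" for f'
  proof -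
    note f' = mixed_class_memD[OF that(1)]
    from f'[THEN conjunct2] have "AE z in \<MM>. c * f' z = c * f z" by eventually_elim simp
    then show ?thesis
      using mixed_class_eq_iff[OF mixed_fun_cmult(1)[OF f'[THEN conjunct1]] mixed_fun_cmult(1)[OF f]]
      by (rule iffD2[rotated])
  qed
  have "vscale MSP c (MC f) = (\<Union>f'\<in>MC f. MC (\<lambda>z. c * f' z))"
    by (simp add: mixed_space_def)
  also have "\<dots> = (\<Union>f'\<in>MC f. MC (\<lambda>z. c * f z))"
    by (intro SUP_cong refl eq)
  also have "\<dots> = MC (\<lambda>z. c * f z)"
    by (simp only: UN_constant mixed_class_nonempty[OF f] if_False)
  finally show ?thesis .
qed

lemma mixed_space_norm:
  assumes f: "f \<in> MF"
  shows "vnorm MSP (MC f) = MN f"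
proof -
  have eq: "MN f' = MN f" if "f' \<in> MC f" for f'
    using mixed_class_memD[OF that] by (intro mixed_fun_cong_AE(2)[OF f] mixed_fun_measurable) simp_all
  have "MN ` MC f = (\<lambda>_. MN f) ` MC f" by (intro image_cong refl eq)
  also have "\<dots> = {MN f}" by (simp only: image_constant_conv mixed_class_nonempty[OF f] if_False)
  finally have "MN ` MC f = {MN f}" .
  then show ?thesis by (simp add: mixed_space_def)
qed

lemma mixed_space_carrier: "vcarrier MSP = MC ` MF"
  by (simp add: mixed_space_def)

text \<open>The Euclidean norm is dominated by the sum of the absolute values.\<close>
lemma square_function_mixed_fun:
  fixes \<phi> :: "nat \<Rightarrow> 'a \<times> 'b \<Rightarrow> real"
  assumes "\<And>k. k \<in> K \<Longrightarrow> \<phi> k \<in> MF"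
  shows "(\<lambda>z. sqrt (\<Sum>k\<in>K. (\<phi> k z)\<^sup>2)) \<in> MF"
proof (rule mixed_fun_bound)
  show "(\<lambda>z. \<Sum>k\<in>K. \<bar>\<phi> k z\<bar>) \<in> MF" by (intro mixed_fun_sum mixed_fun_abs assms)
  have [measurable]: "k \<in> K \<Longrightarrow> \<phi> k \<in> borel_measurable \<MM>" for k using assms by auto
  show "(\<lambda>z. sqrt (\<Sum>k\<in>K. (\<phi> k z)\<^sup>2)) \<in> borel_measurable \<MM>" by measurable
  show "AE z in \<MM>. \<bar>sqrt (\<Sum>k\<in>K. (\<phi> k z)\<^sup>2)\<bar> \<le> \<bar>\<Sum>k\<in>K. \<bar>\<phi> k z\<bar>\<bar>"
  proof (intro AE_I2)
    fix z
    show "\<bar>sqrt (\<Sum>k\<in>K. (\<phi> k z)\<^sup>2)\<bar> \<le> \<bar>\<Sum>k\<in>K. \<bar>\<phi> k z\<bar>\<bar>"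
      using L2_set_le_sum_abs[of "\<lambda>k. \<phi> k z" K] by (simp add: L2_set_def sum_nonneg)
  qed
qed

end

context isonormal
begin

lemma orthonormal_combination:
  assumes on: "L2_orthonormal M m e" and e: "\<And>k. k \<in> {1..m} \<Longrightarrow> e k \<in> chaos_closure n"
  shows "(\<lambda>w. \<Sum>k=1..m. e k w * c k) \<in> chaos_closure n"
    "expectation (\<lambda>w. (\<Sum>k=1..m. e k w * c k)\<^sup>2) = (\<Sum>k=1..m. (c k)\<^sup>2)"
proof -
  show "(\<lambda>w. \<Sum>k=1..m. e k w * c k) \<in> chaos_closure n"
    using chaos_closure_cmult[OF e] by (intro chaos_closure_sum) (auto simp: mult.commute)
  have esq: "e k \<in> sq_integrable M" if "k \<in> {1..m}" for k using e[OF that] by (simp add: chaos_closure_def)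
  have I: "integrable M (\<lambda>w. e j w * e k w)" if jk: "j \<in> {1..m}" "k \<in> {1..m}" for j k
  proof (rule Bochner_Integration.integrable_bound)
    show "integrable M (\<lambda>w. (e j w)\<^sup>2 + (e k w)\<^sup>2)" using esq jk by (auto simp: sq_integrable_def)
    show "(\<lambda>w. e j w * e k w) \<in> borel_measurable M"
      using esq[OF jk(1)] esq[OF jk(2)] by (auto simp: sq_integrable_def intro: borel_measurable_times)
    show "AE w in M. norm (e j w * e k w) \<le> norm ((e j w)\<^sup>2 + (e k w)\<^sup>2)"
    proof (intro AE_I2)
      fix w
      have "2 * (\<bar>e j w\<bar> * \<bar>e k w\<bar>) \<le> (e j w)\<^sup>2 + (e k w)\<^sup>2"
        using sum_squares_bound[of "\<bar>e j w\<bar>" "\<bar>e k w\<bar>"] by simp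
      moreover have "0 \<le> \<bar>e j w\<bar> * \<bar>e k w\<bar>" by simp
      ultimately have "\<bar>e j w\<bar> * \<bar>e k w\<bar> \<le> (e j w)\<^sup>2 + (e k w)\<^sup>2" by linarith
      then show "norm (e j w * e k w) \<le> norm ((e j w)\<^sup>2 + (e k w)\<^sup>2)" by (simp add: abs_mult)
    qed
  qed
  have "expectation (\<lambda>w. (\<Sum>k=1..m. e k w * c k)\<^sup>2)
      = expectation (\<lambda>w. \<Sum>j=1..m. \<Sum>k=1..m. c j * c k * (e j w * e k w))"
    by (simp only: power2_eq_square sum_product mult_ac)
  also have "\<dots> = (\<Sum>j=1..m. \<Sum>k=1..m. c j * c k * expectation (\<lambda>w. e j w * e k w))"
  proof -
    have "expectation (\<lambda>w. \<Sum>k=1..m. c j * c k * (e j w * e k w))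
        = (\<Sum>k=1..m. c j * c k * expectation (\<lambda>w. e j w * e k w))" if "j \<in> {1..m}" for j
      using I[OF that] by (subst Bochner_Integration.integral_sum) (auto intro!: integrable_mult_right)
    then show ?thesis
      using I by (subst Bochner_Integration.integral_sum)
        (auto intro!: Bochner_Integration.integrable_sum integrable_mult_right)
  qed
  also have "\<dots> = (\<Sum>j=1..m. \<Sum>k=1..m. if j = k then (c j)\<^sup>2 else 0)"
    using on by (intro sum.cong refl) (auto simp: L2_orthonormal_def power2_eq_square)
  also have "\<dots> = (\<Sum>k=1..m. (c k)\<^sup>2)" by simp
  finally show "expectation (\<lambda>w. (\<Sum>k=1..m. e k w * c k)\<^sup>2) = (\<Sum>k=1..m. (c k)\<^sup>2)" .
qed

end

text \<open>A random series and its square function, for one pair of exponents.\<close>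
locale chaos_series = isonormal M W + mixed p1 p2 M1 M2
  for M :: "'w measure" and W :: "'v::real_inner \<Rightarrow> 'w \<Rightarrow> real"
    and p1 p2 :: real and M1 :: "'a measure" and M2 :: "'b measure" +
  fixes n m :: nat and e :: "nat \<Rightarrow> 'w \<Rightarrow> real" and \<phi> :: "nat \<Rightarrow> 'a \<times> 'b \<Rightarrow> real"
  assumes on: "L2_orthonormal M m e" and e: "\<And>k. k \<in> {1..m} \<Longrightarrow> e k \<in> chaos_closure n"
    and phi: "\<And>k. k \<in> {1..m} \<Longrightarrow> \<phi> k \<in> mixed_fun p1 p2 M1 M2"
begin

definition series :: "'w \<Rightarrow> 'a \<times> 'b \<Rightarrow> real" where "series w z = (\<Sum>k=1..m. e k w * \<phi> k z)"
definition square_fun :: "'a \<times> 'b \<Rightarrow> real" where "square_fun z = sqrt (\<Sum>k=1..m. (\<phi> k z)\<^sup>2)"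

lemma series_mixed_fun: "series w \<in> MF"
  unfolding series_def[abs_def] using phi by (intro mixed_fun_sum mixed_fun_cmult) auto

lemma square_fun_mixed_fun: "square_fun \<in> MF"
  unfolding square_fun_def[abs_def] using phi by (rule square_function_mixed_fun)

lemma square_fun_nonneg [simp]: "0 \<le> square_fun z" by (simp add: square_fun_def sum_nonneg)

lemma sigma_finite_M: "sigma_finite_measure M"
  by unfold_locales

lemma MN_square_fun: "ennreal (MN square_fun) = EN (\<lambda>z. ennreal (square_fun z))"
  using MN_eq_EN[OF square_fun_mixed_fun] by simp

lemma measurable_series [measurable]: "(\<lambda>(w, z). series w z) \<in> borel_measurable (M \<Otimes>\<^sub>M \<MM>)"
proof -
  have [measurable]: "e k \<in> borel_measurable M" "\<phi> k \<in> borel_measurable \<MM>" if "k \<in> {1..m}" for k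
    using e[OF that] phi[OF that] by (auto simp: chaos_closure_def sq_integrable_def)
  show ?thesis unfolding series_def by measurable
qed

text \<open>Pointwise, the second moment of the series is independent of the orthonormal system.\<close>
lemma series_point: "(\<lambda>w. series w z) \<in> chaos_closure n" "expectation (\<lambda>w. (series w z)\<^sup>2) = (square_fun z)\<^sup>2"
  using orthonormal_combination[OF on e, of "\<lambda>k. \<phi> k z"] by (simp_all add: series_def square_fun_def sum_nonneg)

lemma measurable_MN_series [measurable]: "(\<lambda>w. MN (series w)) \<in> borel_measurable M"
proof -
  have "(\<lambda>w. enn2real (EN (\<lambda>z. ennreal \<bar>series w z\<bar>))) \<in> borel_measurable M" by measurable
  moreover have "enn2real (EN (\<lambda>z. ennreal \<bar>series w z\<bar>)) = MN (series w)" for w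
    by (simp add: MN_eq_EN[OF series_mixed_fun, symmetric])
  ultimately show ?thesis by simp
qed

text \<open>
  The scalar bound at each point gives a multiple of the square function below the mean of the absolute
  value of the series; Minkowski's inequality moves the mean outside the norm.
\<close>
lemma norm_expectation_lower:
  assumes c: "0 \<le> c" "\<And>H. H \<in> chaos_closure n \<Longrightarrow>
     ennreal (c * sqrt (expectation (\<lambda>w. (H w)\<^sup>2))) \<le> (\<integral>\<^sup>+w. ennreal \<bar>H w\<bar> \<partial>M)"
  shows "ennreal (c * MN square_fun) \<le> (\<integral>\<^sup>+w. ennreal (MN (series w)) \<partial>M)"
proof -
  have Gm [measurable]: "square_fun \<in> borel_measurable \<MM>" using square_fun_mixed_fun by (rule mixed_fun_measurable)
  have "ennreal (c * MN square_fun) = EN (\<lambda>z. ennreal c * ennreal \<bar>square_fun z\<bar>)"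
    using c(1) by (subst EN_cmult) (auto simp: MN_square_fun ennreal_mult)
  also have "\<dots> \<le> EN (\<lambda>z. \<integral>\<^sup>+w. ennreal \<bar>series w z\<bar> \<partial>M)"
  proof (intro EN_mono AE_I2)
    fix z
    have "sqrt ((square_fun z)\<^sup>2) = \<bar>square_fun z\<bar>" by (rule real_sqrt_abs)
    then show "ennreal c * ennreal \<bar>square_fun z\<bar> \<le> (\<integral>\<^sup>+w. ennreal \<bar>series w z\<bar> \<partial>M)"
      using c(2)[OF series_point(1)[of z]] unfolding series_point(2) ennreal_mult[OF c(1) abs_ge_zero, symmetric]
      by (simp only:)
  qed
  also have "\<dots> \<le> (\<integral>\<^sup>+w. EN (\<lambda>z. ennreal \<bar>series w z\<bar>) \<partial>M)"
    by (rule Minkowski_mixed[OF sigma_finite_M]) measurable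
  also have "\<dots> = (\<integral>\<^sup>+w. ennreal (MN (series w)) \<partial>M)" by (simp add: MN_eq_EN[OF series_mixed_fun])
  finally show ?thesis .
qed

text \<open>
  Pass from the second to the moment of order \<open>2\<^sup>k\<^sup>+\<^sup>1\<close>, move it inside the norm, which requires an order of at
  least both exponents, and apply the scalar bound at each point.
\<close>
lemma norm_expectation_upper:
  assumes k: "p1 \<le> 2 ^ Suc k" "p2 \<le> 2 ^ Suc k"
    and C: "0 \<le> C" "\<And>H. H \<in> chaos_closure n \<Longrightarrow>
     (\<integral>\<^sup>+w. ennreal (H w ^ (2 ^ Suc k)) \<partial>M) \<le> ennreal (C * (expectation (\<lambda>w. (H w)\<^sup>2)) ^ (2 ^ k))"
  shows "(\<integral>\<^sup>+w. ennreal ((MN (series w))\<^sup>2) \<partial>M) \<le> ennreal ((C powr (1 / 2 ^ Suc k) * MN square_fun)\<^sup>2)"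
proof -
  have Gm [measurable]: "square_fun \<in> borel_measurable \<MM>" using square_fun_mixed_fun by (rule mixed_fun_measurable)
  define r :: real where "r = 2 ^ Suc k"
  have r: "2 \<le> r" unfolding r_def by simp
  have pw: "\<bar>x\<bar> powr r = x ^ (2 ^ Suc k)" for x :: real
  proof (cases "x = 0")
    case False
    then have "\<bar>x\<bar> powr real (2 ^ Suc k) = \<bar>x\<bar> ^ (2 ^ Suc k)"
      by (intro powr_realpow) simp
    moreover have "real (2 ^ Suc k) = r" by (simp add: r_def)
    moreover have "\<bar>x\<bar> ^ (2 ^ Suc k) = x ^ (2 ^ Suc k)" by (rule power_even_abs) simp
    ultimately show ?thesis by (simp only:)
  qed simp
  have point: "ennpowr (\<integral>\<^sup>+w. ennpowr (ennreal \<bar>series w z\<bar>) r \<partial>M) (1 / r) \<le> ennreal (C powr (1 / r)) * ennreal \<bar>square_fun z\<bar>" for z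
  proof -
    have "(\<integral>\<^sup>+w. ennpowr (ennreal \<bar>series w z\<bar>) r \<partial>M) \<le> ennreal (C * ((square_fun z)\<^sup>2) ^ (2 ^ k))"
      using C(2)[OF series_point(1)[of z]] by (simp only: ennpowr_ennreal[OF abs_ge_zero] pw series_point(2))
    also have "((square_fun z)\<^sup>2) ^ (2 ^ k) = \<bar>square_fun z\<bar> powr r" by (simp only: pw power_mult[symmetric]) simp
    finally have "ennpowr (\<integral>\<^sup>+w. ennpowr (ennreal \<bar>series w z\<bar>) r \<partial>M) (1 / r) \<le> ennpowr (ennreal (C * \<bar>square_fun z\<bar> powr r)) (1 / r)"
      using r by (intro ennpowr_mono) auto
    also have "\<dots> = ennreal (C powr (1 / r)) * ennreal \<bar>square_fun z\<bar>"
      using C(1) r by (simp add: ennpowr_ennreal powr_mult powr_powr ennreal_mult[symmetric])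
    finally show ?thesis .
  qed
  have "ennpowr (\<integral>\<^sup>+w. ennpowr (ennreal (MN (series w))) 2 * 1 \<partial>M) (r / 2)
      \<le> (\<integral>\<^sup>+w. ennpowr (ennpowr (ennreal (MN (series w))) 2) (r / 2) * 1 \<partial>M)"
    using r by (intro power_mean) (auto simp: emeasure_space_1)
  then have "ennpowr (ennpowr (\<integral>\<^sup>+w. ennpowr (ennreal (MN (series w))) 2 \<partial>M) (r / 2)) (1 / r)
      \<le> ennpowr (\<integral>\<^sup>+w. ennpowr (ennreal (MN (series w))) r \<partial>M) (1 / r)"
    using r by (intro ennpowr_mono) (auto simp: ennpowr_ennpowr)
  also have "\<dots> \<le> EN (\<lambda>z. ennpowr (\<integral>\<^sup>+w. ennpowr (ennreal \<bar>series w z\<bar>) r \<partial>M) (1 / r))"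
    unfolding MN_eq_EN[OF series_mixed_fun] using k
    by (intro Minkowski_mixed_power[OF sigma_finite_M]) (auto simp: r_def)
  also have "\<dots> \<le> EN (\<lambda>z. ennreal (C powr (1 / r)) * ennreal \<bar>square_fun z\<bar>)"
    using point by (intro EN_mono AE_I2)
  also have "\<dots> = ennreal (C powr (1 / r) * MN square_fun)"
    by (subst EN_cmult) (auto simp: MN_square_fun ennreal_mult)
  finally have "ennpowr (\<integral>\<^sup>+w. ennpowr (ennreal (MN (series w))) 2 \<partial>M) (1 / 2) \<le> ennreal (C powr (1 / r) * MN square_fun)"
    using r by (simp add: ennpowr_ennpowr)
  then have "ennpowr (ennpowr (\<integral>\<^sup>+w. ennpowr (ennreal (MN (series w))) 2 \<partial>M) (1 / 2)) 2 \<le> ennpowr (ennreal (C powr (1 / r) * MN square_fun)) 2"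
    by (intro ennpowr_mono) auto
  then have "(\<integral>\<^sup>+w. ennpowr (ennreal (MN (series w))) 2 \<partial>M) \<le> ennpowr (ennreal (C powr (1 / r) * MN square_fun)) 2"
    by (simp add: ennpowr_ennpowr)
  then show ?thesis by (simp add: ennpowr_ennreal r_def)
qed

end

section \<open>Finite products\<close>

text \<open>
  The finite product.  Its elements are tuples of classes; computations are done with tuples \<open>\<phi>\<close> of
  functions, and \<open>tclass \<phi>\<close> is the element that they represent.
\<close>
locale mixed_product =
  fixes I :: "nat set" and p1 p2 :: "nat \<Rightarrow> real"
    and D1 :: "nat \<Rightarrow> 'a measure" and D2 :: "nat \<Rightarrow> 'b measure"
  assumes finite_I [simp]: "finite I"
    and mixed: "\<And>i. i \<in> I \<Longrightarrow> mixed (p1 i) (p2 i) (D1 i) (D2 i)"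
begin

abbreviation "MFi i \<equiv> mixed_fun (p1 i) (p2 i) (D1 i) (D2 i)"
abbreviation "MNi i \<equiv> mixed_norm (p1 i) (p2 i) (D1 i) (D2 i)"
abbreviation "MCi i \<equiv> mixed_class (p1 i) (p2 i) (D1 i) (D2 i)"
abbreviation "Y \<equiv> prod_nspace I (\<lambda>i. mixed_space (p1 i) (p2 i) (D1 i) (D2 i))"

definition tuples :: "(nat \<Rightarrow> 'a \<times> 'b \<Rightarrow> real) set" where
  "tuples = {\<phi>. \<forall>i\<in>I. \<phi> i \<in> MFi i}"

definition tclass :: "(nat \<Rightarrow> 'a \<times> 'b \<Rightarrow> real) \<Rightarrow> nat \<Rightarrow> ('a \<times> 'b \<Rightarrow> real) set" where
  "tclass \<phi> = (\<lambda>i\<in>I. MCi i (\<phi> i))"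

definition tnorm :: "(nat \<Rightarrow> 'a \<times> 'b \<Rightarrow> real) \<Rightarrow> real" where
  "tnorm \<phi> = (\<Sum>i\<in>I. MNi i (\<phi> i))"

lemma tnorm_nonneg [simp]: "0 \<le> tnorm \<phi>"
  by (simp add: tnorm_def sum_nonneg)

lemma tclass_carrier: "\<phi> \<in> tuples \<Longrightarrow> tclass \<phi> \<in> vcarrier Y"
  by (auto simp: tuples_def tclass_def prod_nspace_def mixed.mixed_space_carrier[OF mixed])

lemma carrier_tclass:
  assumes "y \<in> vcarrier Y"
  obtains \<phi> where "\<phi> \<in> tuples" "y = tclass \<phi>"
proof -
  have y: "y \<in> (\<Pi>\<^sub>E i\<in>I. MCi i ` MFi i)"
    using assms by (simp add: prod_nspace_def mixed_space_def)
  then have "\<forall>i\<in>I. \<exists>f. f \<in> MFi i \<and> y i = MCi i f" by (auto simp: PiE_def Pi_def)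
  then obtain \<phi> where \<phi>: "\<And>i. i \<in> I \<Longrightarrow> \<phi> i \<in> MFi i \<and> y i = MCi i (\<phi> i)" by metis
  show ?thesis
  proof (rule that[of \<phi>])
    show "\<phi> \<in> tuples" using \<phi> by (simp add: tuples_def)
    show "y = tclass \<phi>"
    proof
      fix i show "y i = tclass \<phi> i"
        using \<phi>[of i] y by (cases "i \<in> I") (auto simp: tclass_def PiE_def extensional_def)
    qed
  qed
qed

lemma tclass_add:
  assumes "\<phi> \<in> tuples" "\<psi> \<in> tuples"
  shows "vadd Y (tclass \<phi>) (tclass \<psi>) = tclass (\<lambda>i z. \<phi> i z + \<psi> i z)"
  unfolding prod_nspace_def tclass_def
  by (simp cong: restrict_cong) (use assms in \<open>auto simp: tuples_def mixed.mixed_space_add[OF mixed] intro!: restrict_ext\<close>)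

lemma tclass_scale:
  assumes "\<phi> \<in> tuples"
  shows "vscale Y c (tclass \<phi>) = tclass (\<lambda>i z. c * \<phi> i z)"
  unfolding prod_nspace_def tclass_def
  by (simp cong: restrict_cong) (use assms in \<open>auto simp: tuples_def mixed.mixed_space_scale[OF mixed] intro!: restrict_ext\<close>)

lemma tclass_norm: "\<phi> \<in> tuples \<Longrightarrow> vnorm Y (tclass \<phi>) = tnorm \<phi>"
  by (simp add: prod_nspace_def tclass_def tnorm_def tuples_def mixed.mixed_space_norm[OF mixed])

lemma tuples_add: "\<phi> \<in> tuples \<Longrightarrow> \<psi> \<in> tuples \<Longrightarrow> (\<lambda>i z. \<phi> i z + \<psi> i z) \<in> tuples"
  by (simp add: tuples_def mixed.mixed_fun_add[OF mixed])

lemma tuples_scale: "\<phi> \<in> tuples \<Longrightarrow> (\<lambda>i z. c * \<phi> i z) \<in> tuples"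
  by (simp add: tuples_def mixed.mixed_fun_cmult[OF mixed])

lemma tuples_zero: "(\<lambda>i z. 0) \<in> tuples"
  by (simp add: tuples_def mixed.mixed_fun_zero[OF mixed])

lemma tuples_sum: "(\<And>k. k \<in> K \<Longrightarrow> \<phi> k \<in> tuples) \<Longrightarrow> (\<lambda>i z. \<Sum>k\<in>K. c k * \<phi> k i z) \<in> tuples"
proof (induction K rule: infinite_finite_induct)
  case (insert k K)
  then have "(\<lambda>i z. c k * \<phi> k i z + (\<Sum>k\<in>K. c k * \<phi> k i z)) \<in> tuples"
    by (intro tuples_add tuples_scale) auto
  then show ?case using insert.hyps by simp
qed (simp_all add: tuples_zero)

text \<open>
  The hypothesis on \<open>y\<close> provides a representative for some value of \<open>T\<close>; scaling it by \<open>0\<close> gives one for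
  the empty sum.
\<close>
lemma linear_into_Y_sum:
  fixes T :: "'x::real_normed_vector \<Rightarrow> nat \<Rightarrow> ('a \<times> 'b \<Rightarrow> real) set"
  assumes T: "bounded_linear_op type_nspace (Y\<lparr>vcarrier := Z\<rparr>) T"
    and K: "finite K" "\<And>k. k \<in> K \<Longrightarrow> \<phi> k \<in> tuples" "\<And>k. k \<in> K \<Longrightarrow> T (x k) = tclass (\<phi> k)"
    and y: "T y = tclass \<psi>" "\<psi> \<in> tuples"
  shows "T (\<Sum>k\<in>K. c k *\<^sub>R x k) = tclass (\<lambda>i z. \<Sum>k\<in>K. c k * \<phi> k i z)"
proof -
  have add: "T (u + v) = vadd Y (T u) (T v)" and scale: "T (a *\<^sub>R u) = vscale Y a (T u)" for u v a
    using T by (simp_all add: bounded_linear_op_def type_nspace_def)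
  show ?thesis using K
  proof (induction K rule: finite_induct)
    case empty
    have "T (0 *\<^sub>R y) = tclass (\<lambda>i z. 0 * \<psi> i z)" unfolding scale y(1) by (rule tclass_scale[OF y(2)])
    then show ?case by simp
  next
    case (insert k K)
    have "T (\<Sum>k\<in>insert k K. c k *\<^sub>R x k) = vadd Y (vscale Y (c k) (T (x k))) (T (\<Sum>k\<in>K. c k *\<^sub>R x k))"
      using insert.hyps by (simp add: add scale)
    also have "\<dots> = vadd Y (tclass (\<lambda>i z. c k * \<phi> k i z)) (tclass (\<lambda>i z. \<Sum>k\<in>K. c k * \<phi> k i z))"
      using insert by (simp add: tclass_scale)
    also have "\<dots> = tclass (\<lambda>i z. c k * \<phi> k i z + (\<Sum>k\<in>K. c k * \<phi> k i z))"
      using insert.prems by (intro tclass_add tuples_scale tuples_sum) auto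
    finally show ?case using insert.hyps by simp
  qed
qed

lemma linear_from_Y_sum:
  fixes R :: "(nat \<Rightarrow> ('a \<times> 'b \<Rightarrow> real) set) \<Rightarrow> 'x::real_normed_vector"
  assumes R: "bounded_linear_op Y type_nspace R"
    and K: "finite K" "\<And>k. k \<in> K \<Longrightarrow> \<phi> k \<in> tuples"
  shows "R (tclass (\<lambda>i z. \<Sum>k\<in>K. c k * \<phi> k i z)) = (\<Sum>k\<in>K. c k *\<^sub>R R (tclass (\<phi> k)))"
proof -
  have add: "R (vadd Y u v) = R u + R v" if "u \<in> vcarrier Y" "v \<in> vcarrier Y" for u v
    using R that by (simp add: bounded_linear_op_def type_nspace_def)
  have scale: "R (vscale Y a u) = a *\<^sub>R R u" if "u \<in> vcarrier Y" for u a
    using R that by (simp add: bounded_linear_op_def type_nspace_def)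
  show ?thesis using K
  proof (induction K rule: finite_induct)
    case empty
    have "R (vscale Y 0 (tclass (\<lambda>i z. 0))) = 0 *\<^sub>R R (tclass (\<lambda>i z. 0))"
      by (intro scale tclass_carrier tuples_zero)
    then show ?case by (simp add: tclass_scale[OF tuples_zero])
  next
    case (insert k K)
    have t: "(\<lambda>i z. c k * \<phi> k i z) \<in> tuples" "(\<lambda>i z. \<Sum>k\<in>K. c k * \<phi> k i z) \<in> tuples" "\<phi> k \<in> tuples"
      using insert.prems by (auto intro!: tuples_scale tuples_sum)
    have "(\<lambda>i z. \<Sum>k\<in>insert k K. c k * \<phi> k i z) = (\<lambda>i z. c k * \<phi> k i z + (\<Sum>k\<in>K. c k * \<phi> k i z))"
      using insert.hyps by simp
    then have "R (tclass (\<lambda>i z. \<Sum>k\<in>insert k K. c k * \<phi> k i z))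
        = R (vadd Y (vscale Y (c k) (tclass (\<phi> k))) (tclass (\<lambda>i z. \<Sum>k\<in>K. c k * \<phi> k i z)))"
      by (simp only: tclass_add[OF t(1,2)] tclass_scale[OF t(3)])
    also have "\<dots> = c k *\<^sub>R R (tclass (\<phi> k)) + R (tclass (\<lambda>i z. \<Sum>k\<in>K. c k * \<phi> k i z))"
      using add[of "vscale Y (c k) (tclass (\<phi> k))" "tclass (\<lambda>i z. \<Sum>k\<in>K. c k * \<phi> k i z)"] scale[of "tclass (\<phi> k)" "c k"]
        tclass_carrier[OF t(1)] tclass_carrier[OF t(2)] tclass_carrier[OF t(3)]
      by (simp only: tclass_scale[OF t(3)])
    also have "R (tclass (\<lambda>i z. \<Sum>k\<in>K. c k * \<phi> k i z)) = (\<Sum>k\<in>K. c k *\<^sub>R R (tclass (\<phi> k)))"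
      using insert by blast
    finally show ?case using insert.hyps by simp
  qed
qed

end

text \<open>
  In a non-separable space a sum of measurable functions may fail to be measurable.  The norm of the sum is
  handled instead as a continuous function of the coefficients, which form a measurable map into a space of
  real sequences.
\<close>
lemma measurable_norm_random_sum:
  fixes x :: "nat \<Rightarrow> 'x::real_normed_vector"
  assumes "\<And>k. k \<in> {1..m} \<Longrightarrow> e k \<in> borel_measurable M"
  shows "(\<lambda>w. norm (\<Sum>k=1..m. e k w *\<^sub>R x k)) \<in> borel_measurable M"
proof -
  define a where "a w k = (if k \<in> {1..m} then e k w else 0)" for w and k :: nat
  have "a \<in> borel_measurable M"
  proof (rule measurable_coordinatewise_then_product)
    fix k show "(\<lambda>w. a w k) \<in> borel_measurable M"
      using assms[of k] by (cases "k \<in> {1..m}") (auto simp: a_def)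
  qed
  moreover have "(\<lambda>b :: nat \<Rightarrow> real. norm (\<Sum>k=1..m. b k *\<^sub>R x k)) \<in> borel_measurable borel"
    by (intro borel_measurable_continuous_onI continuous_intros continuous_on_product_coordinates)
  ultimately have "(\<lambda>w. norm (\<Sum>k=1..m. a w k *\<^sub>R x k)) \<in> borel_measurable M"
    by (rule measurable_compose)
  then show ?thesis by (simp add: a_def)
qed

locale chaos_product = isonormal M W + mixed_product I p1 p2 D1 D2
  for M :: "'w measure" and W :: "'v::real_inner \<Rightarrow> 'w \<Rightarrow> real"
    and I :: "nat set" and p1 p2 :: "nat \<Rightarrow> real"
    and D1 :: "nat \<Rightarrow> 'a measure" and D2 :: "nat \<Rightarrow> 'b measure"
begin

text \<open>The norm of the tuple of square functions, with which all random sums are compared.\<close>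
definition square_norm :: "nat \<Rightarrow> (nat \<Rightarrow> nat \<Rightarrow> 'a \<times> 'b \<Rightarrow> real) \<Rightarrow> real" where
  "square_norm m \<phi> = tnorm (\<lambda>i z. sqrt (\<Sum>k=1..m. (\<phi> k i z)\<^sup>2))"

definition equivalence_constants :: "nat \<Rightarrow> real \<Rightarrow> real \<Rightarrow> bool" where
  "equivalence_constants n c C \<longleftrightarrow>
     (\<forall>m e \<phi>. L2_orthonormal M m e \<and> (\<forall>k\<in>{1..m}. e k \<in> wiener_chaos_sum M W n \<and> \<phi> k \<in> tuples) \<longrightarrow>
       (\<forall>i\<in>I. (\<lambda>w. MNi i (\<lambda>z. \<Sum>k=1..m. e k w * \<phi> k i z)) \<in> borel_measurable M) \<and>
       ennreal (c * square_norm m \<phi>) \<le> (\<integral>\<^sup>+w. ennreal (tnorm (\<lambda>i z. \<Sum>k=1..m. e k w * \<phi> k i z)) \<partial>M) \<and>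
       (\<integral>\<^sup>+w. ennreal ((tnorm (\<lambda>i z. \<Sum>k=1..m. e k w * \<phi> k i z))\<^sup>2) \<partial>M) \<le> ennreal ((C * square_norm m \<phi>)\<^sup>2))"

lemma equivalence_constantsD:
  assumes "equivalence_constants n c C" "L2_orthonormal M m e"
    and "\<And>k. k \<in> {1..m} \<Longrightarrow> e k \<in> wiener_chaos_sum M W n" "\<And>k. k \<in> {1..m} \<Longrightarrow> \<phi> k \<in> tuples"
  shows "i \<in> I \<Longrightarrow> (\<lambda>w. MNi i (\<lambda>z. \<Sum>k=1..m. e k w * \<phi> k i z)) \<in> borel_measurable M"
    "ennreal (c * square_norm m \<phi>) \<le> (\<integral>\<^sup>+w. ennreal (tnorm (\<lambda>i z. \<Sum>k=1..m. e k w * \<phi> k i z)) \<partial>M)"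
    "(\<integral>\<^sup>+w. ennreal ((tnorm (\<lambda>i z. \<Sum>k=1..m. e k w * \<phi> k i z))\<^sup>2) \<partial>M) \<le> ennreal ((C * square_norm m \<phi>)\<^sup>2)"
  using assms(1)[unfolded equivalence_constants_def, THEN spec, THEN spec, THEN spec, THEN mp, of m e \<phi>] assms(2-4)
  by blast+

text \<open>
  One moment of order \<open>2\<^sup>k\<^sup>+\<^sup>1\<close> serves all factors, so the constants do not depend on the factor.
\<close>
lemma square_norm_equivalence:
  "\<exists>c>0. \<exists>C>0. equivalence_constants n c C"
proof -
  obtain c where c: "0 < c" "\<And>H. H \<in> chaos_closure n \<Longrightarrow>
     ennreal (c * sqrt (expectation (\<lambda>w. (H w)\<^sup>2))) \<le> (\<integral>\<^sup>+w. ennreal \<bar>H w\<bar> \<partial>M)"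
    using chaos_closure_L1_bound[of n] by blast
  define q where "q = (\<Sum>i\<in>I. p1 i + p2 i)"
  have p_ge: "1 \<le> p1 i" "1 \<le> p2 i" if "i \<in> I" for i
    using mixed[OF that] by (auto simp: mixed_def mixed_axioms_def)
  obtain k :: nat where k: "q < 2 ^ k" using real_arch_pow[of 2 q] by auto
  have pk: "p1 i \<le> 2 ^ Suc k" "p2 i \<le> 2 ^ Suc k" if "i \<in> I" for i
  proof -
    have "p1 i + p2 i \<le> q" unfolding q_def
      using that p_ge by (intro member_le_sum) (auto intro: add_nonneg_nonneg order_trans[OF zero_le_one])
    moreover have "(0::real) < 2 ^ k" by simp
    ultimately have "p1 i + p2 i \<le> 2 ^ Suc k" using k unfolding power_Suc by linarith
    then show "p1 i \<le> 2 ^ Suc k" "p2 i \<le> 2 ^ Suc k" using p_ge[OF that] by auto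
  qed
  obtain C where C: "0 < C" "\<And>H. H \<in> chaos_closure n \<Longrightarrow>
     (\<integral>\<^sup>+w. ennreal (H w ^ (2 ^ Suc k)) \<partial>M) \<le> ennreal (C * (expectation (\<lambda>w. (H w)\<^sup>2)) ^ (2 ^ k))"
    using chaos_closure_moments[where n=n and k=k] by blast
  define K where "K = C powr (1 / 2 ^ Suc k)"
  have K: "0 < K" using C(1) by (simp add: K_def)
  define L where "L = K * sqrt (real (card I) + 1)"
  have L: "0 < L" using K by (simp add: L_def add_nonneg_pos)
  have "equivalence_constants n c L"
    unfolding equivalence_constants_def
  proof (intro allI impI conjI ballI)
    fix m e \<phi>
    assume "L2_orthonormal M m e \<and> (\<forall>k\<in>{1..m}. e k \<in> wiener_chaos_sum M W n \<and> \<phi> k \<in> tuples)"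
    then have on: "L2_orthonormal M m e" and ech: "\<And>k. k \<in> {1..m} \<Longrightarrow> e k \<in> wiener_chaos_sum M W n"
      and tup: "\<And>k. k \<in> {1..m} \<Longrightarrow> \<phi> k \<in> tuples"
      by blast+
    have ephi: "e k \<in> chaos_closure n" "i \<in> I \<Longrightarrow> \<phi> k i \<in> MFi i" if "k \<in> {1..m}" for k i
      using ech[OF that] tup[OF that] wiener_chaos_sum_subset[of n] by (auto simp: tuples_def)
    let ?F = "\<lambda>w i z. \<Sum>k=1..m. e k w * \<phi> k i z"
    let ?G = "\<lambda>i z. sqrt (\<Sum>k=1..m. (\<phi> k i z)\<^sup>2)"
    have cs: "chaos_series M W (p1 i) (p2 i) (D1 i) (D2 i) n m e (\<lambda>k. \<phi> k i)" if "i \<in> I" for i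
      using on ephi that
      by (intro chaos_series.intro chaos_series_axioms.intro isonormal_axioms mixed) auto
    have F_eq: "chaos_series.series m e (\<lambda>k. \<phi> k i) w = ?F w i" if "i \<in> I" for i w
      by (simp add: chaos_series.series_def[OF cs[OF that]] fun_eq_iff)
    have G_eq: "chaos_series.square_fun m (\<lambda>k. \<phi> k i) = ?G i" if "i \<in> I" for i
      by (simp add: chaos_series.square_fun_def[OF cs[OF that]] fun_eq_iff)
    have m: "(\<lambda>w. MNi i (?F w i)) \<in> borel_measurable M" if "i \<in> I" for i
      using chaos_series.measurable_MN_series[OF cs[OF that]] by (simp add: F_eq[OF that])
    then show "(\<lambda>w. MNi i (?F w i)) \<in> borel_measurable M" if "i \<in> I" for i using that .
    have lo: "ennreal (c * MNi i (?G i)) \<le> (\<integral>\<^sup>+w. ennreal (MNi i (?F w i)) \<partial>M)" if "i \<in> I" for i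
      using chaos_series.norm_expectation_lower[OF cs[OF that] less_imp_le[OF c(1)] c(2)] by (simp add: F_eq[OF that] G_eq[OF that])
    have up: "(\<integral>\<^sup>+w. ennreal ((MNi i (?F w i))\<^sup>2) \<partial>M) \<le> ennreal ((K * MNi i (?G i))\<^sup>2)" if "i \<in> I" for i
      using chaos_series.norm_expectation_upper[OF cs[OF that] pk[OF that] less_imp_le[OF C(1)] C(2)]
      by (simp add: F_eq[OF that] G_eq[OF that] K_def)
    have "ennreal (c * square_norm m \<phi>) = (\<Sum>i\<in>I. ennreal (c * MNi i (?G i)))"
      using c(1) by (simp add: square_norm_def tnorm_def sum_distrib_left)
    also have "\<dots> \<le> (\<Sum>i\<in>I. \<integral>\<^sup>+w. ennreal (MNi i (?F w i)) \<partial>M)" by (intro sum_mono lo)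
    also have "\<dots> = (\<integral>\<^sup>+w. (\<Sum>i\<in>I. ennreal (MNi i (?F w i))) \<partial>M)"
      using m by (intro nn_integral_sum[symmetric]) auto
    also have "\<dots> = (\<integral>\<^sup>+w. ennreal (tnorm (?F w)) \<partial>M)" by (simp add: tnorm_def)
    finally show "ennreal (c * square_norm m \<phi>) \<le> (\<integral>\<^sup>+w. ennreal (tnorm (?F w)) \<partial>M)" .
    have "(\<integral>\<^sup>+w. ennreal ((tnorm (?F w))\<^sup>2) \<partial>M) \<le> (\<integral>\<^sup>+w. ennreal (card I) * (\<Sum>i\<in>I. ennreal ((MNi i (?F w i))\<^sup>2)) \<partial>M)"
      using sum_squared_le_sum_of_squares[of "\<lambda>i. MNi i (?F _ i)" I]
      by (intro nn_integral_mono) (simp add: tnorm_def ennreal_mult'[symmetric] mult.commute ennreal_leI sum_nonneg)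
    also have "\<dots> = ennreal (card I) * (\<Sum>i\<in>I. \<integral>\<^sup>+w. ennreal ((MNi i (?F w i))\<^sup>2) \<partial>M)"
    proof -
      have sm: "(\<lambda>w. ennreal ((MNi i (?F w i))\<^sup>2)) \<in> borel_measurable M" if "i \<in> I" for i
        using m[OF that] by measurable
      show ?thesis
        using sm by (subst nn_integral_cmult) (auto simp only: nn_integral_sum intro: borel_measurable_sum)
    qed
    also have "\<dots> \<le> ennreal (card I) * (\<Sum>i\<in>I. ennreal ((K * MNi i (?G i))\<^sup>2))"
      by (intro mult_left_mono sum_mono up) auto
    also have "\<dots> = ennreal (card I * (\<Sum>i\<in>I. (K * MNi i (?G i))\<^sup>2))"
      by (simp add: ennreal_mult' sum_nonneg)
    also have "\<dots> \<le> ennreal ((L * square_norm m \<phi>)\<^sup>2)"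
    proof (rule ennreal_leI)
      have s: "(\<Sum>i\<in>I. (MNi i (?G i))\<^sup>2) \<le> (square_norm m \<phi>)\<^sup>2"
      proof -
        have "(\<Sum>i\<in>I. (MNi i (?G i))\<^sup>2) \<le> (\<Sum>i\<in>I. MNi i (?G i) * square_norm m \<phi>)"
          unfolding power2_eq_square square_norm_def tnorm_def
          by (intro sum_mono mult_left_mono member_le_sum) auto
        then show ?thesis by (simp add: square_norm_def tnorm_def sum_distrib_right power2_eq_square)
      qed
      have "card I * (\<Sum>i\<in>I. (K * MNi i (?G i))\<^sup>2) = (real (card I) * K\<^sup>2) * (\<Sum>i\<in>I. (MNi i (?G i))\<^sup>2)"
        by (simp add: power_mult_distrib sum_distrib_left mult.assoc)
      also have "\<dots> \<le> ((real (card I) + 1) * K\<^sup>2) * (square_norm m \<phi>)\<^sup>2"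
        using s by (intro mult_mono mult_right_mono) (auto intro: sum_nonneg)
      also have "\<dots> = (L * square_norm m \<phi>)\<^sup>2"
        by (simp add: L_def power_mult_distrib)
      finally show "card I * (\<Sum>i\<in>I. (K * MNi i (?G i))\<^sup>2) \<le> (L * square_norm m \<phi>)\<^sup>2" .
    qed
    finally show "(\<integral>\<^sup>+w. ennreal ((tnorm (?F w))\<^sup>2) \<partial>M) \<le> ennreal ((L * square_norm m \<phi>)\<^sup>2)" .
  qed
  with c(1) L show ?thesis by blast
qed

text \<open>
  Along the isomorphism the norm of the random sum is comparable to the norm of a random tuple, and its
  \<open>L\<^sup>2\<close> norm lies between multiples of the same square norm for every orthonormal system.
\<close>
theorem isomorphic_n_good:
  assumes "isomorphic_with_subspace (type_nspace :: 'x::real_normed_vector nspace) Y"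
  shows "n_good M W n TYPE('x)"
proof -
  obtain Z T T' where Z: "Z \<subseteq> vcarrier Y"
    and T: "bounded_linear_op (type_nspace :: 'x nspace) (Y\<lparr>vcarrier := Z\<rparr>) T"
    and T': "bounded_linear_op (Y\<lparr>vcarrier := Z\<rparr>) (type_nspace :: 'x nspace) T'"
    and inv: "\<forall>x\<in>vcarrier (type_nspace :: 'x nspace). T' (T x) = x"
    using assms unfolding isomorphic_with_subspace_def nspace_isomorphic_def linear_subspace_of_def by blast
  have T'T: "T' (T x) = x" for x using inv by (simp add: type_nspace_def)
  have TZ: "T x \<in> Z" for x using T by (simp add: bounded_linear_op_def type_nspace_def)
  obtain K0 where K0: "\<And>x. vnorm Y (T x) \<le> K0 * norm x"
    using T by (auto simp: bounded_linear_op_def type_nspace_def)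
  obtain K1 where K1: "\<And>y. y \<in> Z \<Longrightarrow> norm (T' y) \<le> K1 * vnorm Y y"
  proof -
    have "\<exists>K. \<forall>y\<in>Z. norm (T' y) \<le> K * vnorm Y y"
      using T' by (simp add: bounded_linear_op_def type_nspace_def)
    then show ?thesis using that by blast
  qed
  have "\<exists>\<phi>. \<phi> \<in> tuples \<and> T x = tclass \<phi>" for x
  proof -
    have "T x \<in> vcarrier Y" using TZ[of x] Z by blast
    then obtain \<phi> where "\<phi> \<in> tuples" "T x = tclass \<phi>" by (rule carrier_tclass)
    then show ?thesis by blast
  qed
  then obtain rp where rp: "\<And>x. rp x \<in> tuples" "\<And>x. T x = tclass (rp x)" by metis
  define K where "K = max K0 1"
  define L where "L = max K1 1"
  have KL: "0 < K" "0 < L" by (auto simp: K_def L_def)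
  have upT: "tnorm \<phi> \<le> K * norm x" and loT: "norm x \<le> L * tnorm \<phi>" if "T x = tclass \<phi>" "\<phi> \<in> tuples" for x \<phi>
  proof -
    have n: "vnorm Y (T x) = tnorm \<phi>" using that by (simp add: tclass_norm)
    have "tnorm \<phi> \<le> K0 * norm x" using K0[of x] n by simp
    also have "\<dots> \<le> K * norm x" by (intro mult_right_mono) (auto simp: K_def)
    finally show "tnorm \<phi> \<le> K * norm x" .
    have "norm x \<le> K1 * tnorm \<phi>" using K1[OF TZ[of x]] T'T[of x] n by simp
    also have "\<dots> \<le> L * tnorm \<phi>" by (intro mult_right_mono) (auto simp: L_def)
    finally show "norm x \<le> L * tnorm \<phi>" .
  qed
  obtain c C where c: "0 < c" and C: "0 < C" and cC: "equivalence_constants n c C"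
    using square_norm_equivalence[of n] by blast
  have two_sided: "c * square_norm m (\<lambda>k. rp (x k)) \<le> K * L2_norm M (\<lambda>w. \<Sum>k=1..m. e k w *\<^sub>R x k) \<and>
      L2_norm M (\<lambda>w. \<Sum>k=1..m. e k w *\<^sub>R x k) \<le> L * C * square_norm m (\<lambda>k. rp (x k))"
    if on: "L2_orthonormal M m e" and e: "\<And>k. k \<in> {1..m} \<Longrightarrow> e k \<in> wiener_chaos_sum M W n" for m e and x :: "nat \<Rightarrow> 'x"
  proof -
    let ?X = "\<lambda>w. \<Sum>k=1..m. e k w *\<^sub>R x k"
    let ?F = "\<lambda>w i z. \<Sum>k=1..m. e k w * rp (x k) i z"
    define g where "g = square_norm m (\<lambda>k. rp (x k))"
    have g0: "0 \<le> g" by (simp add: g_def square_norm_def)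
    have sqe: "ennreal (c * g) \<le> (\<integral>\<^sup>+w. ennreal (tnorm (?F w)) \<partial>M)"
      "(\<integral>\<^sup>+w. ennreal ((tnorm (?F w))\<^sup>2) \<partial>M) \<le> ennreal ((C * g)\<^sup>2)"
      and mF: "\<And>i. i \<in> I \<Longrightarrow> (\<lambda>w. MNi i (?F w i)) \<in> borel_measurable M"
      unfolding g_def by (rule equivalence_constantsD[OF cC on e rp(1)]; assumption)+
    have em: "e k \<in> borel_measurable M" if "k \<in> {1..m}" for k
      using e that wiener_chaos_sum_subset[of n] by (auto simp: chaos_closure_def sq_integrable_def)
    have mX [measurable]: "(\<lambda>w. norm (?X w)) \<in> borel_measurable M" by (rule measurable_norm_random_sum[OF em])
    have [measurable]: "(\<lambda>w. tnorm (?F w)) \<in> borel_measurable M"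
      unfolding tnorm_def using mF by (intro borel_measurable_sum) auto
    have TX: "T (?X w) = tclass (?F w)" for w
      using rp by (intro linear_into_Y_sum[OF T _ _ _ rp(2)[of 0] rp(1)[of 0]]) auto
    have Ft: "?F w \<in> tuples" for w using rp(1) by (intro tuples_sum)
    have "(\<integral>\<^sup>+w. ennreal ((norm (?X w))\<^sup>2) \<partial>M) \<le> (\<integral>\<^sup>+w. ennreal (L\<^sup>2) * ennreal ((tnorm (?F w))\<^sup>2) \<partial>M)"
      using loT[OF TX Ft] by (intro nn_integral_mono) (simp add: ennreal_mult[symmetric] power_mult_distrib[symmetric] ennreal_leI power_mono)
    also have "\<dots> = ennreal (L\<^sup>2) * (\<integral>\<^sup>+w. ennreal ((tnorm (?F w))\<^sup>2) \<partial>M)" by (rule nn_integral_cmult) measurable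
    also have "\<dots> \<le> ennreal (L\<^sup>2) * ennreal ((C * g)\<^sup>2)" by (intro mult_left_mono sqe) auto
    also have "\<dots> = ennreal ((L * C * g)\<^sup>2)"
      by (simp add: ennreal_mult[symmetric] power_mult_distrib mult.assoc)
    finally have up: "(\<integral>\<^sup>+w. ennreal ((norm (?X w))\<^sup>2) \<partial>M) \<le> ennreal ((L * C * g)\<^sup>2)" .
    also have "\<dots> < \<infinity>" by simp
    finally have "integrable M (\<lambda>w. (norm (?X w))\<^sup>2)"
      by (intro integrableI_bounded borel_measurable_power mX) simp
    then have A: "(\<integral>\<^sup>+w. ennreal ((norm (?X w))\<^sup>2) \<partial>M) = ennreal ((L2_norm M ?X)\<^sup>2)"
      by (subst nn_integral_eq_integral) (auto simp: L2_norm_def)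
    have A0: "0 \<le> L2_norm M ?X" by (simp add: L2_norm_def)
    have "(L2_norm M ?X)\<^sup>2 \<le> (L * C * g)\<^sup>2" using up unfolding A by simp
    then have 1: "L2_norm M ?X \<le> L * C * g" by (rule power2_le_imp_le) (use KL C g0 in simp)
    have "ennpowr (\<integral>\<^sup>+w. ennreal (norm (?X w)) * 1 \<partial>M) 2 \<le> (\<integral>\<^sup>+w. ennpowr (ennreal (norm (?X w))) 2 * 1 \<partial>M)"
      by (intro power_mean measurable_compose[OF mX measurable_ennreal]) (simp_all add: emeasure_space_1)
    also have "\<dots> = ennreal ((L2_norm M ?X)\<^sup>2)"
      unfolding A[symmetric] by (simp add: ennpowr_ennreal)
    finally have "ennpowr (ennpowr (\<integral>\<^sup>+w. ennreal (norm (?X w)) \<partial>M) 2) (1 / 2) \<le> ennpowr (ennreal ((L2_norm M ?X)\<^sup>2)) (1 / 2)"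
      by (intro ennpowr_mono) auto
    then have X1: "(\<integral>\<^sup>+w. ennreal (norm (?X w)) \<partial>M) \<le> ennreal (L2_norm M ?X)"
      using A0 by (simp add: ennpowr_ennpowr ennpowr_ennreal powr_half_sqrt)
    have "ennreal (c * g) \<le> (\<integral>\<^sup>+w. ennreal K * ennreal (norm (?X w)) \<partial>M)"
      using upT[OF TX Ft] KL
      by (intro order_trans[OF sqe(1)] nn_integral_mono) (simp add: ennreal_mult[symmetric] ennreal_leI)
    also have "\<dots> = ennreal K * (\<integral>\<^sup>+w. ennreal (norm (?X w)) \<partial>M)" by (rule nn_integral_cmult) measurable
    also have "\<dots> \<le> ennreal K * ennreal (L2_norm M ?X)" by (intro mult_left_mono X1) auto
    also have "\<dots> = ennreal (K * L2_norm M ?X)" using KL A0 by (simp add: ennreal_mult)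
    finally have "c * g \<le> K * L2_norm M ?X" using KL A0 by (subst (asm) ennreal_le_iff) auto
    with 1 show ?thesis by (simp add: g_def)
  qed
  define q where "q = K * (L * C) / c"
  have q: "0 < q" using KL C c by (simp add: q_def)
  have compare: "L2_norm M (\<lambda>w. \<Sum>k=1..m. e w k *\<^sub>R x k) \<le> q * L2_norm M (\<lambda>w. \<Sum>k=1..m. e' w k *\<^sub>R x k)"
    if "L2_orthonormal M m (\<lambda>k w. e w k)" "\<And>k. k \<in> {1..m} \<Longrightarrow> (\<lambda>w. e w k) \<in> wiener_chaos_sum M W n"
      "L2_orthonormal M m (\<lambda>k w. e' w k)" "\<And>k. k \<in> {1..m} \<Longrightarrow> (\<lambda>w. e' w k) \<in> wiener_chaos_sum M W n"
    for m e e' and x :: "nat \<Rightarrow> 'x"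
  proof -
    let ?g = "square_norm m (\<lambda>k. rp (x k))"
    have "L2_norm M (\<lambda>w. \<Sum>k=1..m. e w k *\<^sub>R x k) \<le> L * C / c * (c * ?g)"
      using two_sided[OF that(1,2), of x] c by simp
    also have "\<dots> \<le> L * C / c * (K * L2_norm M (\<lambda>w. \<Sum>k=1..m. e' w k *\<^sub>R x k))"
      using two_sided[OF that(3,4), of x] KL C c by (intro mult_left_mono) auto
    finally show ?thesis by (simp add: q_def mult_ac)
  qed
  show ?thesis
    unfolding n_good_def
  proof (rule exI[of _ "1 / q"], rule conjI, simp add: q, rule exI[of _ q], rule conjI[OF q], intro conjI allI impI)
    fix m e1 e2 and x :: "nat \<Rightarrow> 'x"
    assume h: "L2_orthonormal M m e1 \<and> L2_orthonormal M m e2 \<and>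
        (\<forall>k\<in>{1..m}. e1 k \<in> wiener_chaos_sum M W n \<and> e2 k \<in> wiener_chaos_sum M W n)"
    show "L2_norm M (\<lambda>w. \<Sum>k=1..m. e1 k w *\<^sub>R x k) \<le> q * L2_norm M (\<lambda>w. \<Sum>k=1..m. e2 k w *\<^sub>R x k)"
      using compare[of m "\<lambda>w k. e1 k w" "\<lambda>w k. e2 k w" x] h by simp
    have "L2_norm M (\<lambda>w. \<Sum>k=1..m. e2 k w *\<^sub>R x k) \<le> q * L2_norm M (\<lambda>w. \<Sum>k=1..m. e1 k w *\<^sub>R x k)"
      using compare[of m "\<lambda>w k. e2 k w" "\<lambda>w k. e1 k w" x] h by simp
    then show "1 / q * L2_norm M (\<lambda>w. \<Sum>k=1..m. e2 k w *\<^sub>R x k) \<le> L2_norm M (\<lambda>w. \<Sum>k=1..m. e1 k w *\<^sub>R x k)"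
      using q by (simp add: field_simps)
  qed
qed

end

section \<open>Density of rectangles\<close>

context mixed
begin

lemma MN_tendsto_0:
  assumes u: "\<And>i. u i \<in> borel_measurable \<MM>" and g: "g \<in> MF"
    and le: "\<And>i z. z \<in> space \<MM> \<Longrightarrow> \<bar>u i z\<bar> \<le> \<bar>g z\<bar>"
    and lim: "\<And>z. z \<in> space \<MM> \<Longrightarrow> (\<lambda>i. u i z) \<longlonglongrightarrow> 0"
  shows "(\<lambda>i. MN (u i)) \<longlonglongrightarrow> 0"
proof -
  note [measurable] = u mixed_fun_measurable[OF g]
  have uMF: "u i \<in> MF" for i by (rule mixed_fun_bound(1)[OF g u]) (auto intro: AE_I2 le)
  have "(\<lambda>i. EN (\<lambda>z. ennreal \<bar>u i z\<bar>)) \<longlonglongrightarrow> 0"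
  proof (rule EN_tendsto_0[where v="\<lambda>z. ennreal \<bar>g z\<bar>"])
    show "EN (\<lambda>z. ennreal \<bar>g z\<bar>) < \<infinity>" using g by (simp only: mixed_fun_iff)
    fix z assume "z \<in> space \<MM>"
    from tendsto_ennrealI[OF tendsto_rabs[OF lim[OF this]]]
    show "(\<lambda>i. ennreal \<bar>u i z\<bar>) \<longlonglongrightarrow> 0" by simp
  qed (auto intro: ennreal_leI le)
  then have "(\<lambda>i. ennreal (MN (u i))) \<longlonglongrightarrow> ennreal 0"
    by (simp add: MN_eq_EN[OF uMF])
  then show ?thesis by (subst (asm) tendsto_ennreal_iff) auto
qed

lemma EN_rectangle:
  assumes [measurable]: "A \<in> sets M1" "B \<in> sets M2"
  shows "EN (indicator (A \<times> B)) = ennpowr (emeasure M1 A) (1 / p1) * ennpowr (emeasure M2 B) (1 / p2)"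
proof -
  have ind: "ennpowr (indicator S w) q = indicator S w" for S :: "'c set" and w q
    by (simp add: indicator_def)
  have "EN (indicator (A \<times> B)) = ennpowr (\<integral>\<^sup>+x. ennpowr (\<integral>\<^sup>+y. indicator A x * indicator B y \<partial>M2) (p1 / p2) \<partial>M1) (1 / p1)"
    by (simp add: enorm_mixed_def emixed_def ind indicator_times ennpowr_mult)
  also have "(\<integral>\<^sup>+x. ennpowr (\<integral>\<^sup>+y. indicator A x * indicator B y \<partial>M2) (p1 / p2) \<partial>M1)
      = (\<integral>\<^sup>+x. ennpowr (emeasure M2 B) (p1 / p2) * indicator A x \<partial>M1)"
    by (intro nn_integral_cong) (simp add: nn_integral_cmult ennpowr_mult ind mult.commute)
  also have "\<dots> = ennpowr (emeasure M2 B) (p1 / p2) * emeasure M1 A"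
    by (subst nn_integral_cmult) auto
  also have "ennpowr \<dots> (1 / p1) = ennpowr (emeasure M1 A) (1 / p1) * ennpowr (emeasure M2 B) (1 / p2)"
    using p1 by (simp add: ennpowr_mult ennpowr_ennpowr mult.commute)
  finally show ?thesis .
qed

lemma rectangle_mixed_fun:
  assumes [measurable]: "A \<in> sets M1" "B \<in> sets M2" and fin: "emeasure M1 A < \<infinity>" "emeasure M2 B < \<infinity>"
  shows "indicator (A \<times> B) \<in> MF"
proof -
  have "EN (\<lambda>z. ennreal \<bar>indicator (A \<times> B) z\<bar>) = EN (indicator (A \<times> B))"
    by (simp add: ennreal_indicator)
  also have "\<dots> < \<infinity>"
    unfolding EN_rectangle[OF assms(1,2)] using fin by (simp add: ennreal_mult_less_top)
  finally show ?thesis unfolding mixed_fun_iff by (auto intro: borel_measurable_indicator)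
qed

text \<open>Linear combinations of rectangles with sides of finite measure.\<close>
inductive rect_simple :: "('a \<times> 'b \<Rightarrow> real) \<Rightarrow> bool" where
  zero: "rect_simple (\<lambda>z. 0)"
| rect: "A \<in> sets M1 \<Longrightarrow> B \<in> sets M2 \<Longrightarrow> emeasure M1 A < \<infinity> \<Longrightarrow> emeasure M2 B < \<infinity> \<Longrightarrow>
    rect_simple s \<Longrightarrow> rect_simple (\<lambda>z. c * indicator (A \<times> B) z + s z)"

lemma rect_simple_mixed_fun: "rect_simple s \<Longrightarrow> s \<in> MF"
proof (induction rule: rect_simple.induct)
  case (rect A B s c)
  then show ?case by (intro mixed_fun_add(1) mixed_fun_cmult(1) rectangle_mixed_fun)
qed simp

lemma rect_simple_add: "rect_simple s \<Longrightarrow> rect_simple t \<Longrightarrow> rect_simple (\<lambda>z. s z + t z)"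
proof (induction rule: rect_simple.induct)
  case (rect A B s c)
  then show ?case using rect_simple.rect[of A B "\<lambda>z. s z + t z" c] by (simp add: add.assoc)
qed simp

lemma rect_simple_cmult: "rect_simple s \<Longrightarrow> rect_simple (\<lambda>z. c * s z)"
proof (induction rule: rect_simple.induct)
  case (rect A B s d)
  then show ?case using rect_simple.rect[of A B "\<lambda>z. c * s z" "c * d"] by (simp add: distrib_left mult.assoc)
qed (simp add: rect_simple.zero)

definition approximable :: "('a \<times> 'b \<Rightarrow> real) \<Rightarrow> bool" where
  "approximable f \<longleftrightarrow> f \<in> MF \<and> (\<forall>e>0. \<exists>s. rect_simple s \<and> MN (\<lambda>z. f z - s z) < e)"

lemma approximable_rect_simple: "rect_simple s \<Longrightarrow> approximable s"
  unfolding approximable_def by (auto intro!: rect_simple_mixed_fun exI[of _ s])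

lemma approximable_add:
  assumes f: "approximable f" and g: "approximable g"
  shows "approximable (\<lambda>z. f z + g z)"
proof -
  have MF: "f \<in> MF" "g \<in> MF" using f g by (auto simp: approximable_def)
  have "\<exists>s. rect_simple s \<and> MN (\<lambda>z. f z + g z - s z) < e" if e: "0 < e" for e
  proof -
    have e2: "0 < e / 2" using e by simp
    obtain s where s: "rect_simple s" "MN (\<lambda>z. f z - s z) < e / 2" using f e2 unfolding approximable_def by blast
    obtain t where t: "rect_simple t" "MN (\<lambda>z. g z - t z) < e / 2" using g e2 unfolding approximable_def by blast
    have "MN (\<lambda>z. (f z - s z) + (g z - t z)) \<le> MN (\<lambda>z. f z - s z) + MN (\<lambda>z. g z - t z)"
      by (intro mixed_fun_add(2) mixed_fun_diff MF rect_simple_mixed_fun s t)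
    also have "\<dots> < e" using s t by simp
    finally show ?thesis using rect_simple_add[OF s(1) t(1)]
      by (intro exI[of _ "\<lambda>z. s z + t z"]) (simp add: algebra_simps)
  qed
  then show ?thesis using MF by (simp add: approximable_def mixed_fun_add(1))
qed

lemma approximable_cmult:
  assumes f: "approximable f"
  shows "approximable (\<lambda>z. c * f z)"
proof -
  have MF: "f \<in> MF" using f by (auto simp: approximable_def)
  have "\<exists>s. rect_simple s \<and> MN (\<lambda>z. c * f z - s z) < e" if e: "0 < e" for e
  proof -
    have e2: "0 < e / (\<bar>c\<bar> + 1)" using e by simp
    obtain s where s: "rect_simple s" "MN (\<lambda>z. f z - s z) < e / (\<bar>c\<bar> + 1)" using f e2 unfolding approximable_def by blast
    have "MN (\<lambda>z. c * (f z - s z)) = \<bar>c\<bar> * MN (\<lambda>z. f z - s z)"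
      by (intro mixed_fun_cmult(2) mixed_fun_diff MF rect_simple_mixed_fun s)
    also have "\<dots> \<le> MN (\<lambda>z. f z - s z) * (\<bar>c\<bar> + 1)" by (simp add: algebra_simps)
    also have "\<dots> < e" using s(2) by (subst (asm) pos_less_divide_eq) auto
    finally show ?thesis using rect_simple_cmult[OF s(1), of c]
      by (intro exI[of _ "\<lambda>z. c * s z"]) (simp add: right_diff_distrib)
  qed
  then show ?thesis using MF by (simp add: approximable_def mixed_fun_cmult(1))
qed

lemma approximable_sum: "(\<And>k. k \<in> K \<Longrightarrow> approximable (f k)) \<Longrightarrow> approximable (\<lambda>z. \<Sum>k\<in>K. f k z)"
  by (induction K rule: infinite_finite_induct)
     (auto intro: approximable_add approximable_rect_simple rect_simple.zero)

lemma approximable_limit: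
  assumes f: "f \<in> MF" and u: "\<And>i. approximable (u i)" and lim: "(\<lambda>i. MN (\<lambda>z. f z - u i z)) \<longlonglongrightarrow> 0"
  shows "approximable f"
proof -
  have "\<exists>s. rect_simple s \<and> MN (\<lambda>z. f z - s z) < e" if e: "0 < e" for e
  proof -
    have e2: "0 < e / 2" using e by simp
    from order_tendstoD(2)[OF lim e2] obtain i where i: "MN (\<lambda>z. f z - u i z) < e / 2"
      by (auto simp: eventually_sequentially)
    obtain s where s: "rect_simple s" "MN (\<lambda>z. u i z - s z) < e / 2" using u[of i] e2 unfolding approximable_def by blast
    have uMF: "u i \<in> MF" using u[of i] by (simp add: approximable_def)
    have "MN (\<lambda>z. (f z - u i z) + (u i z - s z)) \<le> MN (\<lambda>z. f z - u i z) + MN (\<lambda>z. u i z - s z)"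
      by (intro mixed_fun_add(2) mixed_fun_diff f uMF rect_simple_mixed_fun s)
    also have "\<dots> < e" using s i by simp
    finally show ?thesis using s(1) by auto
  qed
  then show ?thesis using f by (simp add: approximable_def)
qed

text \<open>
  The sets with this property form a Dynkin system that contains the measurable rectangles.  Intersecting with
  \<open>A \<times> B\<close> provides the dominating function for countable unions.
\<close>
lemma approximable_indicator:
  assumes C: "C \<in> sets \<MM>" and A: "A \<in> sets M1" "emeasure M1 A < \<infinity>" and B: "B \<in> sets M2" "emeasure M2 B < \<infinity>"
  shows "approximable (indicator (C \<inter> A \<times> B))"
proof -
  let ?G = "{a \<times> b |a b. a \<in> sets M1 \<and> b \<in> sets M2}"
  have ABm [measurable]: "A \<times> B \<in> sets \<MM>" using A B by simp
  have AB: "approximable (indicator (A \<times> B))"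
    using rect_simple.rect[OF A(1) B(1) A(2) B(2) rect_simple.zero, of 1] by (simp add: approximable_rect_simple)
  have "C \<in> sigma_sets (space M1 \<times> space M2) ?G" using C by (simp add: sets_pair_measure)
  then show ?thesis
  proof (induction rule: sigma_sets_induct_disjoint[OF Int_stable_pair_measure_generator pair_measure_closed, consumes 1, case_names basic empty compl union])
    case (basic D)
    then obtain a b where D: "D = a \<times> b" "a \<in> sets M1" "b \<in> sets M2" by blast
    have "D \<inter> A \<times> B = (a \<inter> A) \<times> (b \<inter> B)" using D by auto
    moreover have "rect_simple (\<lambda>z. 1 * indicator ((a \<inter> A) \<times> (b \<inter> B)) z + 0)"
    proof (rule rect_simple.rect[OF _ _ _ _ rect_simple.zero])
      show "emeasure M1 (a \<inter> A) < \<infinity>"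
        by (rule le_less_trans[OF emeasure_mono A(2)]) (use A in auto)
      show "emeasure M2 (b \<inter> B) < \<infinity>"
        by (rule le_less_trans[OF emeasure_mono B(2)]) (use B in auto)
    qed (use D A B in auto)
    ultimately show ?case by (simp add: approximable_rect_simple)
  next
    case empty
    show ?case using approximable_rect_simple[OF rect_simple.zero] by simp
  next
    case (compl D)
    have "approximable (\<lambda>z. indicator (A \<times> B) z + (- 1) * indicator (D \<inter> A \<times> B) z)"
      by (intro approximable_add AB approximable_cmult compl)
    moreover have "(\<lambda>z. indicator (A \<times> B) z + (- 1) * indicator (D \<inter> A \<times> B) z)
        = (indicator ((space M1 \<times> space M2 - D) \<inter> A \<times> B) :: _ \<Rightarrow> real)"
      using sets.sets_into_space[OF A(1)] sets.sets_into_space[OF B(1)] by (auto simp: fun_eq_iff indicator_def)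
    ultimately show ?case by simp
  next
    case (union D)
    have Dm [measurable]: "D i \<in> sets \<MM>" for i
      using union(2) unfolding sets_pair_measure by blast
    let ?u = "\<lambda>i z. \<Sum>j<i. indicator (D j \<inter> A \<times> B) z :: real"
    have u_eq: "?u i z = indicator ((\<Union>j<i. D j) \<inter> A \<times> B) z" for i z
    proof -
      have "indicator (\<Union>j<i. D j \<inter> A \<times> B) z = ?u i z"
        by (rule indicator_UN_disjoint) (use union(1) in \<open>auto simp: disjoint_family_on_def\<close>)
      moreover have "(\<Union>j<i. D j \<inter> A \<times> B) = (\<Union>j<i. D j) \<inter> A \<times> B" by blast
      ultimately show ?thesis by (simp only:)
    qed
    have AB_MF: "indicator (A \<times> B) \<in> MF" using AB by (simp add: approximable_def)
    have ind_MF: "indicator ((\<Union>i. D i) \<inter> A \<times> B) \<in> MF"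
      by (rule mixed_fun_bound(1)[OF AB_MF], measurable, rule AE_I2) (simp add: indicator_def)
    show ?case
    proof (rule approximable_limit[OF ind_MF])
      show "approximable (?u i)" for i by (intro approximable_sum union)
      show "(\<lambda>i. MN (\<lambda>z. indicator ((\<Union>i. D i) \<inter> A \<times> B) z - ?u i z)) \<longlonglongrightarrow> 0"
      proof (rule MN_tendsto_0[OF _ AB_MF])
        show "(\<lambda>z. indicator ((\<Union>i. D i) \<inter> A \<times> B) z - ?u i z) \<in> borel_measurable \<MM>" for i by measurable
        show "\<bar>indicator ((\<Union>i. D i) \<inter> A \<times> B) z - ?u i z\<bar> \<le> \<bar>indicator (A \<times> B) z\<bar>" for i z
          unfolding u_eq by (auto simp: indicator_def)
        show "(\<lambda>i. indicator ((\<Union>i. D i) \<inter> A \<times> B) z - ?u i z) \<longlonglongrightarrow> 0" for z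
        proof (cases "\<exists>k. z \<in> D k")
          case True
          then obtain k where k: "z \<in> D k" by blast
          have "eventually (\<lambda>i. indicator ((\<Union>i. D i) \<inter> A \<times> B) z - ?u i z = 0) sequentially"
            using eventually_gt_at_top[of k]
          proof eventually_elim
            case (elim i)
            then have "z \<in> (\<Union>j<i. D j)" using k by blast
            then show ?case unfolding u_eq using k by (auto simp: indicator_def)
          qed
          then show ?thesis by (rule tendsto_eventually)
        next
          case False
          then have "indicator ((\<Union>i. D i) \<inter> A \<times> B) z - ?u i z = 0" for i
            unfolding u_eq by (auto simp: indicator_def)
          then show ?thesis by simp
        qed
      qed
    qed
  qed
qed

text \<open>Restricting to an exhaustion by rectangles of finite measure reduces to indicators.\<close>
lemma approximable_simple:
  assumes s: "simple_function \<MM> s" and sMF: "s \<in> MF"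
  shows "approximable s"
proof -
  obtain A :: "nat \<Rightarrow> 'a set" where A: "range A \<subseteq> sets M1" "(\<Union>i. A i) = space M1" "\<And>i. emeasure M1 (A i) \<noteq> \<infinity>" "incseq A"
    using M1.sigma_finite_incseq by blast
  obtain B :: "nat \<Rightarrow> 'b set" where B: "range B \<subseteq> sets M2" "(\<Union>i. B i) = space M2" "\<And>i. emeasure M2 (B i) \<noteq> \<infinity>" "incseq B"
    using M2.sigma_finite_incseq by blast
  have Am [measurable]: "A i \<in> sets M1" and Bm [measurable]: "B i \<in> sets M2" for i using A(1) B(1) by auto
  have fin: "emeasure M1 (A i) < \<infinity>" "emeasure M2 (B i) < \<infinity>" for i
    using A(3)[of i] B(3)[of i] by (simp_all add: less_top)
  let ?E = "\<lambda>c. s -` {c} \<inter> space \<MM>"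
  let ?u = "\<lambda>n z. s z * indicator (A n \<times> B n) z"
  have sm [measurable]: "s \<in> borel_measurable \<MM>" using sMF by (rule mixed_fun_measurable)
  have u_eq: "?u n = (\<lambda>z. \<Sum>c\<in>s ` space \<MM>. c * indicator (?E c \<inter> A n \<times> B n) z)" for n
  proof
    fix z
    show "?u n z = (\<Sum>c\<in>s ` space \<MM>. c * indicator (?E c \<inter> A n \<times> B n) z)"
    proof (cases "z \<in> A n \<times> B n")
      case True
      then have z: "z \<in> space \<MM>"
        using sets.sets_into_space[OF Am[of n]] sets.sets_into_space[OF Bm[of n]] by (auto simp: space_pair_measure)
      have "(\<Sum>c\<in>s ` space \<MM>. c * indicator (?E c \<inter> A n \<times> B n) z) = (\<Sum>c\<in>s ` space \<MM>. if c = s z then s z else 0)"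
        using True z by (intro sum.cong) (auto simp: indicator_def)
      also have "\<dots> = s z" using z simple_functionD(1)[OF s] by simp
      finally show ?thesis using True by simp
    qed (simp add: indicator_def)
  qed
  show ?thesis
  proof (rule approximable_limit[OF sMF])
    fix n
    have "?E c \<in> sets \<MM>" for c using simple_functionD(2)[OF s] .
    then show "approximable (?u n)"
      unfolding u_eq by (intro approximable_sum approximable_cmult approximable_indicator Am Bm fin)
  next
    show "(\<lambda>n. MN (\<lambda>z. s z - ?u n z)) \<longlonglongrightarrow> 0"
    proof (rule MN_tendsto_0[OF _ sMF])
      show "(\<lambda>z. s z - ?u n z) \<in> borel_measurable \<MM>" for n by measurable
      show "\<bar>s z - ?u n z\<bar> \<le> \<bar>s z\<bar>" for n z by (simp add: indicator_def)
      fix z assume "z \<in> space \<MM>"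
      then have "fst z \<in> (\<Union>i. A i)" "snd z \<in> (\<Union>i. B i)" using A(2) B(2) by (auto simp: space_pair_measure)
      then obtain i j where ij: "fst z \<in> A i" "snd z \<in> B j" by blast
      have "eventually (\<lambda>n. s z - ?u n z = 0) sequentially"
        using eventually_ge_at_top[of "max i j"]
      proof eventually_elim
        case (elim n)
        then have "fst z \<in> A n" "snd z \<in> B n"
          using ij incseqD[OF A(4), of i n] incseqD[OF B(4), of j n] by auto
        then have "z \<in> A n \<times> B n" by (simp add: mem_Times_iff)
        then show ?case by simp
      qed
      then show "(\<lambda>n. s z - ?u n z) \<longlonglongrightarrow> 0" by (rule tendsto_eventually)
    qed
  qed
qed

theorem rect_simple_dense:
  assumes f: "f \<in> MF" and e: "0 < e"
  obtains s where "rect_simple s" "MN (\<lambda>z. f z - s z) < e"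
proof -
  have fm [measurable]: "f \<in> borel_measurable \<MM>" using f by (rule mixed_fun_measurable)
  obtain F where F: "\<And>i. simple_function \<MM> (F i)" "\<And>z. z \<in> space \<MM> \<Longrightarrow> (\<lambda>i. F i z) \<longlonglongrightarrow> f z"
    "\<And>i z. z \<in> space \<MM> \<Longrightarrow> dist (F i z) 0 \<le> 2 * dist (f z) 0"
    using borel_measurable_implies_sequence_metric[OF fm, of 0] by blast
  have Fm [measurable]: "F i \<in> borel_measurable \<MM>" for i using F(1) by (rule borel_measurable_simple_function)
  have FMF: "F i \<in> MF" for i
    using F(3)[of _ i] by (intro mixed_fun_bound(1)[OF mixed_fun_cmult(1)[OF f, of 2] Fm] AE_I2) (simp add: abs_mult)
  have "approximable f"
  proof (rule approximable_limit[OF f])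
    show "approximable (F i)" for i by (rule approximable_simple[OF F(1) FMF])
    show "(\<lambda>i. MN (\<lambda>z. f z - F i z)) \<longlonglongrightarrow> 0"
    proof (rule MN_tendsto_0[OF _ mixed_fun_cmult(1)[OF f, of 3]])
      show "(\<lambda>z. f z - F i z) \<in> borel_measurable \<MM>" for i by measurable
      fix z assume z: "z \<in> space \<MM>"
      show "\<bar>f z - F i z\<bar> \<le> \<bar>3 * f z\<bar>" for i using F(3)[OF z, of i] by simp
      show "(\<lambda>i. f z - F i z) \<longlonglongrightarrow> 0"
        using tendsto_diff[OF tendsto_const F(2)[OF z], of "f z"] by simp
    qed
  qed
  then show ?thesis using that e by (auto simp: approximable_def)
qed

end

section \<open>Averages over cells\<close>

text \<open>
  A finite partition of a part of the space.  Cells of measure zero are excluded, since averages over them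
  would be meaningless.
\<close>
definition cells :: "'c measure \<Rightarrow> 'c set set \<Rightarrow> bool" where
  "cells M P \<longleftrightarrow> finite P \<and> disjoint P \<and> (\<forall>A\<in>P. A \<in> sets M \<and> 0 < emeasure M A \<and> emeasure M A < \<infinity>)"

text \<open>Up to a null set, every member of the family is a union of cells.\<close>
definition cells_refine :: "'c measure \<Rightarrow> 'c set set \<Rightarrow> 'c set set \<Rightarrow> bool" where
  "cells_refine M P \<A> \<longleftrightarrow> (\<forall>A\<in>\<A>. (\<forall>C\<in>P. C \<subseteq> A \<or> C \<inter> A = {}) \<and> A - \<Union>P \<in> null_sets M)"

text \<open>The integral kernel of the averaging operator in one variable.\<close>
definition cell_kernel :: "'c measure \<Rightarrow> 'c set set \<Rightarrow> 'c \<Rightarrow> 'c \<Rightarrow> ennreal" where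
  "cell_kernel M P x x' = (\<Sum>A\<in>P. indicator A x * indicator A x' * ennreal (1 / measure M A))"

definition cell_average ::
  "'a measure \<Rightarrow> 'b measure \<Rightarrow> 'a set set \<Rightarrow> 'b set set \<Rightarrow> ('a \<times> 'b \<Rightarrow> real) \<Rightarrow> 'a \<times> 'b \<Rightarrow> real" where
  "cell_average M1 M2 P Q f z =
     (\<Sum>A\<in>P. \<Sum>B\<in>Q. (\<integral>w. f w * indicator (A \<times> B) w \<partial>(M1 \<Otimes>\<^sub>M M2)) / (measure M1 A * measure M2 B) * indicator (A \<times> B) z)"

lemma cellsD:
  assumes "cells M P"
  shows "finite P" "disjoint P" "A \<in> P \<Longrightarrow> A \<in> sets M" "A \<in> P \<Longrightarrow> 0 < emeasure M A" "A \<in> P \<Longrightarrow> emeasure M A < \<infinity>"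
  using assms by (auto simp: cells_def)

lemma cells_measure:
  assumes "cells M P" "A \<in> P"
  shows "0 < measure M A" "emeasure M A = ennreal (measure M A)"
proof -
  have A: "emeasure M A \<noteq> \<infinity>" "0 < emeasure M A" using cellsD[OF assms(1)] assms(2) by (auto simp: less_top)
  then show "emeasure M A = ennreal (measure M A)" by (simp add: emeasure_eq_ennreal_measure)
  with A(2) show "0 < measure M A" by simp
qed

lemma cell_kernel_sym: "cell_kernel M P x x' = cell_kernel M P x' x"
  by (simp add: cell_kernel_def mult_ac)

lemma cell_kernel_measurable [measurable]:
  assumes "cells M P"
  shows "(\<lambda>(x, x'). cell_kernel M P x x') \<in> borel_measurable (M \<Otimes>\<^sub>M M)"
proof -
  have [measurable]: "A \<in> P \<Longrightarrow> A \<in> sets M" for A using cellsD[OF assms] by blast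
  show ?thesis unfolding cell_kernel_def by measurable
qed

lemma sum_indicator_disjoint_le_1:
  assumes "finite P" "disjoint P"
  shows "(\<Sum>A\<in>P. indicator A x :: ennreal) \<le> 1"
proof (cases "\<exists>A\<in>P. x \<in> A")
  case True
  then obtain A where A: "A \<in> P" "x \<in> A" by blast
  have "(\<Sum>B\<in>P. indicator B x :: ennreal) = (\<Sum>B\<in>P. if B = A then 1 else 0)"
    using A assms(2) by (intro sum.cong) (auto simp: indicator_def disjoint_def)
  then show ?thesis using A assms(1) by simp
next
  case False
  then have "(\<Sum>A\<in>P. indicator A x :: ennreal) = 0" by (intro sum.neutral) auto
  then show ?thesis by simp
qed

lemma cell_kernel_integral_le_1:
  assumes P: "cells M P"
  shows "(\<integral>\<^sup>+x'. cell_kernel M P x x' \<partial>M) \<le> 1"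
proof -
  have m: "A \<in> sets M" if "A \<in> P" for A using cellsD[OF P] that by blast
  have "(\<integral>\<^sup>+x'. cell_kernel M P x x' \<partial>M) = (\<Sum>A\<in>P. \<integral>\<^sup>+x'. indicator A x * ennreal (1 / measure M A) * indicator A x' \<partial>M)"
    unfolding cell_kernel_def using m by (subst nn_integral_sum) (auto simp: mult_ac)
  also have "\<dots> = (\<Sum>A\<in>P. indicator A x)"
  proof (intro sum.cong refl)
    fix A assume A: "A \<in> P"
    have "(\<integral>\<^sup>+x'. indicator A x * ennreal (1 / measure M A) * indicator A x' \<partial>M) = indicator A x * (ennreal (1 / measure M A) * ennreal (measure M A))"
      using m[OF A] cells_measure(2)[OF P A] by (subst nn_integral_cmult_indicator) (auto simp: mult.assoc)
    also have "ennreal (1 / measure M A) * ennreal (measure M A) = 1"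
      using cells_measure(1)[OF P A] by (simp add: ennreal_mult[symmetric])
    finally show "(\<integral>\<^sup>+x'. indicator A x * ennreal (1 / measure M A) * indicator A x' \<partial>M) = indicator A x" by simp
  qed
  also have "\<dots> \<le> 1" using cellsD[OF P] by (intro sum_indicator_disjoint_le_1)
  finally show ?thesis .
qed

text \<open>
  Jensen's inequality in the variable of integration, followed by Fubini and the symmetry of the kernel.
\<close>
lemma kernel_contraction:
  assumes "sigma_finite_measure M" and [measurable]: "(\<lambda>(x, x'). k x x') \<in> borel_measurable (M \<Otimes>\<^sub>M M)"
    and k: "\<And>x. (\<integral>\<^sup>+x'. k x x' \<partial>M) \<le> 1" "\<And>x x'. k x x' = k x' x" and q: "1 \<le> q"
    and [measurable]: "u \<in> borel_measurable M"
  shows "(\<integral>\<^sup>+x. ennpowr (\<integral>\<^sup>+x'. u x' * k x x' \<partial>M) q \<partial>M) \<le> (\<integral>\<^sup>+x. ennpowr (u x) q \<partial>M)"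
proof -
  interpret M: sigma_finite_measure M by fact
  interpret MM: pair_sigma_finite M M ..
  have "(\<integral>\<^sup>+x. ennpowr (\<integral>\<^sup>+x'. u x' * k x x' \<partial>M) q \<partial>M) \<le> (\<integral>\<^sup>+x. (\<integral>\<^sup>+x'. ennpowr (u x') q * k x x' \<partial>M) \<partial>M)"
    using q k(1) by (intro nn_integral_mono power_mean) auto
  also have "\<dots> = (\<integral>\<^sup>+x'. (\<integral>\<^sup>+x. ennpowr (u x') q * k x x' \<partial>M) \<partial>M)"
    by (rule MM.Fubini'[symmetric]) measurable
  also have "\<dots> = (\<integral>\<^sup>+x'. ennpowr (u x') q * (\<integral>\<^sup>+x. k x' x \<partial>M) \<partial>M)"
  proof (intro nn_integral_cong)
    fix x' assume "x' \<in> space M"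
    then have [measurable]: "k x' \<in> borel_measurable M"
      using measurable_Pair2[OF assms(2), of x'] by simp
    have "(\<integral>\<^sup>+x. ennpowr (u x') q * k x x' \<partial>M) = (\<integral>\<^sup>+x. ennpowr (u x') q * k x' x \<partial>M)"
      by (simp only: k(2)[of _ x'])
    also have "\<dots> = ennpowr (u x') q * (\<integral>\<^sup>+x. k x' x \<partial>M)"
      by (rule nn_integral_cmult) measurable
    finally show "(\<integral>\<^sup>+x. ennpowr (u x') q * k x x' \<partial>M) = ennpowr (u x') q * (\<integral>\<^sup>+x. k x' x \<partial>M)" .
  qed
  also have "\<dots> \<le> (\<integral>\<^sup>+x'. ennpowr (u x') q * 1 \<partial>M)"
    using k(1) by (intro nn_integral_mono mult_left_mono) auto
  finally show ?thesis by simp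
qed

definition finite_measure_family :: "'c measure \<Rightarrow> 'c set set \<Rightarrow> bool" where
  "finite_measure_family M \<A> \<longleftrightarrow> finite \<A> \<and> (\<forall>A\<in>\<A>. A \<in> sets M \<and> emeasure M A < \<infinity>)"

lemma finite_measure_family_UN:
  "finite K \<Longrightarrow> (\<And>k. k \<in> K \<Longrightarrow> finite_measure_family M (\<A> k)) \<Longrightarrow> finite_measure_family M (\<Union>k\<in>K. \<A> k)"
  unfolding finite_measure_family_def by blast

text \<open>
  The cells are the atoms of the algebra generated by the family, except those outside all its members, whose
  measure may be infinite, and those of measure zero.
\<close>
lemma ex_refining_cells:
  assumes "finite_measure_family M \<A>"
  shows "\<exists>P. cells M P \<and> cells_refine M P \<A>"
proof -
  have assms: "finite \<A>" "\<And>A. A \<in> \<A> \<Longrightarrow> A \<in> sets M" "\<And>A. A \<in> \<A> \<Longrightarrow> emeasure M A < \<infinity>"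
    using assms by (auto simp: finite_measure_family_def)
  define atom where "atom T = {x \<in> space M. \<forall>A\<in>\<A>. x \<in> A \<longleftrightarrow> A \<in> T}" for T
  define P where "P = {atom T |T. T \<subseteq> \<A> \<and> T \<noteq> {} \<and> 0 < emeasure M (atom T)}"
  have atom_sets: "atom T \<in> sets M" for T
  proof -
    have "{x \<in> space M. x \<in> A \<longleftrightarrow> A \<in> T} \<in> sets M" if "A \<in> \<A>" for A
    proof (cases "A \<in> T")
      case True
      have "{x \<in> space M. x \<in> A \<longleftrightarrow> A \<in> T} = A" using True sets.sets_into_space[OF assms(2)[OF that]] by auto
      then show ?thesis using assms(2)[OF that] by simp
    next
      case False
      then have "{x \<in> space M. x \<in> A \<longleftrightarrow> A \<in> T} = space M - A" by auto
      then show ?thesis using assms(2)[OF that] by auto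
    qed
    then show ?thesis unfolding atom_def using assms(1) by (rule sets.sets_Collect_finite_All)
  qed
  have atom_sub: "atom T \<subseteq> A" if "A \<in> T" "T \<subseteq> \<A>" for A T using that by (auto simp: atom_def)
  have atom_disj: "atom T \<inter> A = {}" if "A \<notin> T" "A \<in> \<A>" for A T using that by (auto simp: atom_def)
  have finP: "finite P"
  proof (rule finite_subset)
    show "P \<subseteq> atom ` Pow \<A>" unfolding P_def by blast
  qed (use assms(1) in simp)
  have "cells M P"
    unfolding cells_def
  proof (intro conjI ballI finP)
    show "disjoint P"
    proof (unfold disjoint_def, intro ballI impI)
      fix C D assume "C \<in> P" "D \<in> P" "C \<noteq> D"
      then obtain T U where T: "C = atom T" "T \<subseteq> \<A>" and U: "D = atom U" "U \<subseteq> \<A>" unfolding P_def by blast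
      show "C \<inter> D = {}"
      proof (rule ccontr)
        assume "C \<inter> D \<noteq> {}"
        then obtain x where "x \<in> atom T" "x \<in> atom U" using T U by blast
        then have "A \<in> T \<longleftrightarrow> A \<in> U" if "A \<in> \<A>" for A using that by (auto simp: atom_def)
        then have "T = U" using T U by blast
        then show False using T U \<open>C \<noteq> D\<close> by simp
      qed
    qed
  next
    fix C assume "C \<in> P"
    then obtain T where T: "C = atom T" "T \<subseteq> \<A>" "T \<noteq> {}" "0 < emeasure M (atom T)" unfolding P_def by blast
    then obtain A where A: "A \<in> T" by blast
    show "C \<in> sets M" "0 < emeasure M C" using T atom_sets by auto
    have "emeasure M C \<le> emeasure M A" using A T atom_sub assms(2) by (intro emeasure_mono) auto
    also have "\<dots> < \<infinity>" using A T assms(3) by auto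
    finally show "emeasure M C < \<infinity>" .
  qed
  moreover have "cells_refine M P \<A>"
    unfolding cells_refine_def
  proof (intro ballI conjI)
    fix A C assume "A \<in> \<A>" "C \<in> P"
    then obtain T where "C = atom T" "T \<subseteq> \<A>" unfolding P_def by blast
    then show "C \<subseteq> A \<or> C \<inter> A = {}" using atom_sub[of A T] atom_disj[of A T] \<open>A \<in> \<A>\<close> by blast
  next
    fix A assume A: "A \<in> \<A>"
    let ?N = "\<Union>T\<in>{T. T \<subseteq> \<A> \<and> emeasure M (atom T) = 0}. atom T"
    have N: "?N \<in> null_sets M"
    proof (rule null_sets.finite_UN)
      show "finite {T. T \<subseteq> \<A> \<and> emeasure M (atom T) = 0}" using assms(1) by simp
      show "T \<in> {T. T \<subseteq> \<A> \<and> emeasure M (atom T) = 0} \<Longrightarrow> atom T \<in> null_sets M" for T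
        using atom_sets by (auto intro: null_setsI)
    qed
    have "A - \<Union>P \<subseteq> ?N"
    proof
      fix x assume x: "x \<in> A - \<Union>P"
      then have xs: "x \<in> space M" using sets.sets_into_space[OF assms(2)[OF A]] by blast
      define T where "T = {B \<in> \<A>. x \<in> B}"
      have xT: "x \<in> atom T" using xs by (auto simp: atom_def T_def)
      have "A \<in> T" "T \<subseteq> \<A>" using A x by (auto simp: T_def)
      then have "atom T \<notin> P" using x xT by blast
      then have "\<not> 0 < emeasure M (atom T)" using \<open>A \<in> T\<close> \<open>T \<subseteq> \<A>\<close> unfolding P_def by blast
      then have "emeasure M (atom T) = 0" by (simp add: zero_less_iff_neq_zero)
      then show "x \<in> ?N" using xT \<open>T \<subseteq> \<A>\<close> by blast
    qed
    moreover have "A - \<Union>P \<in> sets M"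
      using assms(2)[OF A] \<open>cells M P\<close> by (intro sets.Diff sets.finite_Union) (auto simp: cells_def)
    ultimately show "A - \<Union>P \<in> null_sets M" using N null_sets_subset by blast
  qed
  ultimately show ?thesis by blast
qed

lemma cells_refine_mono: "cells_refine M P \<A> \<Longrightarrow> \<B> \<subseteq> \<A> \<Longrightarrow> cells_refine M P \<B>"
  unfolding cells_refine_def by blast

lemma cells_refine_indicator:
  assumes P: "cells M P" and R: "cells_refine M P \<A>" and A: "A \<in> \<A>" and x: "x \<notin> A - \<Union>P"
  shows "(\<Sum>C\<in>P. (if C \<subseteq> A then 1 else 0) * indicator C x) = (indicator A x :: real)"
proof (cases "x \<in> A")
  case True
  then obtain C where C: "C \<in> P" "x \<in> C" using x by blast
  then have "C \<subseteq> A" using R A True unfolding cells_refine_def by blast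
  have "(\<Sum>D\<in>P. (if D \<subseteq> A then 1 else 0) * indicator D x) = (\<Sum>D\<in>P. if D = C then 1 else 0 :: real)"
    using C \<open>C \<subseteq> A\<close> cellsD(2)[OF P] by (intro sum.cong) (auto simp: indicator_def disjoint_def)
  then show ?thesis using C True cellsD(1)[OF P] by simp
next
  case False
  then have "(\<Sum>C\<in>P. (if C \<subseteq> A then 1 else 0) * indicator C x) = (0 :: real)"
    by (intro sum.neutral) (auto simp: indicator_def)
  then show ?thesis using False by simp
qed

context mixed
begin

text \<open>
  The inner average contracts the inner norm.  For the outer one, Minkowski's inequality shows that the inner
  norm of the average is at most the average of the inner norms, to which the contraction in the
  outer variable applies.
\<close>
lemma EN_kernel_le:
  assumes P: "cells M1 P" and Q: "cells M2 Q" and [measurable]: "u \<in> borel_measurable \<MM>"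
  shows "EN (\<lambda>(x, y). \<integral>\<^sup>+x'. (\<integral>\<^sup>+y'. u (x', y') * cell_kernel M2 Q y y' \<partial>M2) * cell_kernel M1 P x x' \<partial>M1) \<le> EN u"
proof -
  note [measurable] = cell_kernel_measurable[OF P] cell_kernel_measurable[OF Q]
  define v where "v x' y = (\<integral>\<^sup>+y'. u (x', y') * cell_kernel M2 Q y y' \<partial>M2)" for x' y
  have vm [measurable]: "(\<lambda>(x', y). v x' y) \<in> borel_measurable \<MM>" unfolding v_def by measurable
  define U where "U x' = ennpowr (\<integral>\<^sup>+y. ennpowr (u (x', y)) p2 \<partial>M2) (1 / p2)" for x'
  have Um [measurable]: "U \<in> borel_measurable M1" unfolding U_def by measurable
  have inner: "ennpowr (\<integral>\<^sup>+y. ennpowr (\<integral>\<^sup>+x'. v x' y * cell_kernel M1 P x x' \<partial>M1) p2 \<partial>M2) (1 / p2)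
      \<le> (\<integral>\<^sup>+x'. U x' * cell_kernel M1 P x x' \<partial>M1)" if x: "x \<in> space M1" for x
  proof -
    have km [measurable]: "cell_kernel M1 P x \<in> borel_measurable M1"
      using x measurable_Pair2[OF cell_kernel_measurable[OF P]] by simp
    have "ennpowr (\<integral>\<^sup>+y. ennpowr (\<integral>\<^sup>+x'. v x' y * cell_kernel M1 P x x' \<partial>M1) p2 \<partial>M2) (1 / p2)
       \<le> (\<integral>\<^sup>+x'. ennpowr (\<integral>\<^sup>+y. ennpowr (v x' y * cell_kernel M1 P x x') p2 \<partial>M2) (1 / p2) \<partial>M1)"
      using p2 by (intro Minkowski_integral M1.sigma_finite_measure_axioms M2.sigma_finite_measure_axioms) auto
    also have "\<dots> \<le> (\<integral>\<^sup>+x'. U x' * cell_kernel M1 P x x' \<partial>M1)"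
    proof (intro nn_integral_mono)
      fix x' assume x': "x' \<in> space M1"
      have "(\<integral>\<^sup>+y. ennpowr (v x' y * cell_kernel M1 P x x') p2 \<partial>M2)
          = (\<integral>\<^sup>+y. ennpowr (v x' y) p2 \<partial>M2) * ennpowr (cell_kernel M1 P x x') p2"
        using x' by (simp add: ennpowr_mult nn_integral_multc)
      also have "\<dots> \<le> (\<integral>\<^sup>+y. ennpowr (u (x', y)) p2 \<partial>M2) * ennpowr (cell_kernel M1 P x x') p2"
        unfolding v_def using x' p2
        by (intro mult_right_mono kernel_contraction M2.sigma_finite_measure_axioms cell_kernel_integral_le_1 Q
              cell_kernel_measurable cell_kernel_sym) auto
      finally have "ennpowr (\<integral>\<^sup>+y. ennpowr (v x' y * cell_kernel M1 P x x') p2 \<partial>M2) (1 / p2)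
          \<le> ennpowr ((\<integral>\<^sup>+y. ennpowr (u (x', y)) p2 \<partial>M2) * ennpowr (cell_kernel M1 P x x') p2) (1 / p2)"
        using p2 by (intro ennpowr_mono) auto
      then show "ennpowr (\<integral>\<^sup>+y. ennpowr (v x' y * cell_kernel M1 P x x') p2 \<partial>M2) (1 / p2) \<le> U x' * cell_kernel M1 P x x'"
        using p2 by (simp add: ennpowr_mult ennpowr_ennpowr U_def)
    qed
    finally show ?thesis .
  qed
  have "EN (\<lambda>(x, y). \<integral>\<^sup>+x'. v x' y * cell_kernel M1 P x x' \<partial>M1)
     \<le> ennpowr (\<integral>\<^sup>+x. ennpowr (\<integral>\<^sup>+x'. U x' * cell_kernel M1 P x x' \<partial>M1) p1 \<partial>M1) (1 / p1)"
    unfolding EN_inner using p1 inner by (intro ennpowr_mono nn_integral_mono) auto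
  also have "\<dots> \<le> ennpowr (\<integral>\<^sup>+x. ennpowr (U x) p1 \<partial>M1) (1 / p1)"
    using p1 by (intro ennpowr_mono kernel_contraction M1.sigma_finite_measure_axioms cell_kernel_integral_le_1 P
              cell_kernel_measurable cell_kernel_sym) auto
  also have "\<dots> = EN u" unfolding EN_inner U_def by simp
  finally show ?thesis unfolding v_def .
qed

definition cell_mass :: "('a \<times> 'b \<Rightarrow> ennreal) \<Rightarrow> 'a set \<Rightarrow> 'b set \<Rightarrow> ennreal" where
  "cell_mass u A B = (\<integral>\<^sup>+z. u z * indicator (A \<times> B) z \<partial>\<MM>)"

lemma kernel_eq_cell_mass:
  assumes P: "cells M1 P" and Q: "cells M2 Q" and [measurable]: "u \<in> borel_measurable \<MM>"
  shows "(\<integral>\<^sup>+x'. (\<integral>\<^sup>+y'. u (x', y') * cell_kernel M2 Q y y' \<partial>M2) * cell_kernel M1 P x x' \<partial>M1)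
     = (\<Sum>A\<in>P. \<Sum>B\<in>Q. cell_mass u A B * ennreal (1 / (measure M1 A * measure M2 B)) * indicator (A \<times> B) (x, y))"
proof -
  have Pm [measurable]: "A \<in> P \<Longrightarrow> A \<in> sets M1" for A using cellsD[OF P] by blast
  have Qm [measurable]: "B \<in> Q \<Longrightarrow> B \<in> sets M2" for B using cellsD[OF Q] by blast
  define J where "J B x' = (\<integral>\<^sup>+y'. u (x', y') * indicator B y' \<partial>M2)" for B x'
  have Jm [measurable]: "J B \<in> borel_measurable M1" if "B \<in> Q" for B
    unfolding J_def using Qm[OF that] by measurable
  have inner: "(\<integral>\<^sup>+y'. u (x', y') * cell_kernel M2 Q y y' \<partial>M2) = (\<Sum>B\<in>Q. indicator B y * ennreal (1 / measure M2 B) * J B x')"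
    if x': "x' \<in> space M1" for x'
  proof -
    have "(\<integral>\<^sup>+y'. u (x', y') * cell_kernel M2 Q y y' \<partial>M2)
        = (\<integral>\<^sup>+y'. (\<Sum>B\<in>Q. (indicator B y * ennreal (1 / measure M2 B)) * (u (x', y') * indicator B y')) \<partial>M2)"
      by (simp add: cell_kernel_def sum_distrib_left mult_ac)
    also have "\<dots> = (\<Sum>B\<in>Q. \<integral>\<^sup>+y'. (indicator B y * ennreal (1 / measure M2 B)) * (u (x', y') * indicator B y') \<partial>M2)"
      using x' by (intro nn_integral_sum) measurable
    also have "\<dots> = (\<Sum>B\<in>Q. indicator B y * ennreal (1 / measure M2 B) * J B x')"
      unfolding J_def using x' by (intro sum.cong refl nn_integral_cmult) measurable
    finally show ?thesis .
  qed
  have "(\<integral>\<^sup>+x'. (\<integral>\<^sup>+y'. u (x', y') * cell_kernel M2 Q y y' \<partial>M2) * cell_kernel M1 P x x' \<partial>M1)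
      = (\<integral>\<^sup>+x'. (\<Sum>A\<in>P. \<Sum>B\<in>Q. (indicator A x * ennreal (1 / measure M1 A) * (indicator B y * ennreal (1 / measure M2 B))) * (J B x' * indicator A x')) \<partial>M1)"
  proof (intro nn_integral_cong)
    fix x' assume x': "x' \<in> space M1"
    show "(\<integral>\<^sup>+y'. u (x', y') * cell_kernel M2 Q y y' \<partial>M2) * cell_kernel M1 P x x'
      = (\<Sum>A\<in>P. \<Sum>B\<in>Q. (indicator A x * ennreal (1 / measure M1 A) * (indicator B y * ennreal (1 / measure M2 B))) * (J B x' * indicator A x'))"
      unfolding inner[OF x'] cell_kernel_def[of M1] sum_product
      by (subst sum.swap) (simp only: mult_ac)
  qed
  also have "\<dots> = (\<Sum>A\<in>P. \<integral>\<^sup>+x'. (\<Sum>B\<in>Q. (indicator A x * ennreal (1 / measure M1 A) * (indicator B y * ennreal (1 / measure M2 B))) * (J B x' * indicator A x')) \<partial>M1)"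
    by (intro nn_integral_sum) measurable
  also have "\<dots> = (\<Sum>A\<in>P. \<Sum>B\<in>Q. \<integral>\<^sup>+x'. (indicator A x * ennreal (1 / measure M1 A) * (indicator B y * ennreal (1 / measure M2 B))) * (J B x' * indicator A x') \<partial>M1)"
    by (intro sum.cong refl nn_integral_sum) measurable
  also have "\<dots> = (\<Sum>A\<in>P. \<Sum>B\<in>Q. cell_mass u A B * ennreal (1 / (measure M1 A * measure M2 B)) * indicator (A \<times> B) (x, y))"
  proof (intro sum.cong refl)
    fix A B assume AB: "A \<in> P" "B \<in> Q"
    note [measurable] = Pm[OF AB(1)] Qm[OF AB(2)] Jm[OF AB(2)]
    have "cell_mass u A B = (\<integral>\<^sup>+x'. \<integral>\<^sup>+y'. u (x', y') * indicator (A \<times> B) (x', y') \<partial>M2 \<partial>M1)"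
      unfolding cell_mass_def by (rule M2.nn_integral_fst[symmetric]) measurable
    also have "\<dots> = (\<integral>\<^sup>+x'. J B x' * indicator A x' \<partial>M1)"
      unfolding J_def
      by (intro nn_integral_cong) (auto simp: indicator_def intro!: nn_integral_cong)
    finally have cm: "cell_mass u A B = (\<integral>\<^sup>+x'. J B x' * indicator A x' \<partial>M1)" .
    have "(\<integral>\<^sup>+x'. (indicator A x * ennreal (1 / measure M1 A) * (indicator B y * ennreal (1 / measure M2 B))) * (J B x' * indicator A x') \<partial>M1)
        = (indicator A x * ennreal (1 / measure M1 A) * (indicator B y * ennreal (1 / measure M2 B))) * cell_mass u A B"
      unfolding cm by (rule nn_integral_cmult) measurable
    also have "ennreal (1 / (measure M1 A * measure M2 B)) = ennreal (1 / measure M1 A) * ennreal (1 / measure M2 B)"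
      by (simp add: ennreal_mult[symmetric])
    then have "(indicator A x * ennreal (1 / measure M1 A) * (indicator B y * ennreal (1 / measure M2 B))) * cell_mass u A B
        = cell_mass u A B * ennreal (1 / (measure M1 A * measure M2 B)) * indicator (A \<times> B) (x, y)"
      by (simp add: indicator_times mult_ac)
    finally show "(\<integral>\<^sup>+x'. (indicator A x * ennreal (1 / measure M1 A) * (indicator B y * ennreal (1 / measure M2 B))) * (J B x' * indicator A x') \<partial>M1)
        = cell_mass u A B * ennreal (1 / (measure M1 A * measure M2 B)) * indicator (A \<times> B) (x, y)" .
  qed
  finally show ?thesis .
qed

text \<open>
  The average over the single cell \<open>A \<times> B\<close> is a multiple of its indicator, and by the contraction property its
  norm is finite.  Since the indicator has positive norm, the multiple is finite.
\<close>
lemma cell_mass_finite: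
  assumes P: "cells M1 P" and Q: "cells M2 Q" and f: "f \<in> MF" and AB: "A \<in> P" "B \<in> Q"
  shows "cell_mass (\<lambda>z. ennreal \<bar>f z\<bar>) A B < \<infinity>"
proof -
  note [measurable] = mixed_fun_measurable[OF f]
  let ?u = "\<lambda>z. ennreal \<bar>f z\<bar>"
  let ?d = "ennreal (1 / (measure M1 A * measure M2 B))"
  have PA: "cells M1 {A}" and QB: "cells M2 {B}" using P Q AB by (auto simp: cells_def)
  have AB_sets: "A \<in> sets M1" "B \<in> sets M2" using cellsD[OF P] cellsD[OF Q] AB by auto
  have "EN (\<lambda>z. (cell_mass ?u A B * ?d) * indicator (A \<times> B) z)
      = EN (\<lambda>(x, y). \<integral>\<^sup>+x'. (\<integral>\<^sup>+y'. ?u (x', y') * cell_kernel M2 {B} y y' \<partial>M2) * cell_kernel M1 {A} x x' \<partial>M1)"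
  proof -
    have "(\<integral>\<^sup>+x'. (\<integral>\<^sup>+y'. ?u (x', y') * cell_kernel M2 {B} y y' \<partial>M2) * cell_kernel M1 {A} x x' \<partial>M1)
        = (cell_mass ?u A B * ?d) * indicator (A \<times> B) (x, y)" for x y
      using kernel_eq_cell_mass[OF PA QB, of ?u y x]
      by (simp only: sum.insert finite.emptyI empty_iff not_False_eq_True sum.empty add_0_right) simp
    then show ?thesis
      by (intro arg_cong[of _ _ EN] ext) (simp only: split_paired_all prod.case)
  qed
  also have "\<dots> \<le> EN ?u" by (rule EN_kernel_le[OF PA QB]) measurable
  also have "\<dots> < \<infinity>" using f by (simp only: mixed_fun_iff)
  finally have "(cell_mass ?u A B * ?d) * EN (indicator (A \<times> B)) < \<infinity>"
    using AB_sets by (subst (asm) EN_cmult) auto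
  moreover have "EN (indicator (A \<times> B)) \<noteq> 0"
    unfolding EN_rectangle[OF AB_sets] using cellsD(4)[OF P AB(1)] cellsD(4)[OF Q AB(2)] by auto
  moreover have "?d \<noteq> 0"
    using cells_measure(1)[OF P AB(1)] cells_measure(1)[OF Q AB(2)] by (simp add: ennreal_eq_0_iff not_le)
  moreover have "a < \<infinity>" if "a * b * c < \<infinity>" "c \<noteq> 0" "b \<noteq> 0" for a b c :: ennreal
    using that by (auto simp: less_top[symmetric] ennreal_mult_eq_top_iff)
  ultimately show ?thesis by blast
qed

lemma cell_integrable:
  assumes "cells M1 P" "cells M2 Q" and f: "f \<in> MF" and AB: "A \<in> P" "B \<in> Q"
  shows "integrable \<MM> (\<lambda>z. f z * indicator (A \<times> B) z)"
proof (rule integrableI_bounded)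
  note [measurable] = mixed_fun_measurable[OF f]
  have [measurable]: "A \<times> B \<in> sets \<MM>" using cellsD[OF assms(1)] cellsD[OF assms(2)] AB by auto
  show "(\<lambda>z. f z * indicator (A \<times> B) z) \<in> borel_measurable \<MM>" by measurable
  have "(\<integral>\<^sup>+z. ennreal (norm (f z * indicator (A \<times> B) z)) \<partial>\<MM>) = cell_mass (\<lambda>z. ennreal \<bar>f z\<bar>) A B"
    unfolding cell_mass_def by (intro nn_integral_cong) (auto simp: indicator_def)
  then show "(\<integral>\<^sup>+z. ennreal (norm (f z * indicator (A \<times> B) z)) \<partial>\<MM>) < \<infinity>"
    using cell_mass_finite[OF assms] by simp
qed

lemma cell_average_measurable:
  assumes "cells M1 P" "cells M2 Q"
  shows "cell_average M1 M2 P Q f \<in> borel_measurable \<MM>"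
proof -
  have [measurable]: "A \<times> B \<in> sets \<MM>" if "A \<in> P" "B \<in> Q" for A B
    using cellsD[OF assms(1)] cellsD[OF assms(2)] that by auto
  show ?thesis unfolding cell_average_def[abs_def] by measurable
qed

theorem cell_average_contraction:
  assumes P: "cells M1 P" and Q: "cells M2 Q" and f: "f \<in> MF"
  shows "cell_average M1 M2 P Q f \<in> MF" "MN (cell_average M1 M2 P Q f) \<le> MN f"
proof -
  note fm [measurable] = mixed_fun_measurable[OF f]
  let ?u = "\<lambda>z. ennreal \<bar>f z\<bar>"
  let ?av = "cell_average M1 M2 P Q f"
  have bound: "ennreal \<bar>?av (x, y)\<bar>
      \<le> (\<integral>\<^sup>+x'. (\<integral>\<^sup>+y'. ?u (x', y') * cell_kernel M2 Q y y' \<partial>M2) * cell_kernel M1 P x x' \<partial>M1)" for x y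
  proof -
    let ?I = "\<lambda>A B. \<integral>w. f w * indicator (A \<times> B) w \<partial>\<MM>"
    let ?m = "\<lambda>A B. measure M1 A * measure M2 B"
    let ?i = "\<lambda>A B. indicator (A \<times> B) (x, y) :: real"
    have "\<bar>?av (x, y)\<bar> \<le> (\<Sum>A\<in>P. \<bar>\<Sum>B\<in>Q. ?I A B / ?m A B * ?i A B\<bar>)"
      unfolding cell_average_def by (rule sum_abs)
    also have "\<dots> \<le> (\<Sum>A\<in>P. \<Sum>B\<in>Q. \<bar>?I A B / ?m A B * ?i A B\<bar>)"
      by (intro sum_mono sum_abs)
    finally have "ennreal \<bar>?av (x, y)\<bar> \<le> ennreal (\<Sum>A\<in>P. \<Sum>B\<in>Q. \<bar>?I A B / ?m A B * ?i A B\<bar>)"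
      by (rule ennreal_leI)
    also have "\<dots> = (\<Sum>A\<in>P. \<Sum>B\<in>Q. ennreal \<bar>?I A B / ?m A B * ?i A B\<bar>)"
      by (simp add: sum_nonneg)
    also have "\<dots> \<le> (\<Sum>A\<in>P. \<Sum>B\<in>Q. cell_mass ?u A B * ennreal (1 / ?m A B) * indicator (A \<times> B) (x, y))"
    proof (intro sum_mono)
      fix A B assume AB: "A \<in> P" "B \<in> Q"
      have "ennreal \<bar>?I A B\<bar> \<le> (\<integral>\<^sup>+w. ennreal (norm (f w * indicator (A \<times> B) w)) \<partial>\<MM>)"
        using integral_norm_bound_ennreal[OF cell_integrable[OF P Q f AB]] by simp
      also have "\<dots> = cell_mass ?u A B"
        unfolding cell_mass_def by (intro nn_integral_cong) (auto simp: indicator_def)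
      finally have I: "ennreal \<bar>?I A B\<bar> \<le> cell_mass ?u A B" .
      have "ennreal \<bar>?I A B / ?m A B * ?i A B\<bar> = ennreal \<bar>?I A B\<bar> * ennreal (1 / ?m A B) * indicator (A \<times> B) (x, y)"
        by (cases "(x, y) \<in> A \<times> B") (simp_all add: abs_mult ennreal_mult'[symmetric])
      also have "\<dots> \<le> cell_mass ?u A B * ennreal (1 / ?m A B) * indicator (A \<times> B) (x, y)"
        by (intro mult_right_mono I) auto
      finally show "ennreal \<bar>?I A B / ?m A B * ?i A B\<bar> \<le> cell_mass ?u A B * ennreal (1 / ?m A B) * indicator (A \<times> B) (x, y)" .
    qed
    also have "\<dots> = (\<integral>\<^sup>+x'. (\<integral>\<^sup>+y'. ?u (x', y') * cell_kernel M2 Q y y' \<partial>M2) * cell_kernel M1 P x x' \<partial>M1)"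
      by (rule kernel_eq_cell_mass[OF P Q, symmetric]) measurable
    finally show ?thesis .
  qed
  have "EN (\<lambda>z. ennreal \<bar>?av z\<bar>)
     \<le> EN (\<lambda>(x, y). \<integral>\<^sup>+x'. (\<integral>\<^sup>+y'. ?u (x', y') * cell_kernel M2 Q y y' \<partial>M2) * cell_kernel M1 P x x' \<partial>M1)"
    using bound by (intro EN_mono AE_I2) auto
  also have "\<dots> \<le> EN ?u" by (rule EN_kernel_le[OF P Q]) measurable
  finally have le: "EN (\<lambda>z. ennreal \<bar>?av z\<bar>) \<le> EN ?u" .
  also have "\<dots> < \<infinity>" using f by (simp only: mixed_fun_iff)
  finally show av: "?av \<in> MF" using cell_average_measurable[OF P Q] by (simp only: mixed_fun_iff)
  have "ennreal (MN ?av) \<le> ennreal (MN f)" using le by (simp only: MN_eq_EN[OF av] MN_eq_EN[OF f])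
  then show "MN ?av \<le> MN f" by simp
qed

lemma cell_average_add:
  assumes "cells M1 P" "cells M2 Q" "f \<in> MF" "g \<in> MF"
  shows "cell_average M1 M2 P Q (\<lambda>z. f z + g z) z = cell_average M1 M2 P Q f z + cell_average M1 M2 P Q g z"
proof -
  have "(\<integral>w. (f w + g w) * indicator (A \<times> B) w \<partial>\<MM>)
      = (\<integral>w. f w * indicator (A \<times> B) w \<partial>\<MM>) + (\<integral>w. g w * indicator (A \<times> B) w \<partial>\<MM>)"
    if "A \<in> P" "B \<in> Q" for A B
    using cell_integrable[OF assms(1,2,3) that] cell_integrable[OF assms(1,2,4) that]
    by (simp add: distrib_right)
  then show ?thesis
    by (simp add: cell_average_def sum.distrib[symmetric] add_divide_distrib distrib_right cong: sum.cong)
qed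

lemma cell_average_cmult:
  "cell_average M1 M2 P Q (\<lambda>z. c * f z) z = c * cell_average M1 M2 P Q f z"
  by (simp add: cell_average_def sum_distrib_left mult.assoc)

lemma cell_average_rectangle:
  assumes P: "cells M1 P" and Q: "cells M2 Q" and A: "cells_refine M1 P \<A>" "A \<in> \<A>" "A \<in> sets M1" and B: "cells_refine M2 Q \<B>" "B \<in> \<B>" "B \<in> sets M2"
    and z: "fst z \<notin> A - \<Union>P" "snd z \<notin> B - \<Union>Q"
  shows "cell_average M1 M2 P Q (indicator (A \<times> B)) z = indicator (A \<times> B) z"
proof -
  let ?a = "\<lambda>C. if C \<subseteq> A then 1 else 0 :: real" and ?b = "\<lambda>D. if D \<subseteq> B then 1 else 0 :: real"
  have "(\<integral>w. indicator (A \<times> B) w * indicator (C \<times> D) w \<partial>\<MM>) / (measure M1 C * measure M2 D) = ?a C * ?b D"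
    if CD: "C \<in> P" "D \<in> Q" for C D
  proof -
    have s: "C \<in> sets M1" "D \<in> sets M2" using cellsD[OF P] cellsD[OF Q] CD by auto
    have "(\<integral>w. indicator (A \<times> B) w * indicator (C \<times> D) w \<partial>\<MM>) = (\<integral>w. ?a C * ?b D * indicator (C \<times> D) w \<partial>\<MM>)"
    proof (intro Bochner_Integration.integral_cong refl)
      fix w :: "'a \<times> 'b"
      have "C \<subseteq> A \<or> C \<inter> A = {}" "D \<subseteq> B \<or> D \<inter> B = {}" using A(1,2) B(1,2) CD by (auto simp: cells_refine_def)
      then show "indicator (A \<times> B) w * indicator (C \<times> D) w = ?a C * ?b D * indicator (C \<times> D) w"
        by (cases w) (auto simp: indicator_def)
    qed
    also have "\<dots> = ?a C * ?b D * measure \<MM> (C \<times> D)"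
      using s sets.sets_into_space[of "C \<times> D" \<MM>] by (simp add: Int_absorb2)
    also have "measure \<MM> (C \<times> D) = measure M1 C * measure M2 D"
      using s by (simp add: measure_def M2.emeasure_pair_measure_Times enn2real_mult)
    finally show ?thesis
      using cells_measure(1)[OF P CD(1)] cells_measure(1)[OF Q CD(2)] by simp
  qed
  then have "cell_average M1 M2 P Q (indicator (A \<times> B)) z = (\<Sum>C\<in>P. \<Sum>D\<in>Q. (?a C * indicator C (fst z)) * (?b D * indicator D (snd z)))"
    unfolding cell_average_def by (intro sum.cong refl) (cases z, simp add: indicator_times mult_ac)
  also have "\<dots> = (\<Sum>C\<in>P. ?a C * indicator C (fst z)) * (\<Sum>D\<in>Q. ?b D * indicator D (snd z))"
    by (simp only: sum_product)
  also have "\<dots> = indicator A (fst z) * indicator B (snd z)"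
    by (simp only: cells_refine_indicator[OF P A(1,2) z(1)] cells_refine_indicator[OF Q B(1,2) z(2)])
  finally show ?thesis by (cases z) (simp add: indicator_times)
qed

definition fixed_by_averages :: "('a \<times> 'b \<Rightarrow> real) \<Rightarrow> 'a set set \<Rightarrow> 'b set set \<Rightarrow> bool" where
  "fixed_by_averages s \<A> \<B> \<longleftrightarrow>
    (\<forall>P Q. cells M1 P \<longrightarrow> cells M2 Q \<longrightarrow> cells_refine M1 P \<A> \<longrightarrow> cells_refine M2 Q \<B> \<longrightarrow>
       (AE z in \<MM>. cell_average M1 M2 P Q s z = s z))"

text \<open>The sides of the rectangles involved are the sets to be refined.\<close>
lemma rect_simple_fixed:
  assumes "rect_simple s"
  shows "\<exists>\<A> \<B>. finite_measure_family M1 \<A> \<and> finite_measure_family M2 \<B> \<and> fixed_by_averages s \<A> \<B>"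
  using assms
proof (induction rule: rect_simple.induct)
  case zero
  show ?case
    by (intro exI[of _ "{}"]) (simp add: cell_average_def finite_measure_family_def fixed_by_averages_def)
next
  case (rect A B s c)
  then obtain \<A> \<B> where fam: "finite_measure_family M1 \<A>" "finite_measure_family M2 \<B>"
    and fixed: "fixed_by_averages s \<A> \<B>"
    by blast
  have sMF: "s \<in> MF" using rect.hyps by (intro rect_simple_mixed_fun)
  have iMF: "indicator (A \<times> B) \<in> MF" using rect.hyps by (intro rectangle_mixed_fun)
  have step: "AE z in \<MM>. cell_average M1 M2 P Q (\<lambda>z. c * indicator (A \<times> B) z + s z) z = c * indicator (A \<times> B) z + s z"
    if PQ: "cells M1 P" "cells M2 Q" and R: "cells_refine M1 P (insert A \<A>)" "cells_refine M2 Q (insert B \<B>)" for P Q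
  proof -
    have nullA: "A - \<Union>P \<in> null_sets M1" and nullB: "B - \<Union>Q \<in> null_sets M2" using R by (auto simp: cells_refine_def)
    have "AE x in M1. AE y in M2. x \<notin> A - \<Union>P \<and> y \<notin> B - \<Union>Q"
      using AE_not_in[OF nullA]
    proof eventually_elim
      case (elim x)
      show ?case using AE_not_in[OF nullB] by eventually_elim (use elim in simp)
    qed
    then have z: "AE z in \<MM>. fst z \<notin> A - \<Union>P \<and> snd z \<notin> B - \<Union>Q"
    proof (intro AE_pair_measure)
      have [measurable]: "A - \<Union>P \<in> sets M1" "B - \<Union>Q \<in> sets M2" using nullA nullB by auto
      show "{z \<in> space \<MM>. fst z \<notin> A - \<Union>P \<and> snd z \<notin> B - \<Union>Q} \<in> sets \<MM>" by measurable
    qed simp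
    have "AE z in \<MM>. cell_average M1 M2 P Q s z = s z"
      using fixed PQ cells_refine_mono[OF R(1), of \<A>] cells_refine_mono[OF R(2), of \<B>]
      by (auto simp: fixed_by_averages_def)
    with z show ?thesis
    proof eventually_elim
      case (elim z)
      have "cell_average M1 M2 P Q (indicator (A \<times> B)) z = indicator (A \<times> B) z"
        using elim rect.hyps by (intro cell_average_rectangle[OF PQ R(1) _ _ R(2)]) auto
      then show ?case
        using elim by (simp add: cell_average_add[OF PQ mixed_fun_cmult(1)[OF iMF] sMF] cell_average_cmult)
    qed
  qed
  show ?case
  proof (rule exI[of _ "insert A \<A>"], rule exI[of _ "insert B \<B>"], intro conjI)
    show "finite_measure_family M1 (insert A \<A>)" "finite_measure_family M2 (insert B \<B>)"
      using fam rect.hyps by (auto simp: finite_measure_family_def)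
    show "fixed_by_averages (\<lambda>z. c * indicator (A \<times> B) z + s z) (insert A \<A>) (insert B \<B>)"
      unfolding fixed_by_averages_def using step by blast
  qed
qed

text \<open>
  Choose cells that fix approximants \<open>s k\<close> within \<open>e / 2\<close>.  The error is then that of averaging
  \<open>f k - s k\<close>, at most twice its norm.
\<close>
theorem cell_average_approximates:
  assumes "finite K" and f: "\<And>k. k \<in> K \<Longrightarrow> f k \<in> MF" and e: "0 < e"
  obtains P Q where "cells M1 P" "cells M2 Q" "\<And>k. k \<in> K \<Longrightarrow> MN (\<lambda>z. f k z - cell_average M1 M2 P Q (f k) z) < e"
proof -
  have "\<forall>k. \<exists>s. k \<in> K \<longrightarrow> rect_simple s \<and> MN (\<lambda>z. f k z - s z) < e / 2"
  proof
    fix k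
    show "\<exists>s. k \<in> K \<longrightarrow> rect_simple s \<and> MN (\<lambda>z. f k z - s z) < e / 2"
    proof (cases "k \<in> K")
      case True
      have "0 < e / 2" using e by simp
      then obtain s where "rect_simple s" "MN (\<lambda>z. f k z - s z) < e / 2" by (rule rect_simple_dense[OF f[OF True]])
      then show ?thesis by blast
    qed simp
  qed
  then obtain s where s: "\<And>k. k \<in> K \<Longrightarrow> rect_simple (s k)" "\<And>k. k \<in> K \<Longrightarrow> MN (\<lambda>z. f k z - s k z) < e / 2"
    by metis
  have "\<forall>k\<in>K. \<exists>\<A> \<B>. finite_measure_family M1 \<A> \<and> finite_measure_family M2 \<B> \<and> fixed_by_averages (s k) \<A> \<B>"
    using rect_simple_fixed[OF s(1)] by blast
  then obtain \<A> \<B> where AB: "\<And>k. k \<in> K \<Longrightarrow> finite_measure_family M1 (\<A> k)"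
      "\<And>k. k \<in> K \<Longrightarrow> finite_measure_family M2 (\<B> k)" "\<And>k. k \<in> K \<Longrightarrow> fixed_by_averages (s k) (\<A> k) (\<B> k)"
    by metis
  obtain P where P: "cells M1 P" "cells_refine M1 P (\<Union>k\<in>K. \<A> k)"
  proof -
    have "finite_measure_family M1 (\<Union>k\<in>K. \<A> k)" by (rule finite_measure_family_UN[OF assms(1) AB(1)])
    from ex_refining_cells[OF this] that show ?thesis by blast
  qed
  obtain Q where Q: "cells M2 Q" "cells_refine M2 Q (\<Union>k\<in>K. \<B> k)"
  proof -
    have "finite_measure_family M2 (\<Union>k\<in>K. \<B> k)" by (rule finite_measure_family_UN[OF assms(1) AB(2)])
    from ex_refining_cells[OF this] that show ?thesis by blast
  qed
  show ?thesis
  proof (rule that[OF P(1) Q(1)])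
    fix k assume k: "k \<in> K"
    have sMF: "s k \<in> MF" using s(1)[OF k] by (rule rect_simple_mixed_fun)
    have "cells_refine M1 P (\<A> k)" "cells_refine M2 Q (\<B> k)"
      by (rule cells_refine_mono[OF P(2)] cells_refine_mono[OF Q(2)], use k in blast)+
    then have fixed: "AE z in \<MM>. cell_average M1 M2 P Q (s k) z = s k z"
      using AB(3)[OF k] P(1) Q(1) by (simp add: fixed_by_averages_def)
    let ?d = "\<lambda>z. f k z - s k z"
    have dMF: "?d \<in> MF" using f[OF k] sMF by (rule mixed_fun_diff)
    have avMF: "cell_average M1 M2 P Q ?d \<in> MF" using cell_average_contraction(1)[OF P(1) Q(1) dMF] .
    have split: "cell_average M1 M2 P Q (f k) z = cell_average M1 M2 P Q ?d z + cell_average M1 M2 P Q (s k) z" for z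
      using cell_average_add[OF P(1) Q(1) dMF sMF, of z] by simp
    have "AE z in \<MM>. ?d z + (- 1) * cell_average M1 M2 P Q ?d z = f k z - cell_average M1 M2 P Q (f k) z"
      using fixed
    proof eventually_elim
      case (elim z)
      then show ?case using split[of z] by simp
    qed
    moreover have "(\<lambda>z. f k z - cell_average M1 M2 P Q (f k) z) \<in> borel_measurable \<MM>"
      using mixed_fun_measurable[OF f[OF k]] cell_average_measurable[OF P(1) Q(1)] by (rule borel_measurable_diff)
    ultimately have "MN (\<lambda>z. f k z - cell_average M1 M2 P Q (f k) z) = MN (\<lambda>z. ?d z + (- 1) * cell_average M1 M2 P Q ?d z)"
      by (intro mixed_fun_cong_AE(2)[OF mixed_fun_add(1)[OF dMF mixed_fun_cmult(1)[OF avMF]]])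
    also have "\<dots> \<le> MN ?d + MN (\<lambda>z. (- 1) * cell_average M1 M2 P Q ?d z)"
      by (rule mixed_fun_add(2)[OF dMF mixed_fun_cmult(1)[OF avMF]])
    also have "\<dots> = MN ?d + MN (cell_average M1 M2 P Q ?d)" using mixed_fun_cmult(2)[OF avMF, of "- 1"] by simp
    also have "\<dots> \<le> MN ?d + MN ?d" using cell_average_contraction(2)[OF P(1) Q(1) dMF] by simp
    also have "\<dots> < e" using s(2)[OF k] by simp
    finally show "MN (\<lambda>z. f k z - cell_average M1 M2 P Q (f k) z) < e" .
  qed
qed

end

section \<open>Retracts and bounded approximation\<close>

context mixed_product
begin

lemma tclass_eq_AE:
  assumes "tclass \<phi> = tclass \<psi>" "\<phi> \<in> tuples" "\<psi> \<in> tuples" "i \<in> I"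
  shows "AE z in D1 i \<Otimes>\<^sub>M D2 i. \<phi> i z = \<psi> i z"
proof -
  have "MCi i (\<phi> i) = MCi i (\<psi> i)"
    using fun_cong[OF assms(1), of i] assms(4) by (simp add: tclass_def)
  then show ?thesis
    using assms by (simp add: mixed.mixed_class_eq_iff[OF mixed[OF assms(4)]] tuples_def)
qed

lemma tnorm_le: "(\<And>i. i \<in> I \<Longrightarrow> MNi i (\<phi> i) \<le> MNi i (\<psi> i)) \<Longrightarrow> tnorm \<phi> \<le> tnorm \<psi>"
  unfolding tnorm_def by (rule sum_mono)

text \<open>
  The representatives \<open>rp x\<close> are chosen arbitrarily and need not depend linearly on \<open>x\<close>.  Their integrals over
  cells do, and \<open>T\<close> is the combination, with these integrals as coefficients, of the images of the
  indicators of finitely many cells.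
\<close>
lemma retraction_finite_rank:
  fixes R :: "(nat \<Rightarrow> ('a \<times> 'b \<Rightarrow> real) set) \<Rightarrow> 'x::real_normed_vector"
  assumes R: "bounded_linear_op Y type_nspace R" and S: "bounded_linear_op type_nspace Y S"
    and rp: "\<And>x. rp x \<in> tuples" "\<And>x. S x = tclass (rp x)"
    and P: "\<And>i. i \<in> I \<Longrightarrow> cells (D1 i) (P i)" and Q: "\<And>i. i \<in> I \<Longrightarrow> cells (D2 i) (Q i)"
  defines "T \<equiv> \<lambda>x. R (tclass (\<lambda>i. cell_average (D1 i) (D2 i) (P i) (Q i) (rp x i)))"
  shows "T (x + y) = T x + T y" "T (c *\<^sub>R x) = c *\<^sub>R T x" "\<exists>B. finite B \<and> range T \<subseteq> span B"
proof -
  define K where "K = (SIGMA i:I. P i \<times> Q i)"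
  have finK: "finite K"
    unfolding K_def using P Q by (intro finite_SigmaI finite_cartesian_product cellsD(1)) auto
  define coef where "coef k x = (case k of (i, A, B) \<Rightarrow>
      (\<integral>w. rp x i w * indicator (A \<times> B) w \<partial>(D1 i \<Otimes>\<^sub>M D2 i)) / (measure (D1 i) A * measure (D2 i) B))" for k x
  define \<phi> :: "nat \<times> 'a set \<times> 'b set \<Rightarrow> nat \<Rightarrow> 'a \<times> 'b \<Rightarrow> real"
    where "\<phi> k j z = (case k of (i, A, B) \<Rightarrow> if j = i then indicator (A \<times> B) z else 0)" for k j z
  have phi_tuples: "\<phi> k \<in> tuples" if kK: "k \<in> K" for k
  proof -
    obtain i A B where k: "k = (i, A, B)" "i \<in> I" "A \<in> P i" "B \<in> Q i" using kK unfolding K_def by blast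
    have "indicator (A \<times> B) \<in> MFi i"
      using cellsD[OF P[OF k(2)]] cellsD[OF Q[OF k(2)]] k
      by (intro mixed.rectangle_mixed_fun[OF mixed]) auto
    moreover have "\<phi> k j = (if j = i then indicator (A \<times> B) else (\<lambda>z. 0))" for j
      by (simp add: \<phi>_def k(1) fun_eq_iff)
    ultimately show ?thesis by (simp add: tuples_def mixed.mixed_fun_zero[OF mixed])
  qed
  have T_eq: "T x = (\<Sum>k\<in>K. coef k x *\<^sub>R R (tclass (\<phi> k)))" for x
  proof -
    have "(\<Sum>k\<in>K. coef k x * \<phi> k j z) = cell_average (D1 j) (D2 j) (P j) (Q j) (rp x j) z" if j: "j \<in> I" for j z
    proof -
      let ?t = "\<lambda>A B. (\<integral>w. rp x j w * indicator (A \<times> B) w \<partial>(D1 j \<Otimes>\<^sub>M D2 j)) / (measure (D1 j) A * measure (D2 j) B) * indicator (A \<times> B) z"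
      have "(\<Sum>k\<in>K. coef k x * \<phi> k j z) = (\<Sum>i\<in>I. \<Sum>(A, B)\<in>P i \<times> Q i. coef (i, A, B) x * \<phi> (i, A, B) j z)"
        unfolding K_def using P Q
        by (subst sum.Sigma) (auto intro!: finite_cartesian_product cellsD(1) sum.cong)
      also have "\<dots> = (\<Sum>i\<in>I. if i = j then (\<Sum>(A, B)\<in>P j \<times> Q j. ?t A B) else 0)"
        by (intro sum.cong refl) (auto simp: coef_def \<phi>_def intro!: sum.cong sum.neutral)
      also have "\<dots> = (\<Sum>(A, B)\<in>P j \<times> Q j. ?t A B)" using j by simp
      also have "\<dots> = cell_average (D1 j) (D2 j) (P j) (Q j) (rp x j) z"
        by (simp add: cell_average_def sum.cartesian_product)
      finally show ?thesis .
    qed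
    then have "tclass (\<lambda>j z. \<Sum>k\<in>K. coef k x * \<phi> k j z) = tclass (\<lambda>j. cell_average (D1 j) (D2 j) (P j) (Q j) (rp x j))"
      unfolding tclass_def by (intro restrict_ext) simp
    moreover have "R (tclass (\<lambda>j z. \<Sum>k\<in>K. coef k x * \<phi> k j z)) = (\<Sum>k\<in>K. coef k x *\<^sub>R R (tclass (\<phi> k)))"
      by (rule linear_from_Y_sum[OF R finK phi_tuples])
    ultimately show ?thesis unfolding T_def by (simp only:)
  qed
  have coef_add: "coef k (x + y) = coef k x + coef k y" and coef_scale: "coef k (c *\<^sub>R x) = c * coef k x"
    if kK: "k \<in> K" for k x y c
  proof -
    obtain i A B where k: "k = (i, A, B)" "i \<in> I" "A \<in> P i" "B \<in> Q i" using kK unfolding K_def by blast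
    interpret m: mixed "p1 i" "p2 i" "D1 i" "D2 i" using mixed[OF k(2)] .
    have rpi: "rp x i \<in> MFi i" for x using rp(1)[of x] k(2) by (simp add: tuples_def)
    have int: "integrable (D1 i \<Otimes>\<^sub>M D2 i) (\<lambda>w. rp x i w * indicator (A \<times> B) w)" for x
      by (rule m.cell_integrable[OF P[OF k(2)] Q[OF k(2)] rpi k(3,4)])
    have AB [measurable]: "A \<times> B \<in> sets (D1 i \<Otimes>\<^sub>M D2 i)"
      using cellsD(3)[OF P[OF k(2)] k(3)] cellsD(3)[OF Q[OF k(2)] k(4)] by auto
    have rpm [measurable]: "rp x i \<in> borel_measurable (D1 i \<Otimes>\<^sub>M D2 i)" for x using rpi by (rule m.mixed_fun_measurable)
    have S_add: "S (x + y) = vadd Y (S x) (S y)" and S_scale: "S (c *\<^sub>R x) = vscale Y c (S x)"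
      using S by (simp_all add: bounded_linear_op_def type_nspace_def)
    have "AE w in D1 i \<Otimes>\<^sub>M D2 i. rp (x + y) i w = rp x i w + rp y i w"
      using S_add rp by (intro tclass_eq_AE[where \<psi>="\<lambda>i z. rp x i z + rp y i z"] k(2) tuples_add) (simp_all add: tclass_add)
    then have "(\<integral>w. rp (x + y) i w * indicator (A \<times> B) w \<partial>(D1 i \<Otimes>\<^sub>M D2 i))
        = (\<integral>w. rp x i w * indicator (A \<times> B) w + rp y i w * indicator (A \<times> B) w \<partial>(D1 i \<Otimes>\<^sub>M D2 i))"
      by (intro integral_cong_AE) (auto elim!: eventually_mono simp: distrib_right)
    then show "coef k (x + y) = coef k x + coef k y"
      using int by (simp add: coef_def k(1) add_divide_distrib)
    have "AE w in D1 i \<Otimes>\<^sub>M D2 i. rp (c *\<^sub>R x) i w = c * rp x i w"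
      using S_scale rp by (intro tclass_eq_AE[where \<psi>="\<lambda>i z. c * rp x i z"] k(2) tuples_scale) (simp_all add: tclass_scale)
    then have "(\<integral>w. rp (c *\<^sub>R x) i w * indicator (A \<times> B) w \<partial>(D1 i \<Otimes>\<^sub>M D2 i))
        = (\<integral>w. c * (rp x i w * indicator (A \<times> B) w) \<partial>(D1 i \<Otimes>\<^sub>M D2 i))"
      by (intro integral_cong_AE) (auto elim!: eventually_mono)
    then show "coef k (c *\<^sub>R x) = c * coef k x" by (simp add: coef_def k(1))
  qed
  show "T (x + y) = T x + T y" unfolding T_eq by (simp add: coef_add scaleR_add_left sum.distrib)
  show "T (c *\<^sub>R x) = c *\<^sub>R T x" unfolding T_eq by (simp add: coef_scale scaleR_sum_right)
  show "\<exists>B. finite B \<and> range T \<subseteq> span B"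
  proof (intro exI conjI)
    show "finite ((\<lambda>k. R (tclass (\<phi> k))) ` K)" using finK by simp
    show "range T \<subseteq> span ((\<lambda>k. R (tclass (\<phi> k))) ` K)"
    proof (rule image_subsetI)
      show "T x \<in> span ((\<lambda>k. R (tclass (\<phi> k))) ` K)" for x
        unfolding T_eq by (intro span_sum span_scale span_base imageI)
    qed
  qed
qed

theorem retraction_bounded_approximation:
  assumes "retraction_of (type_nspace :: 'x::real_normed_vector nspace) Y"
  shows "\<exists>l\<ge>0. bounded_approximation_property l TYPE('x)"
proof -
  obtain R S where R: "bounded_linear_op Y (type_nspace :: 'x nspace) R"
    and S: "bounded_linear_op (type_nspace :: 'x nspace) Y S"
    and inv: "\<forall>x\<in>vcarrier (type_nspace :: 'x nspace). R (S x) = x"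
    using assms unfolding retraction_of_def by blast
  have RS: "R (S x) = x" for x using inv by (simp add: type_nspace_def)
  have "\<exists>\<phi>. \<phi> \<in> tuples \<and> S x = tclass \<phi>" for x
  proof -
    have "S x \<in> vcarrier Y" using S by (simp add: bounded_linear_op_def type_nspace_def)
    then obtain \<phi> where "\<phi> \<in> tuples" "S x = tclass \<phi>" by (rule carrier_tclass)
    then show ?thesis by blast
  qed
  then obtain rp where rp: "\<And>x. rp x \<in> tuples" "\<And>x. S x = tclass (rp x)" by metis
  have "\<exists>K. \<forall>y\<in>vcarrier Y. norm (R y) \<le> K * vnorm Y y"
    using R by (simp add: bounded_linear_op_def type_nspace_def)
  then obtain KR0 where KR0: "\<forall>y\<in>vcarrier Y. norm (R y) \<le> KR0 * vnorm Y y" ..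
  have "\<exists>K. \<forall>x. vnorm Y (S x) \<le> K * norm x"
    using S by (simp add: bounded_linear_op_def type_nspace_def)
  then obtain KS0 where KS0: "\<forall>x. vnorm Y (S x) \<le> KS0 * norm x" ..
  define KR where "KR = max KR0 1"
  define KS where "KS = max KS0 1"
  have pos: "0 < KR" "0 < KS" by (auto simp: KR_def KS_def)
  have KR: "norm (R (tclass \<phi>)) \<le> KR * tnorm \<phi>" if "\<phi> \<in> tuples" for \<phi>
  proof -
    have "norm (R (tclass \<phi>)) \<le> KR0 * tnorm \<phi>" using bspec[OF KR0 tclass_carrier[OF that]] unfolding tclass_norm[OF that] .
    also have "\<dots> \<le> KR * tnorm \<phi>" by (intro mult_right_mono) (auto simp: KR_def)
    finally show ?thesis .
  qed
  have KS: "tnorm (rp x) \<le> KS * norm x" for x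
  proof -
    have "tnorm (rp x) = vnorm Y (S x)" unfolding rp(2) by (rule tclass_norm[OF rp(1), symmetric])
    also have "\<dots> \<le> KS0 * norm x" using KS0 by blast
    also have "\<dots> \<le> KS * norm x" by (intro mult_right_mono) (auto simp: KS_def)
    finally show ?thesis .
  qed
  define l where "l = KR * KS"
  have l: "0 \<le> l" using pos by (simp add: l_def)
  have "bounded_approximation_property l TYPE('x)"
    unfolding bounded_approximation_property_def
  proof (intro allI impI)
    fix \<epsilon> :: real and C :: "'x set"
    assume \<epsilon>: "0 < \<epsilon>" and C: "compact C"
    \<comment> \<open>A net of mesh \<open>\<delta>\<close>: moving to a net point and back costs \<open>(1 + l) \<delta>\<close>, half of the error; the error
        at the net points takes the other half.\<close>
    define \<delta> where "\<delta> = \<epsilon> / (2 * (1 + l))"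
    have \<delta>: "0 < \<delta>" using \<epsilon> l by (simp add: \<delta>_def)
    obtain F where F: "F \<subseteq> C" "finite F" "C \<subseteq> (\<Union>x\<in>F. ball x \<delta>)"
    proof (rule compactE_image[OF C, of C "\<lambda>x. ball x \<delta>"])
      show "C \<subseteq> (\<Union>x\<in>C. ball x \<delta>)" using \<delta> by auto
      fix F assume "F \<subseteq> C" "finite F" "C \<subseteq> (\<Union>x\<in>F. ball x \<delta>)"
      then show ?thesis by (rule that)
    qed simp
    define e where "e = \<epsilon> / (2 * KR * (real (card I) + 1))"
    have e: "0 < e" using \<epsilon> pos by (simp add: e_def add_nonneg_pos)
    define good where "good i P Q \<longleftrightarrow> cells (D1 i) P \<and> cells (D2 i) Q \<and>
        (\<forall>x\<in>F. MNi i (\<lambda>z. rp x i z - cell_average (D1 i) (D2 i) P Q (rp x i) z) < e)" for i P Q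
    have "\<exists>P Q. i \<in> I \<longrightarrow> good i P Q" for i
    proof (cases "i \<in> I")
      case True
      have rpF: "rp x i \<in> MFi i" if "x \<in> F" for x using rp(1)[of x] True by (simp add: tuples_def)
      show ?thesis
      proof (rule mixed.cell_average_approximates[where f="\<lambda>x. rp x i", OF mixed[OF True] F(2) rpF e])
        fix P Q
        assume "cells (D1 i) P" "cells (D2 i) Q"
          and near: "\<And>x. x \<in> F \<Longrightarrow> MNi i (\<lambda>z. rp x i z - cell_average (D1 i) (D2 i) P Q (rp x i) z) < e"
        then have "good i P Q" by (simp add: good_def)
        then show ?thesis by blast
      qed
    qed blast
    then obtain P Q where "\<And>i. i \<in> I \<Longrightarrow> good i (P i) (Q i)" by metis
    then have PQ: "\<And>i. i \<in> I \<Longrightarrow> cells (D1 i) (P i)" "\<And>i. i \<in> I \<Longrightarrow> cells (D2 i) (Q i)"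
      "\<And>i x. i \<in> I \<Longrightarrow> x \<in> F \<Longrightarrow> MNi i (\<lambda>z. rp x i z - cell_average (D1 i) (D2 i) (P i) (Q i) (rp x i) z) < e"
      unfolding good_def by blast+
    define av where "av x = (\<lambda>i. cell_average (D1 i) (D2 i) (P i) (Q i) (rp x i))" for x
    define T where "T x = R (tclass (av x))" for x
    note rank = retraction_finite_rank[OF R S rp PQ(1,2), folded av_def, folded T_def[abs_def]]
    have T_add: "T (x + y) = T x + T y" and T_scale: "T (c *\<^sub>R x) = c *\<^sub>R T x" for x y c
      using rank(1,2) by (simp_all add: T_def)
    have rpi: "rp x i \<in> MFi i" if "i \<in> I" for x i using rp(1)[of x] that by (simp add: tuples_def)
    have av: "av x \<in> tuples" "tnorm (av x) \<le> tnorm (rp x)" for x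
      using mixed.cell_average_contraction[OF mixed PQ(1,2) rpi]
      by (auto simp: tuples_def av_def intro!: tnorm_le)
    have T_bound: "norm (T x) \<le> l * norm x" for x
    proof -
      have "norm (T x) \<le> KR * tnorm (av x)" unfolding T_def by (rule KR[OF av(1)])
      also have "\<dots> \<le> KR * (KS * norm x)"
        using order_trans[OF av(2) KS, of x] pos by (intro mult_left_mono) auto
      finally show ?thesis by (simp add: l_def mult.assoc)
    qed
    have T_near: "norm (x - T x) \<le> \<epsilon> / 2" if x: "x \<in> F" for x
    proof -
      let ?d = "\<lambda>i z. rp x i z + (- 1) * av x i z"
      have d: "?d \<in> tuples" by (intro tuples_add tuples_scale rp av)
      have "R (tclass ?d) = x - T x"
      proof -
        have add: "R (vadd Y u v) = R u + R v" if "u \<in> vcarrier Y" "v \<in> vcarrier Y" for u v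
          using R that by (simp add: bounded_linear_op_def type_nspace_def)
        have scale: "R (vscale Y a u) = a *\<^sub>R R u" if "u \<in> vcarrier Y" for u a
          using R that by (simp add: bounded_linear_op_def type_nspace_def)
        have m: "(\<lambda>i z. (- 1) * av x i z) \<in> tuples" by (intro tuples_scale av)
        have "R (tclass ?d) = R (tclass (rp x)) + R (tclass (\<lambda>i z. (- 1) * av x i z))"
          using add[OF tclass_carrier[OF rp(1)[of x]] tclass_carrier[OF m]] unfolding tclass_add[OF rp(1)[of x] m] .
        also have "R (tclass (\<lambda>i z. (- 1) * av x i z)) = (- 1) *\<^sub>R T x"
          using scale[OF tclass_carrier[OF av(1)[of x]], of "- 1"] unfolding tclass_scale[OF av(1)[of x]] T_def .
        finally show ?thesis using RS[of x] by (simp add: rp(2)[symmetric])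
      qed
      then have "norm (x - T x) \<le> KR * tnorm ?d" using KR[OF d] by simp
      also have "tnorm ?d \<le> (\<Sum>i\<in>I. e)"
        unfolding tnorm_def
      proof (rule sum_mono)
        fix i assume "i \<in> I"
        from PQ(3)[OF this x] show "MNi i (?d i) \<le> e" by (simp add: av_def)
      qed
      also have "\<dots> \<le> (real (card I) + 1) * e" using e by simp
      also have "KR * ((real (card I) + 1) * e) = \<epsilon> / 2"
      proof -
        have gen: "KR * (n * (\<epsilon> / (2 * KR * n))) = \<epsilon> / 2" if "0 < n" for n
          using pos that by (simp add: field_simps)
        show ?thesis unfolding e_def by (rule gen) (simp add: add_nonneg_pos)
      qed
      finally show ?thesis using pos by simp
    qed
    have near: "norm (x - T x) \<le> \<epsilon>" if x: "x \<in> C" for x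
    proof -
      obtain y where y: "y \<in> F" "norm (x - y) < \<delta>" using F(3) x by (auto simp: dist_norm norm_minus_commute)
      have Tdiff: "T y - T x = T (y - x)" using T_add[of y "- 1 *\<^sub>R x"] T_scale[of "- 1" x] by simp
      have "x - T x = (x - y) + (y - T y) + T (y - x)" unfolding Tdiff[symmetric] by simp
      then have "norm (x - T x) = norm ((x - y) + (y - T y) + T (y - x))" by (rule arg_cong)
      then have "norm (x - T x) \<le> norm (x - y) + norm (y - T y) + norm (T (y - x))"
        using norm_triangle_ineq[of "(x - y) + (y - T y)" "T (y - x)"] norm_triangle_ineq[of "x - y" "y - T y"]
        by linarith
      also have "\<dots> \<le> norm (x - y) + \<epsilon> / 2 + l * norm (y - x)"
        by (intro add_mono T_near y T_bound order_refl)
      also have "\<dots> = (1 + l) * norm (x - y) + \<epsilon> / 2" by (simp add: norm_minus_commute algebra_simps)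
      also have "\<dots> \<le> (1 + l) * \<delta> + \<epsilon> / 2" using y(2) l by (intro add_right_mono mult_left_mono) auto
      also have "\<dots> = \<epsilon>" using l by (simp add: \<delta>_def field_simps)
      finally show ?thesis .
    qed
    show "\<exists>T :: 'x \<Rightarrow> 'x. bounded_linear T \<and> (\<exists>B. finite B \<and> range T \<subseteq> span B) \<and> onorm T \<le> l \<and> (\<forall>x\<in>C. norm (x - T x) \<le> \<epsilon>)"
    proof (intro exI[of _ T] conjI ballI)
      show "bounded_linear T"
        using T_bound by (intro bounded_linear_intro[where K=l] T_add T_scale) (simp add: mult.commute)
      show "\<exists>B. finite B \<and> range T \<subseteq> span B" using rank(3) by (simp add: T_def[abs_def])
      show "onorm T \<le> l" by (rule onorm_bound[OF l T_bound])
    qed (rule near)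
  qed
  then show ?thesis using l by blast
qed

end

theorem proposition3p14:
  fixes M :: "'w measure"
    and W :: "'v::{real_inner, complete_space, second_countable_topology} \<Rightarrow> 'w \<Rightarrow> real"
    and N :: nat
    and p1 p2 :: "nat \<Rightarrow> real"
    and D1 :: "nat \<Rightarrow> 'a measure"
    and D2 :: "nat \<Rightarrow> 'b measure"
    and Y :: "(nat \<Rightarrow> ('a \<times> 'b \<Rightarrow> real) set) nspace"
  assumes "prob_space M"
    and "isonormal_process M W"
    and "generated_by_process M W"
    and "\<And>i. i \<in> {1..N} \<Longrightarrow> 1 \<le> p1 i \<and> 1 \<le> p2 i"
    and "\<And>i. i \<in> {1..N} \<Longrightarrow> sigma_finite_measure (D1 i) \<and> separable_measure (D1 i)"
    and "\<And>i. i \<in> {1..N} \<Longrightarrow> sigma_finite_measure (D2 i) \<and> separable_measure (D2 i)"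
    and Y_eq: "Y = prod_nspace {1..N} (\<lambda>i. mixed_space (p1 i) (p2 i) (D1 i) (D2 i))"
  shows "(isomorphic_with_subspace (type_nspace :: 'x::real_normed_vector nspace) Y \<longrightarrow>
            (\<forall>n. n_good M W n TYPE('x))) \<and>
         (retraction_of (type_nspace :: 'x nspace) Y \<longrightarrow>
            (\<exists>l\<ge>0. bounded_approximation_property l TYPE('x)))"
proof -
  interpret prob_space M by fact
  have "mixed (p1 i) (p2 i) (D1 i) (D2 i)" if "i \<in> {1..N}" for i
    using assms(4-6)[OF that] by (simp add: mixed_def mixed_axioms_def)
  then interpret product: chaos_product M W "{1..N}" p1 p2 D1 D2
    using assms(2)
    by (intro chaos_product.intro isonormal.intro isonormal_axioms.intro mixed_product.intro prob_space_axioms) auto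
  show ?thesis
    unfolding Y_eq using product.isomorphic_n_good product.retraction_bounded_approximation by blast
qed

end
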